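(* Let $T>0$, $p\ge1$, $\delta>0$, $\varepsilon\in(0,1)$. Let $X=\{X(t),t\in\mathbb{R}\}$ be a separable, mean-square continuous, strictly sub-Gaussian random process satisfying condition RC, and $Y(t)=\exp\{X(t)\}$. Assume $X$ admits the expansion (E) with independent strictly sub-Gaussian $\xi_{0k},\eta_{jl}$, where the scaling function $\phi$ and wavelet $\psi$ satisfy: $\hat\phi$ is absolutely continuous; $u(t,y)$ is absolutely continuous in $y$ for each $t$; the derivatives $u'_y(t,y),\hat\phi'(y),\hat\psi'(y)$ exist; $|\hat\psi'(y)|\le C$; $|u(t,y)|\le u_1(y)$ and $|u'_y(t,y)|\le|t|u_2(y)$ with $\int u_1(y)|y|dy$, $\int u_1(y)dy$, $\int u_1|\hat\phi'|dy$, $\int u_1|\hat\phi|dy$, $\int u_2(y)|y|dy$, $\int u_2|\hat\phi|dy$ all finite; and $\lim_{|y|\to\infty}u(t,y)\overline{\hat\psi(y/2^j)}=0$ for all $j\ge0$, $t\in\mathbb{R}$, and $\lim_{|y|\to\infty}u(t,y)|\hat\phi(y)|=0$ for all $t\in\mathbb{R}$. Let $S_1=\frac1{\sqrt{2\pi}}\int u_1|\hat\phi'|dy$, $S_2=\frac1{\sqrt{2\pi}}\int u_2|\hat\phi|dy$, $Q_1=\frac{C}{\sqrt{2\pi}}\int u_1dy$, $Q_2=\frac{C}{\sqrt{2\pi}}\int u_2(y)|y|dy$, $D=\frac{C}{\sqrt{2\pi}}\int u_1(y)|y|dy$, $$m=\frac{\varepsilon\delta^p}{2^{2p}(p/e)^{p/2}\,T\sup_{t\in[0,T]}(\mathsf{E}\exp\{2pX(t)\})^{1/2}},\qquad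 h(x)=x^p(1+\exp\{8p^2x^2\})^{1/4},\ x\ge0,$$ and let $x_m$ be the root of $h(x)=m$. If $N_0,N,M_0,\dots,M_{N-1}$ are positive integers with $N_0>\frac{6}{x_m^2}(S_1+S_2T)^2+1$, $N>\max\{1+\log_2\frac{72(Q_1+Q_2T)^2}{5x_m^2},\,1+\log_8\frac{18D^2}{7x_m^2}\}$, and $M_j>1+\frac{12}{x_m^2}(Q_1+Q_2T)^2(1-2^{-N})$ for $j=0,\dots,N-1$, then the model $\hat Y=\exp\{\hat X\}$ satisfies $$\mathrm{P}\Big\{\Big(\int_0^T|Y(t)-\hat Y(t)|^pdt\Big)^{1/p}>\delta\Big\}\le\varepsilon .$$
   Context: A real random variable $\xi$ is sub-Gaussian if there is $a\ge0$ with $\mathsf{E}\exp\{\lambda\xi\}\le\exp\{\lambda^2a^2/2\}$ for all $\lambda\in\mathbb{R}$; $\tau(\xi)$ is the infimum of such $a$. It is strictly sub-Gaussian if $\tau(\xi)=(\mathsf{E}\xi^2)^{1/2}$. A process $\{X(t),t\in\mathbf{T}\}$ is strictly sub-Gaussian if for any finite or countable set of $\xi_i\in\{X(t)\}$ and reals $\lambda_i$, $\tau^2(\sum\lambda_i\xi_i)=\mathsf{E}(\sum\lambda_i\xi_i)^2$. $\phi$ is the scaling function of a multiresolution analysis of $L_2(\mathbb{R})$ with $\{\phi(\cdot-k),k\in\mathbb{Z}\}$ orthonormal, $\psi$ the corresponding wavelet; $\hat f$ denotes the Fourier transform. Standing setting: $X$ is a centered process with $\mathsf{E}|X(t)|^2<\infty$,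 and there is a Borel function $u(t,\lambda)$ with $\int_{\mathbb{R}}|u(t,\lambda)|^2d\lambda<\infty$ for all $t$ and $R(t,s)=\mathsf{E}X(t)\overline{X(s)}=\int_{\mathbb{R}}u(t,\lambda)\overline{u(s,\lambda)}d\lambda$. Set $a_{0k}(t)=\frac1{\sqrt{2\pi}}\int u(t,y)\overline{\hat\phi(y)}e^{iyk}dy$ and $b_{jl}(t)=\frac1{\sqrt{2\pi}}\int u(t,y)2^{-j/2}e^{iyl/2^j}\overline{\hat\psi(y/2^j)}dy$. Expansion (E): $X(t)=\sum_{k\in\mathbb{Z}}\xi_{0k}a_{0k}(t)+\sum_{j=0}^\infty\sum_{l\in\mathbb{Z}}\eta_{jl}b_{jl}(t)$, converging in $L_2(\Omega)$ for every $t$, where $\xi_{0k},\eta_{jl}$ are centered with $\mathsf{E}\xi_{0k}\overline{\xi_{0l}}=\delta_{kl}$, $\mathsf{E}\eta_{mk}\overline{\eta_{nl}}=\delta_{mn}\delta_{kl}$, $\mathsf{E}\xi_{0k}\overline{\eta_{nl}}=0$. Condition RC: $X$ is as in the standing setting, $u(t,\cdot)\in L_1(\mathbb{R})\cap L_2(\mathbb{R})$ for each $t$, and the inverse Fourier transform of $u(t,x)$ in $x$ is real. Models: $\hat X(t)=\sum_{k=-(N_0-1)}^{N_0-1}\xi_{0k}a_{0k}(t)+\sum_{j=0}^{N-1}\sum_{l=-(M_j-1)}^{M_j-1}\eta_{jl}b_{jl}(t)$ and $\hat Y(t)=\exp\{\hat X(t)\}$. *)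

theory Defs
  imports "HOL-Probability.Probability"
begin

definition sg_bounds :: "'a measure \<Rightarrow> ('a \<Rightarrow> real) \<Rightarrow> real set" where
  "sg_bounds M \<xi> = {a. 0 \<le> a \<and> (\<forall>l::real. integrable M (\<lambda>\<omega>. exp (l * \<xi> \<omega>)) \<and>
      (\<integral>\<omega>. exp (l * \<xi> \<omega>) \<partial>M) \<le> exp (l\<^sup>2 * a\<^sup>2 / 2))}"

definition sub_gaussian :: "'a measure \<Rightarrow> ('a \<Rightarrow> real) \<Rightarrow> bool" where
  "sub_gaussian M \<xi> \<longleftrightarrow> \<xi> \<in> borel_measurable M \<and> sg_bounds M \<xi> \<noteq> {}"

definition sg_tau :: "'a measure \<Rightarrow> ('a \<Rightarrow> real) \<Rightarrow> real" where
  "sg_tau M \<xi> = Inf (sg_bounds M \<xi>)"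

definition strictly_sub_gaussian :: "'a measure \<Rightarrow> ('a \<Rightarrow> real) \<Rightarrow> bool" where
  "strictly_sub_gaussian M \<xi> \<longleftrightarrow>
     sub_gaussian M \<xi> \<and> sg_tau M \<xi> = sqrt (\<integral>\<omega>. (\<xi> \<omega>)\<^sup>2 \<partial>M)"

text \<open>Strictly sub-Gaussian process: every finite or countable linear combination
  \<open>\<Sum> c_i X(t_i)\<close> (countable sums understood as mean-square limits; finite
  combinations are the case of eventually vanishing coefficients) is strictly sub-Gaussian.\<close>
definition strictly_sub_gaussian_process :: "'a measure \<Rightarrow> ('i \<Rightarrow> 'a \<Rightarrow> real) \<Rightarrow> bool" where
  "strictly_sub_gaussian_process M X \<longleftrightarrow>
     (\<forall>(ts::nat \<Rightarrow> 'i) (c::nat \<Rightarrow> real) Z.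
        Z \<in> borel_measurable M \<and> integrable M (\<lambda>\<omega>. (Z \<omega>)\<^sup>2) \<and>
        (\<lambda>n. \<integral>\<omega>. (Z \<omega> - (\<Sum>i<n. c i * X (ts i) \<omega>))\<^sup>2 \<partial>M) \<longlonglongrightarrow> 0
        \<longrightarrow> strictly_sub_gaussian M Z)"

definition separable_process :: "'a measure \<Rightarrow> (real \<Rightarrow> 'a \<Rightarrow> real) \<Rightarrow> bool" where
  "separable_process M X \<longleftrightarrow>
     (\<exists>S N. countable S \<and> closure S = UNIV \<and> N \<in> null_sets M \<and>
        (\<forall>G F. open G \<and> closed (F::real set) \<longrightarrow>
           {\<omega>\<in>space M. \<forall>t\<in>G \<inter> S. X t \<omega> \<in> F} - {\<omega>\<in>space M. \<forall>t\<in>G. X t \<omega> \<in> F} \<subseteq> N))"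

definition ms_continuous :: "'a measure \<Rightarrow> (real \<Rightarrow> 'a \<Rightarrow> real) \<Rightarrow> bool" where
  "ms_continuous M X \<longleftrightarrow>
     (\<forall>t. ((\<lambda>s. \<integral>\<omega>. (X s \<omega> - X t \<omega>)\<^sup>2 \<partial>M) \<longlongrightarrow> 0) (at t))"

definition l2fun :: "(real \<Rightarrow> complex) \<Rightarrow> bool" where
  "l2fun f \<longleftrightarrow> f \<in> borel_measurable lborel \<and> integrable lborel (\<lambda>x. (cmod (f x))\<^sup>2)"

definition l2dist2 :: "(real \<Rightarrow> complex) \<Rightarrow> (real \<Rightarrow> complex) \<Rightarrow> real" where
  "l2dist2 f g = (\<integral>x. (cmod (f x - g x))\<^sup>2 \<partial>lborel)"

text \<open>Fourier transform with the convention \<open>\<hat>f(y) = \<integral> f(x) e^{-iyx} dx\<close>, in the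
  L2 (Plancherel) sense: \<open>F\<close> is the L2-limit of the truncated transforms.\<close>
definition fourier_L2 :: "(real \<Rightarrow> complex) \<Rightarrow> (real \<Rightarrow> complex) \<Rightarrow> bool" where
  "fourier_L2 f F \<longleftrightarrow> F \<in> borel_measurable lborel \<and>
     (\<lambda>n::nat. \<integral>\<^sup>+ y. ennreal ((cmod (F y -
         (LINT x:{- real n..real n}|lborel. f x * exp (- (\<i> * complex_of_real (y * x))))))\<^sup>2) \<partial>lborel)
       \<longlonglongrightarrow> 0"

definition dil :: "int \<Rightarrow> int \<Rightarrow> (real \<Rightarrow> complex) \<Rightarrow> real \<Rightarrow> complex" where
  "dil j k f x = complex_of_real (2 powr (real_of_int j / 2)) * f (2 powr real_of_int j * x - real_of_int k)"

definition cspan_L2 :: "(real \<Rightarrow> complex) set \<Rightarrow> (real \<Rightarrow> complex) set" where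
  "cspan_L2 B = {f. l2fun f \<and> (\<forall>e>0. \<exists>F c. finite F \<and> F \<subseteq> B \<and>
        l2dist2 f (\<lambda>x. \<Sum>g\<in>F. c g * g x) < e)}"

definition mra_V :: "(real \<Rightarrow> complex) \<Rightarrow> int \<Rightarrow> (real \<Rightarrow> complex) set" where
  "mra_V \<phi> j = cspan_L2 (range (\<lambda>k. dil j k \<phi>))"

definition orthonormal_fam :: "(int \<Rightarrow> real \<Rightarrow> complex) \<Rightarrow> bool" where
  "orthonormal_fam g \<longleftrightarrow> (\<forall>k. l2fun (g k)) \<and>
     (\<forall>k l. (LINT x|lborel. g k x * cnj (g l x)) = (if k = l then 1 else 0))"

definition mra_scaling :: "(real \<Rightarrow> complex) \<Rightarrow> bool" where
  "mra_scaling \<phi> \<longleftrightarrow> l2fun \<phi> \<and> orthonormal_fam (\<lambda>k. dil 0 k \<phi>) \<and>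
     (\<forall>j. mra_V \<phi> j \<subseteq> mra_V \<phi> (j + 1)) \<and>
     (\<forall>f. l2fun f \<longrightarrow> (\<forall>e>0. \<exists>j g. g \<in> mra_V \<phi> j \<and> l2dist2 f g < e)) \<and>
     (\<forall>f. (\<forall>j. f \<in> mra_V \<phi> j) \<longrightarrow> (AE x in lborel. f x = 0))"

text \<open>\<open>\<psi>\<close> is the corresponding wavelet: \<open>{\<psi>(\<cdot>-k)}\<close> is an orthonormal basis of the
  orthogonal complement \<open>W_0\<close> of \<open>V_0\<close> in \<open>V_1\<close>.\<close>
definition mra_wavelet :: "(real \<Rightarrow> complex) \<Rightarrow> (real \<Rightarrow> complex) \<Rightarrow> bool" where
  "mra_wavelet \<phi> \<psi> \<longleftrightarrow> mra_scaling \<phi> \<and> l2fun \<psi> \<and>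
     orthonormal_fam (\<lambda>k. dil 0 k \<psi>) \<and> \<psi> \<in> mra_V \<phi> 1 \<and>
     (\<forall>k l. (LINT x|lborel. dil 0 k \<psi> x * cnj (dil 0 l \<phi> x)) = 0) \<and>
     mra_V \<phi> 1 = cspan_L2 (range (\<lambda>k. dil 0 k \<phi>) \<union> range (\<lambda>k. dil 0 k \<psi>))"

definition abs_cont_on :: "real set \<Rightarrow> (real \<Rightarrow> 'b::real_normed_vector) \<Rightarrow> bool" where
  "abs_cont_on S f \<longleftrightarrow> (\<forall>e>0. \<exists>d>0. \<forall>(I::nat set) l r.
      finite I \<and> (\<forall>i\<in>I. l i \<le> r i \<and> {l i..r i} \<subseteq> S) \<and>
      (\<forall>i\<in>I. \<forall>j\<in>I. i \<noteq> j \<longrightarrow> {l i<..<r i} \<inter> {l j<..<r j} = {}) \<and>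
      (\<Sum>i\<in>I. r i - l i) < d \<longrightarrow> (\<Sum>i\<in>I. norm (f (r i) - f (l i))) < e)"

definition abs_cont :: "(real \<Rightarrow> 'b::real_normed_vector) \<Rightarrow> bool" where
  "abs_cont f \<longleftrightarrow> (\<forall>a b. abs_cont_on {a..b} f)"

definition coef_a :: "(real \<Rightarrow> real \<Rightarrow> complex) \<Rightarrow> (real \<Rightarrow> complex) \<Rightarrow> int \<Rightarrow> real \<Rightarrow> complex" where
  "coef_a u \<Phi> k t = (LINT y|lborel. u t y * cnj (\<Phi> y) * exp (\<i> * complex_of_real (y * real_of_int k)))
        / complex_of_real (sqrt (2 * pi))"

definition coef_b :: "(real \<Rightarrow> real \<Rightarrow> complex) \<Rightarrow> (real \<Rightarrow> complex) \<Rightarrow> nat \<Rightarrow> int \<Rightarrow> real \<Rightarrow> complex" where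
  "coef_b u \<Psi> j l t = (LINT y|lborel. u t y * complex_of_real (2 powr (- real j / 2))
        * exp (\<i> * complex_of_real (y * real_of_int l / 2 ^ j)) * cnj (\<Psi> (y / 2 ^ j)))
        / complex_of_real (sqrt (2 * pi))"

definition model_X :: "(real \<Rightarrow> real \<Rightarrow> complex) \<Rightarrow> (real \<Rightarrow> complex) \<Rightarrow> (real \<Rightarrow> complex) \<Rightarrow>
    (int \<Rightarrow> 'a \<Rightarrow> real) \<Rightarrow> (nat \<Rightarrow> int \<Rightarrow> 'a \<Rightarrow> real) \<Rightarrow> nat \<Rightarrow> nat \<Rightarrow> (nat \<Rightarrow> nat) \<Rightarrow>
    real \<Rightarrow> 'a \<Rightarrow> complex" where
  "model_X u \<Phi> \<Psi> \<xi> \<eta> N0 N Mj t \<omega> =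
     (\<Sum>k\<in>{- (int N0 - 1)..int N0 - 1}. complex_of_real (\<xi> k \<omega>) * coef_a u \<Phi> k t) +
     (\<Sum>j<N. \<Sum>l\<in>{- (int (Mj j) - 1)..int (Mj j) - 1}. complex_of_real (\<eta> j l \<omega>) * coef_b u \<Psi> j l t)"

definition hfun :: "real \<Rightarrow> real \<Rightarrow> real" where
  "hfun p x = x powr p * (1 + exp (8 * p\<^sup>2 * x\<^sup>2)) powr (1 / 4)"

end

theory Submission
  imports Defs
begin

text \<open>
  The error \<open>X(t) - Xhat(t)\<close> is a mean-square limit of sums of independent strictly sub-Gaussian
  terms, so its exponential moments are governed by the sum of the squares of the omitted
  coefficients.  Integration by parts in the frequency variable bounds these coefficients by
  \<open>1/|k|\<close> and \<open>2^(-j/2)/|l|\<close> (here \<open>\<Psi> 0 = 0\<close> is needed, which follows from Bessel's inequality for a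
  single test function), and the choice of \<open>N0\<close>, \<open>N\<close>, \<open>Mj\<close> makes the sum at most \<open>xm^2\<close>.
  Two applications of the Cauchy-Schwarz inequality turn this into a bound on
  \<open>E|Y(t) - Yhat(t)|^p\<close>, and Tonelli and Markov finish the proof.

  Tonelli needs joint measurability, which the hypotheses do not grant.  Writing the partial sums
  of the expansion as \<open>- \<integral> du t y * Z_n y dy\<close>, where \<open>Z_n\<close> collects the primitives of the wavelet basis in
  frequency space, Bessel's inequality for \<open>1_[0,y]\<close> bounds \<open>E|Z_n y|^2\<close> by a multiple of \<open>|y|\<close>.
  As \<open>u2\<close> is integrable (because \<open>\<Phi> 0 \<noteq> 0\<close>, by density of the multiresolution analysis), a subsequence
  of the partial sums converges locally uniformly in \<open>t\<close> almost surely; the limit is sample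
  continuous, and separability forces \<open>X\<close> to agree with it at all times off a null set.
\<close>

section \<open>Square-integrable functions\<close>

text \<open>Both values at the origin are read off from one test function, \<open>osc 0 1\<close>,
  whose spectrum is the indicator of [0,1]: paired with basis functions of level j it sees their
  transform only on [0, 2^-j]. A nonzero \<Psi> 0 would make every fine level carry the same
  positive share of its norm; a zero \<Phi> 0 would make its projections onto fine spaces too small
  for density.

  Mean-square convergence at each t says nothing about all t simultaneously. Integrating by parts
  against primitives leaves t only in \<open>du t y\<close>, which is at most \<bar>t\<bar> * u2 y,
  so a single random integral free of t dominates the increments for all t at once.

  The number m is dictated by the last step: if the omitted squares sum to at most x^2, then E|Y(t)
  - Yhat(t)|^p is at most 2^(2p) (p/e)^(p/2) h(x) (E exp(2pX(t)))^(1/2), and h(x) = m makes its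
  integral over [0,T] at most \<epsilon> \<delta>^p, as Markov's inequality requires. The thresholds
  for N0, N and Mj come from splitting xm^2 into thirds.\<close>

definition sq_int :: "'a measure \<Rightarrow> ('a \<Rightarrow> complex) \<Rightarrow> bool" where
  "sq_int M f \<longleftrightarrow> f \<in> borel_measurable M \<and> integrable M (\<lambda>x. (cmod (f x))\<^sup>2)"

text \<open>The measure is arbitrary because the same Hilbert space facts serve the wavelets over
  \<open>lborel\<close> and the random variables over the probability space.\<close>

definition ip :: "'a measure \<Rightarrow> ('a \<Rightarrow> complex) \<Rightarrow> ('a \<Rightarrow> complex) \<Rightarrow> complex" where
  "ip M f g = (LINT x|M. f x * cnj (g x))"

definition nsq :: "'a measure \<Rightarrow> ('a \<Rightarrow> complex) \<Rightarrow> real" where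
  "nsq M f = (LINT x|M. (cmod (f x))\<^sup>2)"

lemma l2fun_eq_sq_int: "l2fun f \<longleftrightarrow> sq_int lborel f"
  by (simp add: l2fun_def sq_int_def)

lemma sq_int_measurable [measurable_dest]: "sq_int M f \<Longrightarrow> f \<in> borel_measurable M"
  by (simp add: sq_int_def)

lemma borel_measurable_cnj [measurable]:
  "f \<in> borel_measurable M \<Longrightarrow> (\<lambda>x. cnj (f x)) \<in> borel_measurable M"
  by (rule borel_measurable_continuous_on[where f=cnj]) (intro continuous_on_cnj continuous_on_id)

lemma sq_int_mult_integrable:
  assumes f: "sq_int M f" and g: "sq_int M g"
  shows "integrable M (\<lambda>x. f x * cnj (g x))"
proof (rule Bochner_Integration.integrable_bound)
  show "integrable M (\<lambda>x. (cmod (f x))\<^sup>2 + (cmod (g x))\<^sup>2)"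
    using f g by (auto simp: sq_int_def)
  show "(\<lambda>x. f x * cnj (g x)) \<in> borel_measurable M"
    using f g by measurable
  have "cmod (f x) * cmod (g x) \<le> (cmod (f x))\<^sup>2 + (cmod (g x))\<^sup>2" for x
    using sum_squares_bound[of "cmod (f x)" "cmod (g x)"] mult_nonneg_nonneg[OF norm_ge_zero norm_ge_zero, of "f x" "g x"]
    by linarith
  then show "AE x in M. norm (f x * cnj (g x)) \<le> norm ((cmod (f x))\<^sup>2 + (cmod (g x))\<^sup>2)"
    by (simp add: norm_mult)
qed

lemma cmod_add_sq_le: "(cmod (a + b))\<^sup>2 \<le> 2 * (cmod a)\<^sup>2 + 2 * (cmod b)\<^sup>2"
proof -
  have "(cmod (a + b))\<^sup>2 \<le> (cmod a + cmod b)\<^sup>2"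
    by (intro power_mono norm_triangle_ineq) auto
  also have "\<dots> \<le> 2 * (cmod a)\<^sup>2 + 2 * (cmod b)\<^sup>2"
    using sum_squares_bound[of "cmod a" "cmod b"] by (simp add: power2_sum)
  finally show ?thesis .
qed

lemma sq_int_add:
  assumes f: "sq_int M f" and g: "sq_int M g"
  shows "sq_int M (\<lambda>x. f x + g x)"
  unfolding sq_int_def
proof
  show "(\<lambda>x. f x + g x) \<in> borel_measurable M" using f g by measurable
  show "integrable M (\<lambda>x. (cmod (f x + g x))\<^sup>2)"
  proof (rule Bochner_Integration.integrable_bound)
    show "integrable M (\<lambda>x. 2 * (cmod (f x))\<^sup>2 + 2 * (cmod (g x))\<^sup>2)"
      using f g by (auto simp: sq_int_def)
    show "(\<lambda>x. (cmod (f x + g x))\<^sup>2) \<in> borel_measurable M" using f g by measurable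
    show "AE x in M. norm ((cmod (f x + g x))\<^sup>2) \<le> norm (2 * (cmod (f x))\<^sup>2 + 2 * (cmod (g x))\<^sup>2)"
      using cmod_add_sq_le by (intro AE_I2) simp
  qed
qed

lemma sq_int_scale: "sq_int M f \<Longrightarrow> sq_int M (\<lambda>x. c * f x)"
  by (auto simp: sq_int_def norm_mult power_mult_distrib)

lemma sq_int_diff: "sq_int M f \<Longrightarrow> sq_int M g \<Longrightarrow> sq_int M (\<lambda>x. f x - g x)"
  using sq_int_add[of M f "\<lambda>x. (-1) * g x"] sq_int_scale[of M g "-1"] by simp

lemma sq_int_sum:
  "(\<And>i. i \<in> I \<Longrightarrow> sq_int M (f i)) \<Longrightarrow> sq_int M (\<lambda>x. \<Sum>i\<in>I. f i x)"
  by (induction I rule: infinite_finite_induct) (auto intro: sq_int_add simp: sq_int_def[of M "\<lambda>_. 0"])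

lemma ip_self: "ip M f f = complex_of_real (nsq M f)"
proof -
  have "ip M f f = (LINT x|M. complex_of_real ((cmod (f x))\<^sup>2))"
    unfolding ip_def by (intro Bochner_Integration.integral_cong) (auto simp: complex_norm_square simp del: of_real_power)
  then show ?thesis by (simp add: nsq_def del: of_real_power)
qed

lemma nsq_nonneg: "nsq M f \<ge> 0"
  by (simp add: nsq_def)

lemma ip_cnj: "ip M g f = cnj (ip M f g)"
  unfolding ip_def by (subst Bochner_Integration.integral_cnj[symmetric]) (simp add: mult.commute)

lemma ip_diff_left:
  "sq_int M f \<Longrightarrow> sq_int M g \<Longrightarrow> sq_int M h \<Longrightarrow> ip M (\<lambda>x. f x - g x) h = ip M f h - ip M g h"
  unfolding ip_def by (simp add: left_diff_distrib sq_int_mult_integrable)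

lemma ip_scale_left: "ip M (\<lambda>x. c * f x) h = c * ip M f h"
  unfolding ip_def by (simp add: mult.assoc)

lemma ip_sum_left:
  assumes "\<And>i. i \<in> I \<Longrightarrow> sq_int M (f i)" "sq_int M h"
  shows "ip M (\<lambda>x. \<Sum>i\<in>I. f i x) h = (\<Sum>i\<in>I. ip M (f i) h)"
  unfolding ip_def using assms
  by (simp add: sum_distrib_right Bochner_Integration.integral_sum sq_int_mult_integrable)

lemma ip_diff_right:
  "sq_int M f \<Longrightarrow> sq_int M g \<Longrightarrow> sq_int M h \<Longrightarrow> ip M h (\<lambda>x. f x - g x) = ip M h f - ip M h g"
  by (subst (1 2 3) ip_cnj) (simp add: ip_diff_left)

lemma ip_scale_right: "ip M h (\<lambda>x. c * f x) = cnj c * ip M h f"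
  by (subst (1 2) ip_cnj) (simp add: ip_scale_left)

lemma ip_sum_right:
  assumes "\<And>i. i \<in> I \<Longrightarrow> sq_int M (f i)" "sq_int M h"
  shows "ip M h (\<lambda>x. \<Sum>i\<in>I. f i x) = (\<Sum>i\<in>I. ip M h (f i))"
proof -
  have "ip M h (\<lambda>x. \<Sum>i\<in>I. f i x) = cnj (\<Sum>i\<in>I. ip M (f i) h)"
    by (subst ip_cnj) (simp only: ip_sum_left[OF assms])
  then show ?thesis by (simp add: ip_cnj[of M h])
qed

text \<open>Pythagoras around the orthogonal projection: residual of the best approximation plus
  squared deviations of the coefficients. Bessel's inequality, the lower bound for any approximation
  and the norm of a combination are the cases of optimal \<open>c\<close>, arbitrary
  \<open>c\<close> and \<open>h = 0\<close>.\<close>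

lemma nsq_diff_sum:
  assumes fin: "finite I" and h: "sq_int M h" and g: "\<And>i. i \<in> I \<Longrightarrow> sq_int M (g i)"
    and orth: "\<And>i j. i \<in> I \<Longrightarrow> j \<in> I \<Longrightarrow> ip M (g i) (g j) = (if i = j then 1 else 0)"
  shows "nsq M (\<lambda>x. h x - (\<Sum>i\<in>I. c i * g i x))
    = nsq M h - (\<Sum>i\<in>I. (cmod (ip M h (g i)))\<^sup>2) + (\<Sum>i\<in>I. (cmod (c i - ip M h (g i)))\<^sup>2)"
proof -
  define s where "s = (\<lambda>x. \<Sum>i\<in>I. c i * g i x)"
  have s: "sq_int M s" unfolding s_def by (intro sq_int_sum sq_int_scale g)
  have hs: "ip M h s = (\<Sum>i\<in>I. cnj (c i) * ip M h (g i))"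
    unfolding s_def by (subst ip_sum_right) (auto simp: ip_scale_right intro: sq_int_scale g h)
  have gs: "ip M (g j) s = cnj (c j)" if "j \<in> I" for j
  proof -
    have "ip M (g j) s = (\<Sum>i\<in>I. cnj (c i) * ip M (g j) (g i))"
      unfolding s_def by (subst ip_sum_right) (auto simp: ip_scale_right intro: sq_int_scale g that)
    also have "\<dots> = (\<Sum>i\<in>I. if j = i then cnj (c i) else 0)"
      by (intro sum.cong) (auto simp: orth that)
    finally show ?thesis using fin that by (simp add: sum.delta)
  qed
  have ss: "ip M s s = (\<Sum>i\<in>I. c i * cnj (c i))"
  proof -
    have "ip M s s = (\<Sum>i\<in>I. c i * ip M (g i) s)"
      by (subst (1) s_def, subst ip_sum_left) (auto simp: ip_scale_left intro: sq_int_scale g s)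
    then show ?thesis by (simp add: gs cong: sum.cong)
  qed
  have "complex_of_real (nsq M (\<lambda>x. h x - s x)) = ip M h h - ip M h s - (cnj (ip M h s) - ip M s s)"
    unfolding ip_self[symmetric] using h s
    by (simp add: ip_diff_left ip_diff_right sq_int_diff ip_cnj[of M s h])
  also have "\<dots> = complex_of_real (nsq M h - (\<Sum>i\<in>I. (cmod (ip M h (g i)))\<^sup>2) + (\<Sum>i\<in>I. (cmod (c i - ip M h (g i)))\<^sup>2))"
    unfolding hs ss unfolding ip_self
    by (simp add: complex_norm_square del: of_real_power)
      (simp add: algebra_simps sum.distrib sum_subtractf)
  finally show ?thesis unfolding s_def by (simp only: of_real_eq_iff)
qed

lemma bessel:
  assumes "finite I" "sq_int M h" "\<And>i. i \<in> I \<Longrightarrow> sq_int M (g i)"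
    "\<And>i j. i \<in> I \<Longrightarrow> j \<in> I \<Longrightarrow> ip M (g i) (g j) = (if i = j then 1 else 0)"
  shows "(\<Sum>i\<in>I. (cmod (ip M h (g i)))\<^sup>2) \<le> nsq M h"
  using nsq_diff_sum[OF assms, of "\<lambda>i. ip M h (g i)"] nsq_nonneg[of M "\<lambda>x. h x - (\<Sum>i\<in>I. ip M h (g i) * g i x)"]
  by simp

lemma nsq_diff_sum_ge:
  assumes "finite I" "sq_int M h" "\<And>i. i \<in> I \<Longrightarrow> sq_int M (g i)"
    "\<And>i j. i \<in> I \<Longrightarrow> j \<in> I \<Longrightarrow> ip M (g i) (g j) = (if i = j then 1 else 0)"
  shows "nsq M h - (\<Sum>i\<in>I. (cmod (ip M h (g i)))\<^sup>2) \<le> nsq M (\<lambda>x. h x - (\<Sum>i\<in>I. c i * g i x))"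
  using nsq_diff_sum[OF assms, of c] by (simp add: sum_nonneg)

lemma nsq_sum:
  assumes "finite I" "\<And>i. i \<in> I \<Longrightarrow> sq_int M (g i)"
    "\<And>i j. i \<in> I \<Longrightarrow> j \<in> I \<Longrightarrow> ip M (g i) (g j) = (if i = j then 1 else 0)"
  shows "nsq M (\<lambda>x. \<Sum>i\<in>I. c i * g i x) = (\<Sum>i\<in>I. (cmod (c i))\<^sup>2)"
  using nsq_diff_sum[of I M "\<lambda>_. 0" g "\<lambda>i. - c i"] assms
  by (simp add: sq_int_def[of M "\<lambda>_. 0"] nsq_def[of M "\<lambda>_. 0"] ip_def[of M "\<lambda>_. 0"] sum_negf)

text \<open>This is Bessel's inequality for the one-element family consisting of the normalised
  \<open>g\<close>; if \<open>nsq M g\<close> is zero, \<open>g\<close> vanishes almost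
  everywhere.\<close>

lemma ip_cauchy_schwarz:
  assumes f: "sq_int M f" and g: "sq_int M g"
  shows "(cmod (ip M f g))\<^sup>2 \<le> nsq M f * nsq M g"
proof (cases "nsq M g = 0")
  case True
  then have "AE x in M. (cmod (g x))\<^sup>2 = 0"
    using g unfolding nsq_def sq_int_def by (subst integral_nonneg_eq_0_iff_AE[symmetric]) auto
  then have "AE x in M. f x * cnj (g x) = 0" by eventually_elim auto
  then have "ip M f g = 0" unfolding ip_def by (rule integral_eq_zero_AE)
  then show ?thesis by (simp add: nsq_nonneg)
next
  case False
  then have p: "nsq M g > 0" using nsq_nonneg[of M g] by simp
  define r where "r = sqrt (nsq M g)"
  have r: "r > 0" "r\<^sup>2 = nsq M g" using p by (auto simp: r_def)
  define g' where "g' = (\<lambda>x. complex_of_real (1 / r) * g x)"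
  have "(\<Sum>i\<in>{()}. (cmod (ip M f g'))\<^sup>2) \<le> nsq M f"
  proof (rule bessel[where g="\<lambda>_. g'"])
    show "sq_int M g'" unfolding g'_def by (intro sq_int_scale g)
    show "ip M g' g' = (if i = j then 1 else 0)" for i j :: unit
      using r p unfolding g'_def ip_scale_left ip_scale_right ip_self
      by (simp add: r(2)[symmetric] power2_eq_square)
  qed (use f in auto)
  then have "(cmod (ip M f g) / r)\<^sup>2 \<le> nsq M f"
    using r unfolding g'_def ip_scale_right by (simp add: norm_mult norm_divide)
  then show ?thesis using p by (simp add: power_divide r(2) field_simps)
qed

section \<open>Fourier pairing with compactly supported exponentials\<close>

text \<open>Up to normalisation, the inverse Fourier transform of the indicator of [a,b]. Pairing
  with it converts integrals of a transform over [a,b] into inner products in the time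
  domain.\<close>

definition osc :: "real \<Rightarrow> real \<Rightarrow> real \<Rightarrow> complex" where
  "osc a b x = (LBINT v:{a..b}. iexp (v * x))"

lemma set_integrable_exp_ii: "set_integrable lborel {a..b} (\<lambda>v. iexp (v * x))"
  by (intro borel_integrable_atLeastAtMost' continuous_intros)

lemma cmod_osc_le:
  assumes "a \<le> b" shows "cmod (osc a b x) \<le> b - a"
proof -
  have "cmod (osc a b x) \<le> (LBINT v:{a..b}. cmod (iexp (v * x)))"
    unfolding osc_def set_lebesgue_integral_def
    by (rule order_trans[OF integral_norm_bound]) (auto intro!: Bochner_Integration.integral_cong)
  also have "\<dots> = b - a"
    using assms by (simp add: set_lebesgue_integral_def)
  finally show ?thesis .
qed

lemma osc_eq:
  assumes "a \<le> b" "x \<noteq> 0"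
  shows "osc a b x = (iexp (b * x) - iexp (a * x)) / (\<i> * complex_of_real x)"
proof -
  have "((\<lambda>v. iexp (v * x) / (\<i> * complex_of_real x)) has_vector_derivative
     iexp (v * x)) (at v within {a..b})" for v
  proof -
    have "((\<lambda>z. exp (\<i> * (z * complex_of_real x)) / (\<i> * complex_of_real x)) has_field_derivative
        exp (\<i> * (complex_of_real v * complex_of_real x))) (at (complex_of_real v))"
      using assms(2) by (auto intro!: derivative_eq_intros simp: field_simps)
    from has_vector_derivative_real_field[OF this] show ?thesis by simp
  qed
  then have "osc a b x = iexp (b * x) / (\<i> * complex_of_real x) - iexp (a * x) / (\<i> * complex_of_real x)"
    unfolding osc_def set_lebesgue_integral_def
    by (intro integral_FTC_atLeastAtMost assms continuous_intros)
  then show ?thesis by (simp add: diff_divide_distrib)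
qed

lemma cmod_osc_le_inverse:
  assumes "a \<le> b" "x \<noteq> 0" shows "cmod (osc a b x) \<le> 2 / \<bar>x\<bar>"
proof -
  have "cmod (iexp (b * x) - iexp (a * x)) \<le> 1 + 1"
    by (rule order_trans[OF norm_triangle_ineq4]) (simp)
  then show ?thesis
    unfolding osc_eq[OF assms] norm_divide norm_mult using assms(2) by (simp add: divide_right_mono)
qed

lemma osc_measurable [measurable]: "osc a b \<in> borel_measurable borel"
  unfolding osc_def set_lebesgue_integral_def by measurable

lemma integrable_indicator_Icc: "integrable lborel (\<lambda>v. indicator {a..b} v *\<^sub>R c)"
  for a b :: real and c :: "'a::{banach, second_countable_topology}"
  using borel_integrable_atLeastAtMost'[of a b "\<lambda>_. c"] by (simp add: set_integrable_def)

lemma integrable_inverse_one_plus_square: "integrable lborel (\<lambda>x::real. 1 / (1 + x\<^sup>2))"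
proof -
  let ?f = "\<lambda>x::real. 1 / (1 + x\<^sup>2)"
  have 1: "integrable lborel (\<lambda>x. indicator {0<..} x *\<^sub>R ?f x)"
    using integrable_I0i_1_div_plus_square
    by (simp add: interval_lebesgue_integrable_def set_integrable_def zero_ereal_def)
  have 2: "integrable lborel (\<lambda>x. indicator {0<..} (-x) *\<^sub>R ?f (-x))"
    using lborel_integrable_real_affine[OF 1, of "-1" 0] by simp
  have "integrable lborel (\<lambda>x. indicator {0<..} x *\<^sub>R ?f x + indicator {0<..} (-x) *\<^sub>R ?f (-x))"
    using 1 2 by (rule Bochner_Integration.integrable_add)
  then show ?thesis
    by (rule integrable_cong_AE_imp)
      (use AE_lborel_singleton[of "0::real"] in \<open>auto elim!: eventually_mono simp: indicator_def\<close>)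
qed

text \<open>Merges the trivial bound b - a with the decay 2/\<bar>x\<bar> into one integrable
  majorant. With d = b - a, if (d x)^2 \<le> 4 then 1 + (d x)^2 \<le> 5; otherwise 1 + (d x)^2 \<le>
  (5/4) (d x)^2, and 4 * 5/4 is again 5.\<close>

lemma osc_sq_le:
  assumes "a \<le> b"
  shows "(cmod (osc a b x))\<^sup>2 \<le> 5 * (b - a)\<^sup>2 / (1 + ((b - a) * x)\<^sup>2)"
proof -
  define d where "d = b - a"
  have d: "d \<ge> 0" using assms by (simp add: d_def)
  have pos: "1 + (d * x)\<^sup>2 > 0" by (smt (verit) zero_le_power2)
  show ?thesis
  proof (cases "(d * x)\<^sup>2 \<le> 4")
    case True
    have "(cmod (osc a b x))\<^sup>2 * (1 + (d * x)\<^sup>2) \<le> d\<^sup>2 * 5"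
      using True cmod_osc_le[OF assms, of x] by (intro mult_mono power_mono) (auto simp: d_def)
    then show ?thesis using pos by (simp add: d_def[symmetric] field_simps)
  next
    case False
    then have x: "x \<noteq> 0" by auto
    have "(cmod (osc a b x))\<^sup>2 \<le> (2 / \<bar>x\<bar>)\<^sup>2"
      using cmod_osc_le_inverse[OF assms x] by (intro power_mono) auto
    then have "(cmod (osc a b x))\<^sup>2 * (1 + (d * x)\<^sup>2) \<le> (4 / x\<^sup>2) * (1 + (d*x)\<^sup>2)"
      using pos by (intro mult_right_mono) (auto simp: power_divide)
    also have "\<dots> \<le> (4 / x\<^sup>2) * ((d*x)\<^sup>2 * (5/4))"
      using False by (intro mult_left_mono) auto
    also have "\<dots> = 5 * d\<^sup>2" using x by (simp add: power_mult_distrib)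
    finally show ?thesis using pos by (simp add: d_def[symmetric] field_simps)
  qed
qed

definition osc_const :: real where
  "osc_const = 5 * (LINT x|lborel. 1 / (1 + x\<^sup>2))"

lemma osc_const_nonneg: "osc_const \<ge> 0"
  by (simp add: osc_const_def)

lemma osc_dominator_integrable:
  "d \<noteq> 0 \<Longrightarrow> integrable lborel (\<lambda>x. 5 * d\<^sup>2 / (1 + (d * x)\<^sup>2))" for d :: real
  using integrable_mult_right[OF lborel_integrable_real_affine[OF integrable_inverse_one_plus_square, of d 0], of "5 * d\<^sup>2"]
  by simp

lemma sq_int_osc:
  assumes "a \<le> b" shows "sq_int lborel (osc a b)"
proof (cases "a = b")
  case True
  then have "osc a b x = 0" for x using cmod_osc_le[OF assms, of x] by simp
  then show ?thesis by (simp add: sq_int_def)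
next
  case False
  have "integrable lborel (\<lambda>x. (cmod (osc a b x))\<^sup>2)"
    by (rule Bochner_Integration.integrable_bound[OF osc_dominator_integrable[of "b - a"]])
      (use False osc_sq_le[OF assms] in \<open>auto intro!: AE_I2 order_trans[OF _ abs_ge_self]\<close>)
  then show ?thesis by (simp add: sq_int_def)
qed

text \<open>Rescaling x by b - a shows that the majorant has integral proportional to b - a.
  Plancherel would give the constant 2 pi; what matters later is linear growth in the
  length.\<close>

lemma nsq_osc_le:
  assumes "a \<le> b" shows "nsq lborel (osc a b) \<le> osc_const * (b - a)"
proof (cases "a = b")
  case True
  then have "osc a b x = 0" for x using cmod_osc_le[OF assms, of x] by simp
  then show ?thesis using True by (simp add: nsq_def)
next
  case False
  define d where "d = b - a"
  have d: "d > 0" using assms False by (simp add: d_def)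
  have "nsq lborel (osc a b) \<le> (LINT x|lborel. 5 * d\<^sup>2 / (1 + (d * x)\<^sup>2))"
    unfolding nsq_def using sq_int_osc[OF assms] d osc_sq_le[OF assms]
    by (intro integral_mono osc_dominator_integrable) (auto simp: sq_int_def d_def)
  also have "\<dots> = 5 * d\<^sup>2 * (LINT x|lborel. 1 / (1 + (0 + d * x)\<^sup>2))"
    by (subst Bochner_Integration.integral_mult_right_zero[symmetric]) simp
  also have "(LINT x|lborel. 1 / (1 + (0 + d * x)\<^sup>2)) = (LINT x|lborel. 1 / (1 + x\<^sup>2)) / d"
    using d lborel_integral_real_affine[of d "\<lambda>x. 1 / (1 + x\<^sup>2)" 0] by (simp add: field_simps)
  also have "5 * d\<^sup>2 * ((LINT x|lborel. 1 / (1 + x\<^sup>2)) / d) = osc_const * d"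
    using d by (simp add: osc_const_def power2_eq_square)
  finally show ?thesis by (simp add: d_def)
qed

lemma sq_int_shift: "sq_int lborel f \<Longrightarrow> sq_int lborel (\<lambda>x. f (x + s))" for s :: real
  unfolding sq_int_def
  using lborel_integrable_real_affine[of "\<lambda>x. (cmod (f x))\<^sup>2" 1 s] by (auto simp: add.commute)

lemma sq_int_set_integrable:
  assumes f: "sq_int lborel f" shows "set_integrable lborel {a..b::real} f"
  unfolding set_integrable_def
proof (rule Bochner_Integration.integrable_bound)
  show "integrable lborel (\<lambda>x. indicator {a..b} x *\<^sub>R 1 + (cmod (f x))\<^sup>2)"
    using f borel_integrable_atLeastAtMost'[of a b "\<lambda>_. 1::real"]
    by (intro Bochner_Integration.integrable_add) (auto simp: sq_int_def set_integrable_def)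
  have "cmod z \<le> 1 + (cmod z)\<^sup>2" for z
    using sum_squares_bound[of 1 "cmod z"] norm_ge_zero[of z]
    unfolding one_power2 mult_1_right by linarith
  then show "AE x in lborel. norm (indicator {a..b} x *\<^sub>R f x) \<le> norm (indicator {a..b} x *\<^sub>R 1 + (cmod (f x))\<^sup>2)"
    by (auto simp: indicator_def)
qed (use f in measurable)

text \<open>Fubini on a bounded rectangle. A square-integrable \<open>f\<close> is absolutely
  integrable on [-r, r] but perhaps not on the line, hence the truncation.\<close>

lemma fourier_truncated_pairing:
  assumes f: "sq_int lborel f"
  shows "(LBINT v:{a..b}. cnj (LINT x:{- r..r}|lborel. f x * exp (- (\<i> * complex_of_real (v * x)))) * iexp (v * s))
    = (LBINT x:{- r..r}. osc a b (x + s) * cnj (f x))"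
proof -
  define H where "H v x = (indicator {a..b} v *\<^sub>R indicator {- r..r} x *\<^sub>R (cnj (f x) * iexp (v * (x + s))) :: complex)" for v x
  have [measurable]: "f \<in> borel_measurable borel" using f by (auto simp: sq_int_def)
  have fi: "integrable lborel (\<lambda>x. indicator {- r..r} x *\<^sub>R f x)"
    using sq_int_set_integrable[OF f] by (simp add: set_integrable_def)
  then have fin: "integrable lborel (\<lambda>x. indicator {- r..r} x * cmod (f x))"
    using integrable_norm[OF fi] by simp
  have H: "integrable (lborel \<Otimes>\<^sub>M lborel) (case_prod H)"
  proof (rule lborel_pair.Fubini_integrable)
    show "case_prod H \<in> borel_measurable (lborel \<Otimes>\<^sub>M lborel)"
      unfolding H_def by measurable
    have "(LINT y|lborel. norm (case_prod H (x, y))) = indicator {a..b} x *\<^sub>R (LINT y|lborel. indicator {- r..r} y * cmod (f y))" for x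
      by (simp add: H_def norm_mult mult.assoc)
    then show "integrable lborel (\<lambda>x. LINT y|lborel. norm (case_prod H (x, y)))"
      using borel_integrable_atLeastAtMost'[of a b "\<lambda>_. (LINT y|lborel. indicator {- r..r} y * cmod (f y))"]
      by (simp add: set_integrable_def)
    show "AE x in lborel. integrable lborel (\<lambda>y. case_prod H (x, y))"
    proof (rule AE_I2)
      fix x show "integrable lborel (\<lambda>y. case_prod H (x, y))"
        by (rule Bochner_Integration.integrable_bound[OF fin])
          (auto simp: H_def norm_mult indicator_def)
    qed
  qed
  have "(LBINT v:{a..b}. cnj (LINT x:{- r..r}|lborel. f x * exp (- (\<i> * complex_of_real (v * x)))) * iexp (v * s))
      = (LINT v|lborel. LINT x|lborel. H v x)"
    unfolding set_lebesgue_integral_def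
  proof (rule Bochner_Integration.integral_cong[OF refl], goal_cases)
    case (1 v)
    have "(LINT x|lborel. H v x) = (LINT x|lborel. (indicator {a..b} v *\<^sub>R iexp (v * s)) * (indicator {- r..r} x *\<^sub>R (cnj (f x * exp (- (\<i> * complex_of_real (v * x)))))))"
      by (intro Bochner_Integration.integral_cong)
        (auto simp: H_def indicator_def exp_cnj exp_add[symmetric] algebra_simps)
    also have "\<dots> = (indicator {a..b} v *\<^sub>R iexp (v * s)) * cnj (LINT x|lborel. indicator {- r..r} x *\<^sub>R (f x * exp (- (\<i> * complex_of_real (v * x)))))"
      unfolding integral_mult_right_zero
      by (subst Bochner_Integration.integral_cnj[symmetric]) (simp del: complex_cnj_mult)
    finally show ?case by (simp add: mult.commute)
  qed
  also have "\<dots> = (LINT x|lborel. LINT v|lborel. H v x)"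
    by (rule lborel_pair.Fubini_integral[OF H, symmetric])
  also have "\<dots> = (LBINT x:{- r..r}. osc a b (x + s) * cnj (f x))"
    unfolding set_lebesgue_integral_def
  proof (rule Bochner_Integration.integral_cong[OF refl], goal_cases)
    case (1 x)
    have "(LINT v|lborel. H v x) = (LINT v|lborel. (indicator {- r..r} x *\<^sub>R cnj (f x)) * (indicator {a..b} v *\<^sub>R iexp (v * (x + s))))"
      by (intro Bochner_Integration.integral_cong) (auto simp: H_def indicator_def)
    then show ?case unfolding integral_mult_right_zero by (simp add: osc_def set_lebesgue_integral_def mult.commute)
  qed
  finally show ?thesis .
qed

text \<open>A Parseval identity with one factor supported in [a,b], obtained by letting the
  truncation grow: Cauchy-Schwarz on [a,b] handles the frequency side, dominated convergence the
  time side.\<close>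

lemma fourier_pairing:
  assumes F: "fourier_L2 f F" and f: "sq_int lborel f" and contF: "continuous_on UNIV F" and ab: "a \<le> b"
  shows "(LBINT v:{a..b}. cnj (F v) * iexp (v * s)) = ip lborel (\<lambda>x. osc a b (x + s)) f"
proof -
  define Fn where "Fn n v = (LINT x:{- real n..real n}|lborel. f x * exp (- (\<i> * complex_of_real (v * x))))" for n :: nat and v
  define L where "L n = (LBINT v:{a..b}. cnj (Fn n v) * iexp (v * s))" for n
  define L0 where "L0 = (LBINT v:{a..b}. cnj (F v) * iexp (v * s))"
  have [measurable]: "f \<in> borel_measurable borel" using f by (auto simp: sq_int_def)
  have [measurable]: "F \<in> borel_measurable borel" using F by (auto simp: fourier_L2_def)
  have [measurable]: "Fn n \<in> borel_measurable borel" for n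
    unfolding Fn_def set_lebesgue_integral_def by measurable
  define e where "e n = (\<integral>\<^sup>+ y. ennreal ((cmod (F y - Fn n y))\<^sup>2) \<partial>lborel)" for n
  have e0: "e \<longlonglongrightarrow> 0" using F unfolding fourier_L2_def e_def Fn_def by simp
  \<comment> \<open>\<open>fourier_L2\<close> asserts convergence of an extended nonnegative
    integral, so \<open>F - Fn n\<close> is known to be square integrable only from some n
    on.\<close>
  have e_fin: "\<forall>\<^sub>F n in sequentially. e n < \<infinity>"
    using e0 by (rule order_tendstoD(2)) simp
  have sq: "sq_int lborel (\<lambda>y. F y - Fn n y)" "nsq lborel (\<lambda>y. F y - Fn n y) = enn2real (e n)" if "e n < \<infinity>" for n
  proof -
    have "integrable lborel (\<lambda>y. (cmod (F y - Fn n y))\<^sup>2)"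
      using that by (intro integrableI_bounded) (auto simp: e_def)
    then show "sq_int lborel (\<lambda>y. F y - Fn n y)" by (simp add: sq_int_def)
    show "nsq lborel (\<lambda>y. F y - Fn n y) = enn2real (e n)"
      unfolding nsq_def e_def by (subst integral_eq_nn_integral) auto
  qed
  define E where "E v = indicator {a..b} v *\<^sub>R iexp (v * s)" for v
  have E2: "(cmod (E v))\<^sup>2 = indicator {a..b} v *\<^sub>R 1" for v by (auto simp: E_def indicator_def)
  have [measurable]: "E \<in> borel_measurable borel" unfolding E_def[abs_def] by measurable
  have E: "sq_int lborel E" "nsq lborel E = b - a"
    using borel_integrable_atLeastAtMost'[of a b "\<lambda>_. 1::real"] ab
    unfolding sq_int_def nsq_def E2 by (auto simp: set_integrable_def)
  have Fint: "set_integrable lborel {a..b} (\<lambda>v. cnj (F v) * iexp (v * s))"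
    by (intro borel_integrable_atLeastAtMost' continuous_intros continuous_on_subset[OF contF]) auto
  have diff: "(cmod (L0 - L n))\<^sup>2 \<le> (b - a) * enn2real (e n)" if "e n < \<infinity>" for n
  proof -
    have i: "integrable lborel (\<lambda>v. E v * cnj (F v - Fn n v))"
      by (rule sq_int_mult_integrable[OF E(1) sq(1)[OF that]])
    have i0: "integrable lborel (\<lambda>v. E v * cnj (F v))"
      using Fint by (simp add: set_integrable_def E_def mult.commute)
    have i1: "integrable lborel (\<lambda>v. E v * cnj (Fn n v))"
      using Bochner_Integration.integrable_diff[OF i0 i] by (simp add: algebra_simps)
    have "L0 - L n = ip lborel E (\<lambda>y. F y - Fn n y)"
      unfolding L0_def L_def ip_def set_lebesgue_integral_def
      using Bochner_Integration.integral_diff[OF i0 i1]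
      by (simp add: E_def algebra_simps)
    then show ?thesis
      using ip_cauchy_schwarz[OF E(1) sq(1)[OF that]] sq(2)[OF that] E(2) by simp
  qed
  have "(\<lambda>n. (b - a) * enn2real (e n)) \<longlonglongrightarrow> (b - a) * enn2real 0"
    using tendsto_enn2real[of e 0 sequentially] e0 by (intro tendsto_mult tendsto_const) simp_all
  then have "(\<lambda>n. (cmod (L0 - L n))\<^sup>2) \<longlonglongrightarrow> 0"
    by (intro tendsto_sandwich[of "\<lambda>_. 0" "\<lambda>n. (cmod (L0 - L n))\<^sup>2" sequentially "\<lambda>n. (b - a) * enn2real (e n)"])
      (auto intro: eventually_mono[OF e_fin] diff)
  then have "(\<lambda>n. cmod (L0 - L n)) \<longlonglongrightarrow> 0"
    using tendsto_real_sqrt[of "\<lambda>n. (cmod (L0 - L n))\<^sup>2" 0] by simp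
  then have "(\<lambda>n. L n - L0) \<longlonglongrightarrow> 0"
    by (subst (asm) norm_minus_commute) (rule tendsto_norm_zero_cancel)
  then have L: "L \<longlonglongrightarrow> L0" by (rule LIM_zero_cancel)
  have "L = (\<lambda>n. LBINT x:{- real n..real n}. osc a b (x + s) * cnj (f x))"
    unfolding L_def Fn_def fourier_truncated_pairing[OF f] ..
  moreover have "(\<lambda>n. LBINT x:{- real n..real n}. osc a b (x + s) * cnj (f x)) \<longlonglongrightarrow> ip lborel (\<lambda>x. osc a b (x + s)) f"
    unfolding set_lebesgue_integral_def ip_def
  proof (rule integral_dominated_convergence)
    have i: "integrable lborel (\<lambda>x. osc a b (x + s) * cnj (f x))"
      by (intro sq_int_mult_integrable sq_int_shift sq_int_osc ab f)
    then show "integrable lborel (\<lambda>x. norm (osc a b (x + s) * cnj (f x)))" by (rule integrable_norm)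
    show "AE x in lborel. (\<lambda>n. indicator {- real n..real n} x *\<^sub>R (osc a b (x + s) * cnj (f x))) \<longlonglongrightarrow> osc a b (x + s) * cnj (f x)"
    proof (rule AE_I2)
      fix x :: real
      obtain n0 where n0: "real n0 \<ge> \<bar>x\<bar>" using real_arch_simple by blast
      have "\<forall>\<^sub>F n in sequentially. indicator {- real n..real n} x *\<^sub>R (osc a b (x + s) * cnj (f x)) = osc a b (x + s) * cnj (f x)"
        using eventually_ge_at_top[of n0] by eventually_elim (use n0 in \<open>auto simp: indicator_def\<close>)
      then show "(\<lambda>n. indicator {- real n..real n} x *\<^sub>R (osc a b (x + s) * cnj (f x))) \<longlonglongrightarrow> osc a b (x + s) * cnj (f x)"
        by (rule tendsto_eventually)
    qed
  qed (auto simp: norm_mult indicator_def)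
  ultimately show ?thesis using L LIMSEQ_unique unfolding L0_def by blast
qed

section \<open>Orthonormality of the wavelet family\<close>

text \<open>For j \<ge> 0 the outer shift k is multiplied by the integer 2^j, so the composition is
  again an integer shift.\<close>

lemma dil_dil: "dil i k (dil j l f) = dil (i + j) (l + 2 ^ nat j * k) f" if "j \<ge> 0"
proof
  fix x
  have "2 powr real_of_int j = 2 ^ nat j" using that by (simp add: powr_real_of_int)
  then show "dil i k (dil j l f) x = dil (i + j) (l + 2 ^ nat j * k) f x"
    by (simp add: dil_def powr_add add_divide_distrib algebra_simps)
qed

lemma dil_diff: "dil i k (\<lambda>x. f x - g x) = (\<lambda>x. dil i k f x - dil i k g x)"
  by (simp add: dil_def fun_eq_iff algebra_simps)

lemma dil_lincomb: "dil i k (\<lambda>x. \<Sum>m\<in>K. c m * g m x) = (\<lambda>x. \<Sum>m\<in>K. c m * dil i k (g m) x)"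
  by (simp add: dil_def fun_eq_iff sum_distrib_left algebra_simps)

lemma dil_affine_integral:
  fixes f :: "real \<Rightarrow> 'b::{banach, second_countable_topology}"
  shows "(LINT x|lborel. 2 powr real_of_int i *\<^sub>R f (2 powr real_of_int i * x - s)) = (LINT x|lborel. f x)"
  using lborel_integral_real_affine[of "2 powr real_of_int i" f "-s"]
  by (simp add: algebra_simps)

lemma sq_int_dil:
  assumes f: "sq_int lborel f" shows "sq_int lborel (dil i k f)"
proof -
  have [measurable]: "f \<in> borel_measurable borel" using f by (auto simp: sq_int_def)
  have m: "dil i k f \<in> borel_measurable borel" unfolding dil_def[abs_def] by measurable
  have eq: "(cmod (dil i k f x))\<^sup>2 = 2 powr real_of_int i * (cmod (f (- real_of_int k + 2 powr real_of_int i * x)))\<^sup>2" for x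
  proof -
    have "(2 powr (real_of_int i / 2))\<^sup>2 = 2 powr real_of_int i"
      by (simp add: power2_eq_square powr_add[symmetric])
    then show ?thesis by (simp add: dil_def norm_mult power_mult_distrib)
  qed
  have "integrable lborel (\<lambda>x. (cmod (f x))\<^sup>2)" using f by (simp add: sq_int_def)
  from lborel_integrable_real_affine[OF this, of "2 powr real_of_int i" "- real_of_int k"]
  have "integrable lborel (\<lambda>x. (cmod (dil i k f x))\<^sup>2)" unfolding eq by simp
  then show ?thesis using m by (simp add: sq_int_def)
qed

lemma ip_dil_dil: "ip lborel (dil i k f) (dil i k g) = ip lborel f g"
proof -
  have "dil i k f x * cnj (dil i k g x)
      = 2 powr real_of_int i *\<^sub>R (f (2 powr real_of_int i * x - real_of_int k) * cnj (g (2 powr real_of_int i * x - real_of_int k)))" for x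
  proof -
    have "complex_of_real (2 powr (real_of_int i / 2)) * complex_of_real (2 powr (real_of_int i / 2)) = complex_of_real (2 powr real_of_int i)"
      by (simp add: of_real_mult[symmetric] powr_add[symmetric] del: of_real_mult)
    then show ?thesis by (simp add: dil_def scaleR_conv_of_real algebra_simps)
  qed
  then show ?thesis
    unfolding ip_def using dil_affine_integral[of i "\<lambda>x. f x * cnj (g x)" "real_of_int k"] by simp
qed

lemma nsq_dil: "nsq lborel (dil i k f) = nsq lborel f"
  using ip_dil_dil[of i k f f] unfolding ip_self by simp

lemma l2dist2_eq_nsq: "l2dist2 f g = nsq lborel (\<lambda>x. f x - g x)"
  by (simp add: l2dist2_def nsq_def)

lemma nsq_add_le:
  assumes f: "sq_int M f" and g: "sq_int M g"
  shows "nsq M (\<lambda>x. f x + g x) \<le> 2 * nsq M f + 2 * nsq M g"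
proof -
  have "nsq M (\<lambda>x. f x + g x) \<le> (LINT x|M. 2 * (cmod (f x))\<^sup>2 + 2 * (cmod (g x))\<^sup>2)"
    unfolding nsq_def using f g sq_int_add[OF f g] by (intro integral_mono cmod_add_sq_le) (auto simp: sq_int_def)
  also have "\<dots> = 2 * nsq M f + 2 * nsq M g"
    unfolding nsq_def using f g by (auto simp: sq_int_def)
  finally show ?thesis .
qed

section \<open>Closed spans of the dilated and shifted scaling function\<close>

context
  fixes \<phi> :: "real \<Rightarrow> complex"
  assumes mra: "mra_scaling \<phi>"
begin

lemma sq_int_scaling: "sq_int lborel \<phi>"
  using mra by (simp add: mra_scaling_def l2fun_eq_sq_int)

lemma ip_scaling: "ip lborel (dil j k \<phi>) (dil j l \<phi>) = (if k = l then 1 else 0)"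
proof -
  have "dil j m \<phi> = dil j 0 (dil 0 m \<phi>)" for m by (simp add: dil_dil)
  then have "ip lborel (dil j k \<phi>) (dil j l \<phi>) = ip lborel (dil 0 k \<phi>) (dil 0 l \<phi>)"
    using ip_dil_dil[of j 0 "dil 0 k \<phi>" "dil 0 l \<phi>"] by simp
  also have "\<dots> = (if k = l then 1 else 0)"
    using mra by (simp add: mra_scaling_def orthonormal_fam_def ip_def)
  finally show ?thesis .
qed

text \<open>\<open>cspan_L2\<close> quantifies over finite sets of functions. Orthonormality makes
  the shifts pairwise distinct, so these sets can be replaced by finite sets of integer
  indices.\<close>

lemma mra_V_iff:
  "f \<in> mra_V \<phi> j \<longleftrightarrow> sq_int lborel f \<and>
     (\<forall>e>0. \<exists>K c. finite K \<and> nsq lborel (\<lambda>x. f x - (\<Sum>k\<in>K. c k * dil j k \<phi> x)) < e)"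
proof -
  have inj: "inj (\<lambda>k. dil j k \<phi>)"
  proof (rule injI)
    fix k l assume "dil j k \<phi> = dil j l \<phi>"
    then have "ip lborel (dil j k \<phi>) (dil j l \<phi>) = ip lborel (dil j l \<phi>) (dil j l \<phi>)" by simp
    then show "k = l" by (simp add: ip_scaling split: if_splits)
  qed
  have "(\<exists>F c. finite F \<and> F \<subseteq> range (\<lambda>k. dil j k \<phi>) \<and> l2dist2 f (\<lambda>x. \<Sum>g\<in>F. c g * g x) < e)
      \<longleftrightarrow> (\<exists>K c. finite K \<and> nsq lborel (\<lambda>x. f x - (\<Sum>k\<in>K. c k * dil j k \<phi> x)) < e)" for e
  proof
    assume "\<exists>F c. finite F \<and> F \<subseteq> range (\<lambda>k. dil j k \<phi>) \<and> l2dist2 f (\<lambda>x. \<Sum>g\<in>F. c g * g x) < e"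
    then obtain F c where F: "finite F" "F \<subseteq> range (\<lambda>k. dil j k \<phi>)" "l2dist2 f (\<lambda>x. \<Sum>g\<in>F. c g * g x) < e"
      by blast
    then obtain K where K: "finite K" "F = (\<lambda>k. dil j k \<phi>) ` K"
      using finite_subset_image[OF F(1) F(2)] by (elim exE conjE)
    have "inj_on (\<lambda>k. dil j k \<phi>) K" using inj by (rule inj_on_subset) auto
    then have "nsq lborel (\<lambda>x. f x - (\<Sum>k\<in>K. c (dil j k \<phi>) * dil j k \<phi> x)) < e"
      using F(3) unfolding l2dist2_eq_nsq K(2) by (simp add: sum.reindex)
    with K(1) show "\<exists>K c. finite K \<and> nsq lborel (\<lambda>x. f x - (\<Sum>k\<in>K. c k * dil j k \<phi> x)) < e"
      by (intro exI[of _ K] exI[of _ "\<lambda>k. c (dil j k \<phi>)"]) auto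
  next
    assume "\<exists>K c. finite K \<and> nsq lborel (\<lambda>x. f x - (\<Sum>k\<in>K. c k * dil j k \<phi> x)) < e"
    then obtain K c where K: "finite K" "nsq lborel (\<lambda>x. f x - (\<Sum>k\<in>K. c k * dil j k \<phi> x)) < e" by blast
    have "inj_on (\<lambda>k. dil j k \<phi>) K" using inj by (rule inj_on_subset) auto
    then have "l2dist2 f (\<lambda>x. \<Sum>g\<in>(\<lambda>k. dil j k \<phi>) ` K. c (inv (\<lambda>k. dil j k \<phi>) g) * g x) < e"
      using K(2) inj unfolding l2dist2_eq_nsq by (simp add: sum.reindex inv_f_f[OF inj])
    with K(1) show "\<exists>F c. finite F \<and> F \<subseteq> range (\<lambda>k. dil j k \<phi>) \<and> l2dist2 f (\<lambda>x. \<Sum>g\<in>F. c g * g x) < e"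
      by (intro exI[of _ "(\<lambda>k. dil j k \<phi>) ` K"] exI[of _ "\<lambda>g. c (inv (\<lambda>k. dil j k \<phi>) g)"]) auto
  qed
  then show ?thesis
    unfolding mra_V_def cspan_L2_def by (simp add: l2fun_eq_sq_int)
qed

lemma mra_V_mono: "i \<le> j \<Longrightarrow> mra_V \<phi> i \<subseteq> mra_V \<phi> j"
proof (induction j rule: int_ge_induct)
  case (step j) then show ?case using mra unfolding mra_scaling_def by blast
qed simp

text \<open>Dilation is isometric, so an approximation in V_1 keeps its error; the inner shift m
  merely becomes m + 2k.\<close>

lemma dil_in_mra_V:
  assumes f: "f \<in> mra_V \<phi> 1" shows "dil i k f \<in> mra_V \<phi> (i + 1)"
  unfolding mra_V_iff
proof (intro conjI allI impI)
  show "sq_int lborel (dil i k f)" using f by (simp add: mra_V_iff sq_int_dil)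
  fix e :: real assume "e > 0"
  then obtain K c where K: "finite K" "nsq lborel (\<lambda>x. f x - (\<Sum>m\<in>K. c m * dil 1 m \<phi> x)) < e"
    using f unfolding mra_V_iff by blast
  have "nsq lborel (dil i k (\<lambda>x. f x - (\<Sum>m\<in>K. c m * dil 1 m \<phi> x))) < e"
    using K(2) by (simp add: nsq_dil)
  moreover have "dil i k (\<lambda>x. f x - (\<Sum>m\<in>K. c m * dil 1 m \<phi> x)) = (\<lambda>x. dil i k f x - (\<Sum>m\<in>K. c m * dil (i + 1) (m + 2 * k) \<phi> x))"
    unfolding dil_diff dil_lincomb by (simp add: dil_dil)
  moreover have "(\<lambda>x. dil i k f x - (\<Sum>m\<in>K. c m * dil (i + 1) (m + 2 * k) \<phi> x))
      = (\<lambda>x. dil i k f x - (\<Sum>m\<in>(\<lambda>m. m + 2 * k) ` K. c (m - 2 * k) * dil (i + 1) m \<phi> x))"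
    by (simp add: sum.reindex inj_on_def)
  ultimately show "\<exists>K c. finite K \<and> nsq lborel (\<lambda>x. dil i k f x - (\<Sum>m\<in>K. c m * dil (i + 1) m \<phi> x)) < e"
    using K(1) by (intro exI[of _ "(\<lambda>m. m + 2 * k) ` K"] exI[of _ "\<lambda>m. c (m - 2 * k)"]) simp
qed

lemma mra_V_orthogonal:
  assumes f: "f \<in> mra_V \<phi> j" and h: "sq_int lborel h" and orth: "\<And>k. ip lborel (dil j k \<phi>) h = 0"
  shows "ip lborel f h = 0"
proof (rule ccontr)
  assume "ip lborel f h \<noteq> 0"
  then have p: "(cmod (ip lborel f h))\<^sup>2 > 0" by simp
  have f2: "sq_int lborel f" using f by (simp add: mra_V_iff)
  \<comment> \<open>The added 1 keeps the denominator positive and makes the final comparison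
    strict.\<close>
  define e where "e = (cmod (ip lborel f h))\<^sup>2 / (nsq lborel h + 1)"
  have "e > 0" using p nsq_nonneg[of lborel h] by (simp add: e_def)
  then obtain K c where K: "finite K" "nsq lborel (\<lambda>x. f x - (\<Sum>k\<in>K. c k * dil j k \<phi> x)) < e"
    using f unfolding mra_V_iff by blast
  have s: "sq_int lborel (\<lambda>x. \<Sum>k\<in>K. c k * dil j k \<phi> x)"
    by (intro sq_int_sum sq_int_scale sq_int_dil sq_int_scaling)
  have "ip lborel (\<lambda>x. \<Sum>k\<in>K. c k * dil j k \<phi> x) h = 0"
    by (subst ip_sum_left) (auto simp: ip_scale_left orth intro: sq_int_scale sq_int_dil sq_int_scaling h)
  then have "ip lborel f h = ip lborel (\<lambda>x. f x - (\<Sum>k\<in>K. c k * dil j k \<phi> x)) h"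
    using ip_diff_left[OF f2 s h] by simp
  then have "(cmod (ip lborel f h))\<^sup>2 \<le> nsq lborel (\<lambda>x. f x - (\<Sum>k\<in>K. c k * dil j k \<phi> x)) * nsq lborel h"
    using ip_cauchy_schwarz[OF sq_int_diff[OF f2 s] h] by simp
  also have "\<dots> \<le> e * nsq lborel h"
    using K(2) by (intro mult_right_mono) (auto simp: nsq_nonneg)
  also have "\<dots> < e * (nsq lborel h + 1)" using \<open>e > 0\<close> by simp
  also have "\<dots> = (cmod (ip lborel f h))\<^sup>2" using nsq_nonneg[of lborel h] by (simp add: e_def)
  finally show False by simp
qed

lemma scaling_in_mra_V: "dil j k \<phi> \<in> mra_V \<phi> j"
  unfolding mra_V_iff
proof (intro conjI allI impI)
  fix e :: real assume "e > 0"
  then show "\<exists>K c. finite K \<and> nsq lborel (\<lambda>x. dil j k \<phi> x - (\<Sum>m\<in>K. c m * dil j m \<phi> x)) < e"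
    by (intro exI[of _ "{k}"] exI[of _ "\<lambda>_. 1"]) (simp add: nsq_def)
qed (intro sq_int_dil sq_int_scaling)

end

text \<open>One index type labels the basis functions, their spectra, the coefficients and the
  random variables, so every partial sum runs over a single finite set.\<close>

definition wfam :: "(real \<Rightarrow> complex) \<Rightarrow> (real \<Rightarrow> complex) \<Rightarrow> int + nat \<times> int \<Rightarrow> real \<Rightarrow> complex" where
  "wfam \<phi> \<psi> i = (case i of Inl k \<Rightarrow> dil 0 k \<phi> | Inr (j, l) \<Rightarrow> dil (int j) l \<psi>)"

lemma sq_int_wfam: "mra_wavelet \<phi> \<psi> \<Longrightarrow> sq_int lborel (wfam \<phi> \<psi> i)"
  by (auto simp: wfam_def mra_wavelet_def l2fun_eq_sq_int split: sum.split intro: sq_int_dil sq_int_scaling)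

text \<open>Within a level, dilation invariance reduces to level 0. Across levels, the coarser
  function lies in the V_j of the finer level j, and that space is orthogonal to the wavelets of
  level j.\<close>

lemma ip_wfam:
  assumes wav: "mra_wavelet \<phi> \<psi>"
  shows "ip lborel (wfam \<phi> \<psi> i) (wfam \<phi> \<psi> i') = (if i = i' then 1 else 0)"
proof -
  have mra: "mra_scaling \<phi>" and psi: "sq_int lborel \<psi>" and psiV: "\<psi> \<in> mra_V \<phi> 1"
    using wav by (auto simp: mra_wavelet_def l2fun_eq_sq_int)
  have shift: "dil j m f = dil j 0 (dil 0 m f)" for j m f by (simp add: dil_dil)
  have pp: "ip lborel (dil j k \<psi>) (dil j l \<psi>) = (if k = l then 1 else 0)" for j k l
  proof -
    have "ip lborel (dil j k \<psi>) (dil j l \<psi>) = ip lborel (dil 0 k \<psi>) (dil 0 l \<psi>)"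
      using ip_dil_dil[of j 0 "dil 0 k \<psi>" "dil 0 l \<psi>"] by (simp only: shift[symmetric])
    also have "\<dots> = (if k = l then 1 else 0)"
      using wav unfolding mra_wavelet_def orthonormal_fam_def ip_def by blast
    finally show ?thesis .
  qed
  have ps: "ip lborel (dil j k \<psi>) (dil j l \<phi>) = 0" for j k l
  proof -
    have "ip lborel (dil j k \<psi>) (dil j l \<phi>) = ip lborel (dil 0 k \<psi>) (dil 0 l \<phi>)"
      using ip_dil_dil[of j 0 "dil 0 k \<psi>" "dil 0 l \<phi>"] by (simp only: shift[symmetric])
    also have "\<dots> = 0" using wav unfolding mra_wavelet_def ip_def by blast
    finally show ?thesis .
  qed
  have ip0: "ip lborel f g = 0" if "ip lborel g f = 0" for f g
    using ip_cnj[of lborel f g] that by simp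
  have sp: "ip lborel (dil j l \<phi>) (dil j k \<psi>) = 0" for j k l
    by (rule ip0[OF ps])
  have orth: "ip lborel f (dil j l \<psi>) = 0" if "f \<in> mra_V \<phi> i" "i \<le> j" for f i j l
  proof (rule mra_V_orthogonal[OF mra])
    show "f \<in> mra_V \<phi> j" using mra_V_mono[OF mra that(2)] that(1) by (rule subsetD)
  qed (auto intro: sq_int_dil psi sp)
  have a: "ip lborel (dil 0 k \<phi>) (dil (int j) l \<psi>) = 0" for k j l
    by (rule orth[OF scaling_in_mra_V[OF mra]]) simp
  have b: "ip lborel (dil i k \<psi>) (dil j l \<psi>) = 0" if "i < j" for i j k l
    by (rule orth[OF dil_in_mra_V[OF mra psiV]]) (use that in simp)
  have b': "ip lborel (dil i k \<psi>) (dil j l \<psi>) = (if i = j \<and> k = l then 1 else 0)" for i j k l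
  proof (cases i j rule: linorder_cases)
    case less
    then show ?thesis by (simp add: b)
  next
    case equal
    then show ?thesis by (simp add: pp)
  next
    case greater
    then show ?thesis using ip0[OF b] by simp
  qed
  have a': "ip lborel (dil (int j) l \<psi>) (dil 0 k \<phi>) = 0" for k j l
    by (rule ip0[OF a])
  show ?thesis
    by (auto simp: wfam_def a a' b' ip_scaling[OF mra] split: sum.split)
qed

section \<open>Values of the Fourier transforms at the origin\<close>

text \<open>The factor 2^(-j/2), the modulation and the argument y/2^j are the frequency side of
  \<open>dil\<close>. Rescaling both variables by 2^j reduces the claim to
  \<open>fourier_pairing\<close> with shift l.\<close>

lemma fourier_pairing_dil:
  assumes F: "fourier_L2 f F" and f: "sq_int lborel f" and contF: "continuous_on UNIV F" and ab: "a \<le> b"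
  shows "(LBINT y:{a..b}. complex_of_real (2 powr (- real j / 2)) * iexp (y * real_of_int l / 2 ^ j) * cnj (F (y / 2 ^ j)))
    = ip lborel (osc a b) (dil (int j) l f)"
proof -
  define c :: real where "c = 2 ^ j"
  have c: "c > 0" "2 powr real j = c" by (auto simp: c_def powr_realpow)
  define s where "s = 2 powr (real j / 2)"
  have s: "s > 0" "s * s = c" unfolding s_def using c by (auto simp: powr_add[symmetric])
  have sm: "2 powr (- real j / 2) = 1 / s" unfolding s_def by (simp add: powr_minus_divide)
  define x0 where "x0 = real_of_int l"
  have osc_scale: "osc (a / c) (b / c) (c * x) = complex_of_real (1 / c) * osc a b x" for x
  proof -
    have "osc a b x = \<bar>c\<bar> *\<^sub>R (LINT v|lborel. indicator {a..b} (0 + c * v) *\<^sub>R iexp ((0 + c * v) * x))"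
      unfolding osc_def set_lebesgue_integral_def using c by (intro lborel_integral_real_affine) auto
    also have "(LINT v|lborel. indicator {a..b} (0 + c * v) *\<^sub>R iexp ((0 + c * v) * x)) = osc (a / c) (b / c) (c * x)"
      unfolding osc_def set_lebesgue_integral_def using c
      by (intro Bochner_Integration.integral_cong) (auto simp: indicator_def field_simps)
    finally show ?thesis using c by (simp add: scaleR_conv_of_real)
  qed
  have "(LBINT y:{a..b}. complex_of_real (2 powr (- real j / 2)) * iexp (y * real_of_int l / 2 ^ j) * cnj (F (y / 2 ^ j)))
      = \<bar>c\<bar> *\<^sub>R (LINT y|lborel. indicator {a..b} (0 + c * y) *\<^sub>R (complex_of_real (1 / s) * iexp ((0 + c * y) * x0 / c) * cnj (F ((0 + c * y) / c))))"
    unfolding set_lebesgue_integral_def sm x0_def c_def[symmetric] using c by (intro lborel_integral_real_affine) auto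
  also have "(LINT y|lborel. indicator {a..b} (0 + c * y) *\<^sub>R (complex_of_real (1 / s) * iexp ((0 + c * y) * x0 / c) * cnj (F ((0 + c * y) / c))))
     = (LINT y|lborel. complex_of_real (1 / s) * (indicator {a/c..b/c} y *\<^sub>R (cnj (F y) * iexp (y * x0))))"
    using c by (intro Bochner_Integration.integral_cong) (auto simp: indicator_def field_simps)
  also have "\<dots> = complex_of_real (1 / s) * (LBINT y:{a/c..b/c}. cnj (F y) * iexp (y * x0))"
    unfolding set_lebesgue_integral_def by (rule integral_mult_right_zero)
  also have "(LBINT y:{a/c..b/c}. cnj (F y) * iexp (y * x0)) = ip lborel (\<lambda>x. osc (a/c) (b/c) (x + x0)) f"
    using c ab by (intro fourier_pairing F f contF) (simp add: divide_right_mono)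
  also have "\<dots> = \<bar>c\<bar> *\<^sub>R (LINT x|lborel. osc (a/c) (b/c) ((-x0 + c * x) + x0) * cnj (f (-x0 + c * x)))"
    unfolding ip_def using c by (intro lborel_integral_real_affine) auto
  also have "(LINT x|lborel. osc (a/c) (b/c) ((-x0 + c * x) + x0) * cnj (f (-x0 + c * x)))
     = (LINT x|lborel. complex_of_real (1 / (c * s)) * (osc a b x * cnj (dil (int j) l f x)))"
    using c s by (intro Bochner_Integration.integral_cong)
      (auto simp: osc_scale dil_def s_def[symmetric] x0_def)
  also have "\<dots> = complex_of_real (1 / (c * s)) * ip lborel (osc a b) (dil (int j) l f)"
    unfolding ip_def by (rule integral_mult_right_zero)
  finally have "(LBINT y:{a..b}. complex_of_real (2 powr (- real j / 2)) * iexp (y * real_of_int l / 2 ^ j) * cnj (F (y / 2 ^ j)))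
     = complex_of_real (c * (1 / s * (c * (1 / (c * s))))) * ip lborel (osc a b) (dil (int j) l f)"
    using c by (simp add: scaleR_conv_of_real)
  \<comment> \<open>Two Jacobians c meet the amplitude 1/s and the factor 1/(c s) produced by
    \<open>osc_scale\<close> and \<open>dil\<close>; they cancel because s * s = c.\<close>
  also have "c * (1 / s * (c * (1 / (c * s)))) = 1"
    using c s by (simp add: field_simps)
  finally show ?thesis by simp
qed

lemma osc_0_1_lower_bound:
  assumes "\<bar>x\<bar> \<le> 1/2" shows "cmod (osc 0 1 x) \<ge> 1/2"
proof -
  have i1: "integrable lborel (\<lambda>v::real. indicator {0..1} v *\<^sub>R (1::complex))"
      by (rule integrable_indicator_Icc)
  have i2: "integrable lborel (\<lambda>v. indicator {0..1} v *\<^sub>R iexp (v * x))"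
    using set_integrable_exp_ii[of 0 1 x] by (simp add: set_integrable_def)
  have i3: "integrable lborel (\<lambda>v::real. indicator {0..1} v *\<^sub>R (1/2::real))"
      by (rule integrable_indicator_Icc)
  have "osc 0 1 x - 1 = (LINT v|lborel. indicator {0..1} v *\<^sub>R iexp (v * x) - indicator {0..1::real} v *\<^sub>R (1::complex))"
    unfolding osc_def set_lebesgue_integral_def
    by (subst Bochner_Integration.integral_diff[OF i2 i1]) simp
  also have "cmod \<dots> \<le> (LINT v|lborel. indicator {0..1::real} v *\<^sub>R (1/2::real))"
  proof (rule order_trans[OF integral_norm_bound integral_mono])
    show "integrable lborel (\<lambda>v. cmod (indicator {0..1} v *\<^sub>R iexp (v * x) - indicator {0..1::real} v *\<^sub>R (1::complex)))"
      by (intro integrable_norm Bochner_Integration.integrable_diff i1 i2)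
    fix v :: real
    have "cmod (iexp (v * x) - 1) \<le> \<bar>v * x\<bar>"
      using iexp_approx1[of "v * x" 0] by simp
    also have "\<bar>v * x\<bar> \<le> 1/2" if "0 \<le> v" "v \<le> 1"
      unfolding abs_mult using that assms mult_mono[of "\<bar>v\<bar>" 1 "\<bar>x\<bar>" "1/2"] by simp
    finally show "cmod (indicator {0..1} v *\<^sub>R iexp (v * x) - indicator {0..1::real} v *\<^sub>R (1::complex)) \<le> indicator {0..1} v *\<^sub>R (1/2)"
      by (auto simp: indicator_def)
  qed (fact i3)
  also have "\<dots> = 1/2" by simp
  finally have "cmod (osc 0 1 x - 1) \<le> 1/2" .
  moreover have "1 \<le> cmod (osc 0 1 x) + cmod (osc 0 1 x - 1)"
    using norm_triangle_ineq4[of "osc 0 1 x" "osc 0 1 x - 1"] by simp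
  ultimately show ?thesis by simp
qed

text \<open>The interval [-1/2, 1/2] has length 1 and the modulus is at least 1/2 on it. An explicit
  positive bound is what the contradiction in \<open>scaling_fourier_nonzero\<close> is measured
  against.\<close>

lemma nsq_osc_0_1_ge: "nsq lborel (osc 0 1) \<ge> 1/4"
proof -
  have "(LINT x|lborel. indicator {-1/2..1/2::real} x *\<^sub>R (1/4::real)) \<le> nsq lborel (osc 0 1)"
    unfolding nsq_def
  proof (rule integral_mono)
    show "integrable lborel (\<lambda>x. indicator {-1/2..1/2::real} x *\<^sub>R (1/4::real))"
      by (rule integrable_indicator_Icc)
    show "integrable lborel (\<lambda>x. (cmod (osc 0 1 x))\<^sup>2)"
      using sq_int_osc[of 0 1] by (simp add: sq_int_def)
    fix x :: real
    show "indicator {-1/2..1/2::real} x *\<^sub>R (1/4::real) \<le> (cmod (osc 0 1 x))\<^sup>2"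
    proof (cases "x \<in> {-1/2..1/2}")
      case True
      then have "cmod (osc 0 1 x) \<ge> 1/2" by (intro osc_0_1_lower_bound) auto
      then have "(cmod (osc 0 1 x))\<^sup>2 \<ge> (1/2)\<^sup>2" by (intro power_mono) auto
      then show ?thesis using True by (simp add: power2_eq_square)
    qed simp
  qed
  then show ?thesis by simp
qed

lemma continuous_small_dyadic:
  fixes F :: "real \<Rightarrow> complex"
  assumes contF: "continuous_on UNIV F" and "e > 0"
  obtains j0 where "\<And>j v. j \<ge> j0 \<Longrightarrow> 0 \<le> v \<Longrightarrow> v \<le> 1 \<Longrightarrow> cmod (F (v / 2 ^ j) - F 0) < e"
proof -
  have "isCont F 0" using contF by (simp add: continuous_on_eq_continuous_at)
  then obtain d where d: "d > 0" "\<And>x. \<bar>x\<bar> < d \<Longrightarrow> cmod (F x - F 0) < e"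
    using \<open>e > 0\<close> unfolding continuous_at_eps_delta by (auto simp: dist_norm)
  obtain j0 where j0: "(1/2::real) ^ j0 < d"
    using real_arch_pow_inv[of d "1/2"] d by auto
  show ?thesis
  proof (rule that[of j0], rule d(2))
    fix j v assume a: "j \<ge> j0" "0 \<le> v" "v \<le> (1::real)"
    have "v / 2 ^ j \<le> (1/2) ^ j" using a by (simp add: power_one_over divide_simps)
    also have "\<dots> \<le> (1/2) ^ j0" using a by (intro power_decreasing) auto
    finally show "\<bar>v / 2 ^ j\<bar> < d" using j0 a by simp
  qed
qed

text \<open>Up to a factor, the inner products are the Fourier coefficients of
  \<open>cnj (F (v / 2 ^ j))\<close> restricted to [0,1], with respect to exponentials in v.
  Bessel's inequality for these exponentials gives a bound that does not depend on j or K.\<close>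

lemma fourier_sum_le:
  assumes F: "fourier_L2 f F" and f: "sq_int lborel f" and contF: "continuous_on UNIV F" and fin: "finite K"
    and bd: "\<And>v. 0 \<le> v \<Longrightarrow> v \<le> 1 \<Longrightarrow> cmod (F (v / 2 ^ j)) \<le> B"
  shows "(\<Sum>k\<in>K. (cmod (ip lborel (osc 0 1) (dil (int j) k f)))\<^sup>2) \<le> 2 * pi * B\<^sup>2"
proof -
  \<comment> \<open>A common period of the exponentials with frequencies k/2^j. Being at least 1, it
    leaves room for the support [0,1] of \<open>H\<close>.\<close>
  define L :: real where "L = 2 * pi * 2 ^ j"
  have L1: "L \<ge> 1"
  proof -
    have "1 * 1 \<le> 2 * pi * 2 ^ j" using pi_gt3 by (intro mult_mono) auto
    then show ?thesis by (simp add: L_def)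
  qed
  define r where "r = 1 / sqrt L"
  have r: "r\<^sup>2 = 1 / L" "r \<ge> 0" using L1 by (auto simp: r_def power_divide)
  define g where "g k v = indicator {0..L} v *\<^sub>R (complex_of_real r * exp (- (\<i> * complex_of_real (v * (real_of_int k / 2 ^ j)))))" for k v
  define H where "H v = indicator {0..1} v *\<^sub>R cnj (F (v / 2 ^ j))" for v
  have contH: "continuous_on {0..1} (\<lambda>v. cnj (F (v / 2 ^ j)))"
    by (intro continuous_intros continuous_on_compose2[OF contF]) auto
  have Hint: "integrable lborel H"
    using borel_integrable_atLeastAtMost'[OF contH] by (simp add: H_def[abs_def] set_integrable_def)
  have H2: "(cmod (H v))\<^sup>2 = indicator {0..1} v *\<^sub>R (cmod (cnj (F (v / 2 ^ j))))\<^sup>2" for v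
    by (auto simp: H_def indicator_def)
  have "set_integrable lborel {0..1} (\<lambda>v. (cmod (cnj (F (v / 2 ^ j))))\<^sup>2)"
    by (intro borel_integrable_atLeastAtMost' continuous_on_power continuous_on_norm contH)
  then have Hsq: "sq_int lborel H"
    unfolding sq_int_def H2 set_integrable_def using Hint by auto
  have g2: "(cmod (g k v))\<^sup>2 = indicator {0..L} v *\<^sub>R (r\<^sup>2)" for k v
    by (auto simp: g_def indicator_def norm_mult r(2))
  have gsq: "sq_int lborel (g k)" for k
  proof -
    have "(\<lambda>v. g k v) \<in> borel_measurable borel" unfolding g_def by measurable
    then show ?thesis
      unfolding sq_int_def g2 using integrable_indicator_Icc[of 0 L "r\<^sup>2"] by simp
  qed
  have gg: "ip lborel (g k) (g l) = (if k = l then 1 else 0)" for k l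
  proof -
    define x where "x = real_of_int (l - k) / 2 ^ j"
    have "ip lborel (g k) (g l) = (LINT v|lborel. complex_of_real (r\<^sup>2) * (indicator {0..L} v *\<^sub>R iexp (v * x)))"
      unfolding ip_def
      by (intro Bochner_Integration.integral_cong)
        (auto simp: g_def indicator_def exp_cnj exp_add[symmetric] power2_eq_square x_def field_simps)
    also have "\<dots> = complex_of_real (r\<^sup>2) * osc 0 L x"
      unfolding osc_def set_lebesgue_integral_def by (rule integral_mult_right_zero)
    also have "\<dots> = (if k = l then 1 else 0)"
    proof (cases "k = l")
      case True
      then have "osc 0 L x = L" using L1 by (simp add: osc_def x_def set_lebesgue_integral_def scaleR_conv_of_real)
      then show ?thesis using True r L1 by simp
    next
      case False
      then have "x \<noteq> 0" by (simp add: x_def)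
      moreover have "iexp (L * x) = 1"
      proof -
        have "L * x = 2 * pi * real_of_int (l - k)" by (simp add: L_def x_def)
        then show ?thesis
          by (auto simp: exp_eq_1 intro!: exI[of _ "l - k"])
      qed
      ultimately have "osc 0 L x = 0" using L1 by (subst osc_eq) auto
      then show ?thesis using False by simp
    qed
    finally show ?thesis .
  qed
  have Hg: "(cmod (ip lborel H (g k)))\<^sup>2 = (cmod (ip lborel (osc 0 1) (dil (int j) k f)))\<^sup>2 / (2 * pi)" for k
  proof -
    define s where "s = 2 powr (- real j / 2)"
    have s: "s\<^sup>2 = 1 / 2 ^ j"
      by (simp add: s_def power2_eq_square powr_add[symmetric] powr_minus_divide powr_realpow)
    have s0: "s > 0" by (simp add: s_def)
    have "ip lborel H (g k) = (LINT v|lborel. complex_of_real (r / s) * (indicator {0..1} v *\<^sub>R (complex_of_real s * iexp (v * real_of_int k / 2 ^ j) * cnj (F (v / 2 ^ j)))))"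
      unfolding ip_def using L1 s0
      by (intro Bochner_Integration.integral_cong)
        (auto simp: g_def H_def indicator_def exp_cnj)
    also have "\<dots> = complex_of_real (r / s) * ip lborel (osc 0 1) (dil (int j) k f)"
      unfolding integral_mult_right_zero
      using fourier_pairing_dil[OF F f contF, of 0 1 j k] by (simp add: s_def set_lebesgue_integral_def)
    finally have "(cmod (ip lborel H (g k)))\<^sup>2 = r\<^sup>2 / s\<^sup>2 * (cmod (ip lborel (osc 0 1) (dil (int j) k f)))\<^sup>2"
      by (simp add: norm_mult norm_divide power_mult_distrib power_divide)
    then show ?thesis unfolding r(1) s by (simp add: L_def)
  qed
  have "(\<Sum>k\<in>K. (cmod (ip lborel H (g k)))\<^sup>2) \<le> nsq lborel H"
    by (rule bessel[OF fin Hsq gsq gg])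
  also have "nsq lborel H \<le> (LINT v|lborel. indicator {0..1::real} v *\<^sub>R B\<^sup>2)"
    unfolding nsq_def
  proof (rule integral_mono)
    show "integrable lborel (\<lambda>v. (cmod (H v))\<^sup>2)" using Hsq by (simp add: sq_int_def)
    show "integrable lborel (\<lambda>v. indicator {0..1::real} v *\<^sub>R B\<^sup>2)"
      by (rule integrable_indicator_Icc)
    show "(cmod (H v))\<^sup>2 \<le> indicator {0..1::real} v *\<^sub>R B\<^sup>2" for v
      using bd[of v] by (auto simp: H2 indicator_def intro: power_mono)
  qed
  also have "\<dots> = B\<^sup>2" by simp
  finally have "(\<Sum>k\<in>K. (cmod (ip lborel (osc 0 1) (dil (int j) k f)))\<^sup>2 / (2 * pi)) \<le> B\<^sup>2"
    by (simp add: Hg)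
  then show ?thesis by (simp add: sum_divide_distrib[symmetric] field_simps)
qed

text \<open>If \<Phi> 0 = 0, then \<Phi> (v / 2^j) is uniformly small on [0,1] for large j, so
  \<open>fourier_sum_le\<close> leaves almost all of the norm of \<open>osc 0 1\<close> outside V_j,
  contrary to density of the union of these spaces.\<close>

lemma scaling_fourier_nonzero:
  assumes mra: "mra_scaling \<phi>" and F: "fourier_L2 \<phi> \<Phi>" and cont: "continuous_on UNIV \<Phi>"
  shows "\<Phi> 0 \<noteq> 0"
proof
  assume z: "\<Phi> 0 = 0"
  \<comment> \<open>The tolerances 1/40 here and 1/20 below give 4/40 + 8/400, which is less than
    the lower bound 1/4 for \<open>nsq lborel (osc 0 1)\<close>.\<close>
  define e :: real where "e = 1 / 40"
  have phi: "sq_int lborel \<phi>" by (rule sq_int_scaling[OF mra])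
  have h: "sq_int lborel (osc 0 1)" by (rule sq_int_osc) simp
  obtain j1 where j1: "\<And>j v. j \<ge> j1 \<Longrightarrow> 0 \<le> v \<Longrightarrow> v \<le> 1 \<Longrightarrow> cmod (\<Phi> (v / 2 ^ j) - \<Phi> 0) < 1/20"
    using continuous_small_dyadic[OF cont, of "1/20"] by auto
  obtain i g where g: "g \<in> mra_V \<phi> i" "l2dist2 (osc 0 1) g < e"
    using mra h unfolding mra_scaling_def l2fun_eq_sq_int e_def by (metis zero_less_divide_1_iff zero_less_numeral)
  \<comment> \<open>Nesting moves the approximant \<open>g\<close> up to a nonnegative level at
    which the smallness of \<Phi> is also available.\<close>
  define j where "j = max j1 (nat i)"
  have "g \<in> mra_V \<phi> (int j)" using mra_V_mono[OF mra, of i "int j"] g(1) by (simp add: j_def subset_iff)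
  then have gsq: "sq_int lborel g" and "\<forall>e>0. \<exists>K c. finite K \<and> nsq lborel (\<lambda>x. g x - (\<Sum>k\<in>K. c k * dil (int j) k \<phi> x)) < e"
    by (auto simp: mra_V_iff[OF mra])
  then obtain K c where K: "finite K" "nsq lborel (\<lambda>x. g x - (\<Sum>k\<in>K. c k * dil (int j) k \<phi> x)) < e"
    unfolding e_def by (meson zero_less_divide_1_iff zero_less_numeral)
  have s: "sq_int lborel (\<lambda>x. \<Sum>k\<in>K. c k * dil (int j) k \<phi> x)"
    by (intro sq_int_sum sq_int_scale sq_int_dil phi)
  have "nsq lborel (\<lambda>x. osc 0 1 x - (\<Sum>k\<in>K. c k * dil (int j) k \<phi> x))
      = nsq lborel (\<lambda>x. (osc 0 1 x - g x) + (g x - (\<Sum>k\<in>K. c k * dil (int j) k \<phi> x)))" by simp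
  also have "\<dots> \<le> 2 * nsq lborel (\<lambda>x. osc 0 1 x - g x) + 2 * nsq lborel (\<lambda>x. g x - (\<Sum>k\<in>K. c k * dil (int j) k \<phi> x))"
    by (intro nsq_add_le sq_int_diff h gsq s)
  also have "\<dots> \<le> 4 * e" using g(2) K(2) by (simp add: l2dist2_eq_nsq)
  finally have 1: "nsq lborel (\<lambda>x. osc 0 1 x - (\<Sum>k\<in>K. c k * dil (int j) k \<phi> x)) \<le> 4 * e" .
  have "nsq lborel (osc 0 1) - (\<Sum>k\<in>K. (cmod (ip lborel (osc 0 1) (dil (int j) k \<phi>)))\<^sup>2) \<le> 4 * e"
    using nsq_diff_sum_ge[OF K(1) h, of "\<lambda>k. dil (int j) k \<phi>" c] 1
    by (simp add: ip_scaling[OF mra] sq_int_dil[OF phi])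
  moreover have "(\<Sum>k\<in>K. (cmod (ip lborel (osc 0 1) (dil (int j) k \<phi>)))\<^sup>2) \<le> 2 * pi * (1/20)\<^sup>2"
    by (rule fourier_sum_le[OF F phi cont K(1)]) (use j1[of j] z in \<open>auto simp: j_def less_imp_le\<close>)
  moreover have "2 * pi * (1/20)\<^sup>2 \<le> (8::real) / 400" using pi_less_4 by (simp add: power2_eq_square)
  ultimately show False using nsq_osc_0_1_ge by (simp add: e_def)
qed

text \<open>If \<Psi> 0 \<noteq> 0, then at each fine level j half of the 2^j shifts 0, ..., 2^j - 1
  have a squared inner product with \<open>osc 0 1\<close> of order 2^-j. Every such level therefore
  contributes at least a fixed amount, and sufficiently many levels violate Bessel's
  inequality.\<close>

lemma wavelet_fourier_zero:
  assumes wav: "mra_wavelet \<phi> \<psi>" and F: "fourier_L2 \<psi> \<Psi>" and cont: "continuous_on UNIV \<Psi>"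
  shows "\<Psi> 0 = 0"
proof (rule ccontr)
  assume z: "\<Psi> 0 \<noteq> 0"
  define z0 where "z0 = cmod (\<Psi> 0)"
  have z0: "z0 > 0" using z by (simp add: z0_def)
  have psi: "sq_int lborel \<psi>" using wav by (simp add: mra_wavelet_def l2fun_eq_sq_int)
  have h: "sq_int lborel (osc 0 1)" by (rule sq_int_osc) simp
  obtain j1 where j1: "\<And>j v. j \<ge> j1 \<Longrightarrow> 0 \<le> v \<Longrightarrow> v \<le> 1 \<Longrightarrow> cmod (\<Psi> (v / 2 ^ j) - \<Psi> 0) < z0/4"
    using continuous_small_dyadic[OF cont, of "z0/4"] z0 by auto
  \<comment> \<open>The restriction on l keeps the phase small, so \<open>osc 0 1 x\<close> has
    modulus at least 1/2. Replacing \<Psi> (v / 2^j) by \<Psi> 0 costs z0/4, which leaves z0/2 -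
    z0/4 = z0/4, whence the 16.\<close>
  have low: "(cmod (ip lborel (osc 0 1) (dil (int j) l \<psi>)))\<^sup>2 \<ge> z0\<^sup>2 / 16 / 2 ^ j"
    if j: "j \<ge> j1" and l: "0 \<le> l" "real_of_int l / 2 ^ j \<le> 1/2" for j l
  proof -
    define s where "s = 2 powr (- real j / 2)"
    have s: "s\<^sup>2 = 1 / 2 ^ j"
      by (simp add: s_def power2_eq_square powr_add[symmetric] powr_minus_divide powr_realpow)
    have s0: "s > 0" by (simp add: s_def)
    define x where "x = real_of_int l / 2 ^ j"
    define A where "A v = indicator {0..1} v *\<^sub>R (iexp (v * x) * cnj (\<Psi> (v / 2 ^ j)))" for v
    define B where "B v = indicator {0..1} v *\<^sub>R iexp (v * x) * cnj (\<Psi> 0)" for v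
    have iA: "integrable lborel A"
      unfolding A_def[abs_def] set_integrable_def[symmetric]
      by (intro borel_integrable_atLeastAtMost' continuous_intros continuous_on_compose2[OF cont]) auto
    have iB: "integrable lborel B"
      unfolding B_def[abs_def] using set_integrable_exp_ii[of 0 1 x, unfolded set_integrable_def]
      by (rule integrable_mult_left)
    have ipA: "ip lborel (osc 0 1) (dil (int j) l \<psi>) = complex_of_real s * (LINT v|lborel. A v)"
    proof -
      have "ip lborel (osc 0 1) (dil (int j) l \<psi>) = (LINT v|lborel. complex_of_real s * A v)"
        unfolding fourier_pairing_dil[OF F psi cont zero_le_one, of j l, symmetric] set_lebesgue_integral_def
        by (intro Bochner_Integration.integral_cong) (auto simp: A_def s_def x_def indicator_def)
      then show ?thesis by simp
    qed
    have intB: "(LINT v|lborel. B v) = osc 0 1 x * cnj (\<Psi> 0)"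
      unfolding B_def osc_def set_lebesgue_integral_def by (rule integral_mult_left_zero)
    have "cmod ((LINT v|lborel. A v) - (LINT v|lborel. B v)) \<le> (LINT v|lborel. indicator {0..1::real} v *\<^sub>R (z0/4))"
      unfolding Bochner_Integration.integral_diff[OF iA iB, symmetric]
    proof (rule order_trans[OF integral_norm_bound integral_mono])
      show "integrable lborel (\<lambda>v. cmod (A v - B v))"
        by (intro integrable_norm Bochner_Integration.integrable_diff iA iB)
      show "integrable lborel (\<lambda>v. indicator {0..1::real} v *\<^sub>R (z0/4))"
      by (rule integrable_indicator_Icc)
      fix v
      have "A v - B v = indicator {0..1} v *\<^sub>R (iexp (v * x) * cnj (\<Psi> (v / 2 ^ j) - \<Psi> 0))"
        by (simp add: A_def B_def indicator_def algebra_simps)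
      then show "cmod (A v - B v) \<le> indicator {0..1::real} v *\<^sub>R (z0/4)"
        using j1[OF j, of v] by (auto simp: norm_mult indicator_def simp del: complex_cnj_diff)
    qed
    also have "\<dots> = z0 / 4" by simp
    finally have d: "cmod ((LINT v|lborel. A v) - (LINT v|lborel. B v)) \<le> z0 / 4" .
    have "cmod (osc 0 1 x) \<ge> 1/2" using l by (intro osc_0_1_lower_bound) (auto simp: x_def)
    then have "cmod (LINT v|lborel. B v) \<ge> 1/2 * z0"
      unfolding intB norm_mult z0_def complex_mod_cnj by (intro mult_right_mono) auto
    then have "cmod (LINT v|lborel. A v) \<ge> z0 / 4"
      using d norm_triangle_ineq2[of "LINT v|lborel. B v" "LINT v|lborel. A v"] by (simp add: norm_minus_commute)
    then have "(cmod (LINT v|lborel. A v))\<^sup>2 \<ge> (z0/4)\<^sup>2" using z0 by (intro power_mono) auto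
    then have "s\<^sup>2 * (cmod (LINT v|lborel. A v))\<^sup>2 \<ge> s\<^sup>2 * (z0/4)\<^sup>2" by (intro mult_left_mono) auto
    then show ?thesis unfolding ipA norm_mult power_mult_distrib using s by (simp add: power_divide)
  qed
  \<comment> \<open>The share of one level: 2^(j-1) shifts, each contributing z0^2 / 16 /
    2^j.\<close>
  define q where "q = z0\<^sup>2 / 32"
  have q: "q > 0" using z0 by (simp add: q_def)
  obtain n :: nat where n: "real n * q > nsq lborel (osc 0 1)"
    using reals_Archimedean3[OF q] by blast
  \<comment> \<open>Starting at j1 + 1 keeps j positive, so the natural subtraction in 2^(j - 1)
    really halves 2^j.\<close>
  define J where "J = (SIGMA j:{j1+1..<j1+1+n}. int ` {..<2 ^ (j - 1)})"
  have finJ: "finite J" by (auto simp: J_def)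
  have row: "(\<Sum>l\<in>int ` {..<2 ^ (j - 1)}. (cmod (ip lborel (osc 0 1) (dil (int j) l \<psi>)))\<^sup>2) \<ge> q" if "j \<in> {j1+1..<j1+1+n}" for j
  proof -
    have jj: "(2::real) ^ j = 2 * 2 ^ (j - 1)" using that by (cases j) auto
    have "(\<Sum>l\<in>int ` {..<2 ^ (j - 1)}. z0\<^sup>2 / 16 / 2 ^ j) \<le> (\<Sum>l\<in>int ` {..<2 ^ (j - 1)}. (cmod (ip lborel (osc 0 1) (dil (int j) l \<psi>)))\<^sup>2)"
    proof (rule sum_mono)
      fix l assume "l \<in> int ` {..<2 ^ (j - 1)}"
      then obtain m where m: "l = int m" "m < 2 ^ (j - 1)" by auto
      have "real m \<le> 2 ^ (j - 1)" using m(2) by (metis less_imp_le of_nat_le_iff of_nat_numeral of_nat_power)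
      then have "real_of_int l / 2 ^ j \<le> 1/2" unfolding jj m(1) by (simp add: field_simps)
      then show "z0\<^sup>2 / 16 / 2 ^ j \<le> (cmod (ip lborel (osc 0 1) (dil (int j) l \<psi>)))\<^sup>2"
        using that m by (intro low) auto
    qed
    moreover have "(\<Sum>l\<in>int ` {..<2 ^ (j - 1)}. z0\<^sup>2 / 16 / 2 ^ j) = q"
      by (simp add: card_image jj q_def)
    ultimately show ?thesis by simp
  qed
  have "real n * q = (\<Sum>j\<in>{j1+1..<j1+1+n}. q)" by simp
  also have "\<dots> \<le> (\<Sum>j\<in>{j1+1..<j1+1+n}. \<Sum>l\<in>int ` {..<2 ^ (j - 1)}. (cmod (ip lborel (osc 0 1) (dil (int j) l \<psi>)))\<^sup>2)"
    by (intro sum_mono row)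
  also have "\<dots> = (\<Sum>i\<in>J. (cmod (ip lborel (osc 0 1) (wfam \<phi> \<psi> (Inr i))))\<^sup>2)"
    unfolding J_def by (subst sum.Sigma) (auto simp: wfam_def intro!: sum.cong)
  also have "\<dots> \<le> nsq lborel (osc 0 1)"
    by (rule bessel[OF finJ h]) (auto simp: sq_int_wfam[OF wav] ip_wfam[OF wav])
  finally show False using n by simp
qed

section \<open>Integration by parts on the line\<close>

lemma vector_derivative_borel_measurable:
  fixes F :: "real \<Rightarrow> 'b::{real_normed_vector, second_countable_topology}"
  assumes F: "\<And>y. (F has_vector_derivative F' y) (at y)"
  shows "F' \<in> borel_measurable borel"
proof (rule borel_measurable_LIMSEQ_metric)
  have "continuous_on UNIV F"
    using F by (intro continuous_at_imp_continuous_on) (auto intro: has_vector_derivative_continuous)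
  then have [measurable]: "F \<in> borel_measurable borel" by (rule borel_measurable_continuous_onI)
  show "(\<lambda>y. (F (y + inverse (real (Suc n))) - F y) /\<^sub>R inverse (real (Suc n))) \<in> borel_measurable borel" for n
    by measurable
  show "(\<lambda>n. (F (y + inverse (real (Suc n))) - F y) /\<^sub>R inverse (real (Suc n))) \<longlonglongrightarrow> F' y" for y
  proof -
    have "((\<lambda>h. norm (F (y + h) - F y - h *\<^sub>R F' y) / norm h) \<longlongrightarrow> 0) (at 0)"
      using F[of y] unfolding has_vector_derivative_def has_derivative_at by blast
    moreover have "norm (F (y + h) - F y - h *\<^sub>R F' y) / norm h = norm ((F (y + h) - F y) /\<^sub>R h - F' y)"
      if "h \<noteq> 0" for h
    proof -
      have "(F (y + h) - F y) /\<^sub>R h - F' y = (F (y + h) - F y - h *\<^sub>R F' y) /\<^sub>R h"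
        using that by (simp add: scaleR_diff_right)
      then show ?thesis by (simp add: divide_inverse mult.commute)
    qed
    ultimately have "((\<lambda>h. norm ((F (y + h) - F y) /\<^sub>R h - F' y)) \<longlongrightarrow> 0) (at 0)"
      by (subst LIM_equal[where g="\<lambda>h. norm (F (y + h) - F y - h *\<^sub>R F' y) / norm h"]) auto
    then have "((\<lambda>h. (F (y + h) - F y) /\<^sub>R h) \<longlongrightarrow> F' y) (at 0)"
      by (rule LIM_zero_cancel[OF tendsto_norm_zero_cancel])
    moreover have "filterlim (\<lambda>n. inverse (real (Suc n))) (at 0) sequentially"
      using LIMSEQ_inverse_real_of_nat by (auto simp: filterlim_at)
    ultimately show ?thesis by (rule filterlim_compose)
  qed
qed

text \<open>F(y + 1) - F(y) is integrated over y in two ways: translation invariance gives 0, while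
  writing the difference as an integral of F' over a unit interval and applying Fubini gives the
  integral of F'. The averaging takes the place of boundary terms.\<close>

lemma integral_vector_derivative_eq_0:
  fixes F :: "real \<Rightarrow> complex"
  assumes F: "\<And>y. (F has_vector_derivative F' y) (at y)"
    and iF: "integrable lborel F" and iF': "integrable lborel F'"
  shows "(LINT y|lborel. F' y) = 0"
proof -
  have [measurable]: "F' \<in> borel_measurable borel" using vector_derivative_borel_measurable[OF F] .
  define H where "H s y = indicator {0..1} s *\<^sub>R F' (y + s)" for s y :: real
  have shift: "integrable lborel (\<lambda>y. g (y + s))" "(LINT y|lborel. g (y + s)) = (LINT y|lborel. g y)"
    if "integrable lborel g" for g :: "real \<Rightarrow> 'c::{banach, second_countable_topology}" and s
    using lborel_integrable_real_affine[OF that, of 1 s] lborel_integral_real_affine[of 1 g s]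
    by (simp_all add: add.commute)
  have "integrable (lborel \<Otimes>\<^sub>M lborel) (case_prod H)"
  proof (rule lborel_pair.Fubini_integrable)
    show "case_prod H \<in> borel_measurable (lborel \<Otimes>\<^sub>M lborel)"
      unfolding H_def by measurable
    have "(LINT y|lborel. norm (case_prod H (s, y))) = indicator {0..1} s *\<^sub>R (LINT y|lborel. norm (F' y))" for s
      using shift(2)[OF integrable_norm[OF iF'], of s] by (simp add: H_def)
    then show "integrable lborel (\<lambda>s. LINT y|lborel. norm (case_prod H (s, y)))"
      using borel_integrable_atLeastAtMost'[of 0 1 "\<lambda>_. (LINT y|lborel. norm (F' y))"]
      by (simp add: set_integrable_def)
    show "AE s in lborel. integrable lborel (\<lambda>y. case_prod H (s, y))"
      using shift(1)[OF iF'] by (auto simp: H_def)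
  qed
  from lborel_pair.Fubini_integral[OF this]
  have *: "(LINT y|lborel. LINT s|lborel. H s y) = (LINT s|lborel. LINT y|lborel. H s y)" .
  have "(LINT s|lborel. H s y) = F (y + 1) - F y" for y
  proof -
    have i: "set_integrable lborel {y..y+1} F'"
      unfolding set_integrable_def by (rule integrable_mult_indicator[OF _ iF']) auto
    \<comment> \<open>F' need not be continuous, so the fundamental theorem comes from the gauge
      integral; this agrees with the Lebesgue integral because F' is integrable.\<close>
    have "(F' has_integral (F (y + 1) - F y)) {y..y+1}"
      by (rule fundamental_theorem_of_calculus) (auto intro: has_vector_derivative_at_within F)
    then have "(LBINT x:{y..y+1}. F' x) = F (y + 1) - F y"
      using set_borel_integral_eq_integral(2)[OF i] by (simp add: integral_unique)
    moreover have "(LBINT x:{y..y+1}. F' x) = (LINT s|lborel. H s y)"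
      unfolding set_lebesgue_integral_def
      by (subst lborel_integral_real_affine[of 1 _ y])
        (auto simp: H_def indicator_def intro!: Bochner_Integration.integral_cong)
    ultimately show ?thesis by simp
  qed
  then have "(LINT y|lborel. LINT s|lborel. H s y) = 0"
    using shift[OF iF, of 1] iF by simp
  moreover have "(LINT s|lborel. LINT y|lborel. H s y) = (LINT y|lborel. F' y)"
    using shift(2)[OF iF'] by (simp add: H_def)
  ultimately show ?thesis using * by simp
qed

section \<open>Coefficient estimates\<close>

text \<open>The complex conjugate of the Fourier transform of
  \<open>wfam \<phi> \<psi> i\<close>.\<close>

definition wfreq :: "(real \<Rightarrow> complex) \<Rightarrow> (real \<Rightarrow> complex) \<Rightarrow> int + nat \<times> int \<Rightarrow> real \<Rightarrow> complex" where
  "wfreq \<Phi> \<Psi> i y = (case i of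
      Inl k \<Rightarrow> cnj (\<Phi> y) * iexp (y * real_of_int k)
    | Inr (j, l) \<Rightarrow> complex_of_real (2 powr (- real j / 2)) * iexp (y * real_of_int l / 2 ^ j) * cnj (\<Psi> (y / 2 ^ j)))"

definition wcoef :: "(real \<Rightarrow> real \<Rightarrow> complex) \<Rightarrow> (real \<Rightarrow> complex) \<Rightarrow> (real \<Rightarrow> complex) \<Rightarrow> int + nat \<times> int \<Rightarrow> real \<Rightarrow> complex" where
  "wcoef u \<Phi> \<Psi> i t = (case i of Inl k \<Rightarrow> coef_a u \<Phi> k t | Inr (j, l) \<Rightarrow> coef_b u \<Psi> j l t)"

lemma wcoef_eq: "wcoef u \<Phi> \<Psi> i t = (LINT y|lborel. u t y * wfreq \<Phi> \<Psi> i y) / complex_of_real (sqrt (2 * pi))"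
  by (auto simp: wcoef_def coef_a_def coef_b_def wfreq_def mult.assoc split: sum.split prod.split)

lemma cmod_sqrt_2pi: "cmod (complex_of_real (sqrt (2 * pi))) = sqrt (2 * pi)"
  by simp

lemma exp_ii_has_vector_derivative:
  "((\<lambda>y. iexp (y * s)) has_vector_derivative \<i> * complex_of_real s * iexp (y * s)) (at y)"
proof -
  have "((\<lambda>z. exp (\<i> * (z * complex_of_real s))) has_field_derivative
      \<i> * complex_of_real s * exp (\<i> * (complex_of_real y * complex_of_real s))) (at (complex_of_real y))"
    by (auto intro!: derivative_eq_intros simp: field_simps)
  from has_vector_derivative_real_field[OF this] show ?thesis by simp
qed

text \<open>The derivative of G(y) exp(i s y) integrates to 0, so the factor s of the exponential is
  exchanged for a derivative of G.\<close>

lemma fourier_integral_derivative_bound: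
  fixes G G' :: "real \<Rightarrow> complex"
  assumes G: "\<And>y. (G has_vector_derivative G' y) (at y)"
    and iG: "integrable lborel G" and iG': "integrable lborel G'"
  shows "\<bar>s\<bar> * cmod (LINT y|lborel. G y * iexp (y * s)) \<le> (LINT y|lborel. cmod (G' y))"
proof -
  let ?e = "\<lambda>y. iexp (y * s)"
  have ie: "integrable lborel (\<lambda>y. g y * ?e y)" if "integrable lborel g" for g
    by (rule Bochner_Integration.integrable_bound[OF that]) (use that in \<open>auto simp: norm_mult\<close>)
  have d: "((\<lambda>y. G y * ?e y) has_vector_derivative (G y * (\<i> * complex_of_real s * ?e y) + G' y * ?e y)) (at y)" for y
    by (rule has_vector_derivative_mult[OF G exp_ii_has_vector_derivative])
  have i1: "integrable lborel (\<lambda>y. G y * (\<i> * complex_of_real s * ?e y))"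
    using integrable_mult_right[OF ie[OF iG], of "\<i> * complex_of_real s"] by (simp add: algebra_simps)
  have "(LINT y|lborel. G y * (\<i> * complex_of_real s * ?e y) + G' y * ?e y) = 0"
    by (rule integral_vector_derivative_eq_0[OF d]) (intro ie iG iG' i1 Bochner_Integration.integrable_add)+
  then have "(LINT y|lborel. G y * (\<i> * complex_of_real s * ?e y)) + (LINT y|lborel. G' y * ?e y) = 0"
    using Bochner_Integration.integral_add[OF i1 ie[OF iG']] by (simp only:)
  then have "(LINT y|lborel. G y * (\<i> * complex_of_real s * ?e y)) = - (LINT y|lborel. G' y * ?e y)"
    by (simp only: eq_neg_iff_add_eq_0)
  moreover have "(LINT y|lborel. G y * (\<i> * complex_of_real s * ?e y)) = \<i> * complex_of_real s * (LINT y|lborel. G y * ?e y)"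
    by (subst integral_mult_right_zero[symmetric]) (simp add: algebra_simps)
  ultimately have "\<i> * complex_of_real s * (LINT y|lborel. G y * ?e y) = - (LINT y|lborel. G' y * ?e y)"
    by (simp only:)
  then have "cmod (\<i> * complex_of_real s * (LINT y|lborel. G y * ?e y)) = cmod (LINT y|lborel. G' y * ?e y)"
    by (simp only: norm_minus_cancel)
  also have "\<dots> \<le> (LINT y|lborel. cmod (G' y * ?e y))" by (rule integral_norm_bound)
  finally show ?thesis by (simp add: norm_mult)
qed

section \<open>Deterministic bounds for the kernel and the wavelet\<close>

locale wavelet_kernel =
  fixes \<phi> \<psi> \<Phi> \<Psi> d\<Phi> d\<Psi> :: "real \<Rightarrow> complex"
    and u du :: "real \<Rightarrow> real \<Rightarrow> complex" and u1 u2 :: "real \<Rightarrow> real" and C :: real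
  assumes wav: "mra_wavelet \<phi> \<psi>" and Phi: "fourier_L2 \<phi> \<Phi>" and Psi: "fourier_L2 \<psi> \<Psi>"
    and du: "\<And>t y. (u t has_vector_derivative du t y) (at y)"
    and dPhi: "\<And>y. (\<Phi> has_vector_derivative d\<Phi> y) (at y)"
    and dPsi: "\<And>y. (\<Psi> has_vector_derivative d\<Psi> y) (at y)"
    and dPsi_bd: "\<And>y. cmod (d\<Psi> y) \<le> C"
    and u_bd: "\<And>t y. cmod (u t y) \<le> u1 y"
    and du_bd: "\<And>t y. cmod (du t y) \<le> \<bar>t\<bar> * u2 y"
    and int1: "integrable lborel (\<lambda>y. u1 y * \<bar>y\<bar>)"
    and int2: "integrable lborel u1"
    and int3: "integrable lborel (\<lambda>y. u1 y * cmod (d\<Phi> y))"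
    and int4: "integrable lborel (\<lambda>y. u1 y * cmod (\<Phi> y))"
    and int5: "integrable lborel (\<lambda>y. u2 y * \<bar>y\<bar>)"
    and int6: "integrable lborel (\<lambda>y. u2 y * cmod (\<Phi> y))"
begin

lemma C_nonneg: "C \<ge> 0"
  using dPsi_bd[of 0] norm_ge_zero order_trans by blast

lemma u1_nonneg: "u1 y \<ge> 0"
  using u_bd[of 0 y] norm_ge_zero order_trans by blast

lemma u2_nonneg: "u2 y \<ge> 0"
  using order_trans[OF norm_ge_zero du_bd[of 1 y]] by simp

lemma continuous_Phi: "continuous_on A \<Phi>"
  using dPhi by (intro continuous_at_imp_continuous_on) (auto intro: has_vector_derivative_continuous)

lemma continuous_Psi: "continuous_on A \<Psi>"
  using dPsi by (intro continuous_at_imp_continuous_on) (auto intro: has_vector_derivative_continuous)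

lemma continuous_u: "continuous_on A (u t)"
  using du by (intro continuous_at_imp_continuous_on) (auto intro: has_vector_derivative_continuous)

lemma measurable_setting [measurable]:
  "\<Phi> \<in> borel_measurable borel" "\<Psi> \<in> borel_measurable borel" "u t \<in> borel_measurable borel"
  "du t \<in> borel_measurable borel" "d\<Phi> \<in> borel_measurable borel" "d\<Psi> \<in> borel_measurable borel"
  "u1 \<in> borel_measurable borel"
  using borel_measurable_integrable[OF int2]
  by (auto intro: borel_measurable_continuous_onI continuous_Phi continuous_Psi continuous_u
      vector_derivative_borel_measurable du dPhi dPsi)

lemma sq_int_psi: "sq_int lborel \<psi>"
  using wav by (simp add: mra_wavelet_def l2fun_eq_sq_int)

lemma sq_int_phi: "sq_int lborel \<phi>"
  using wav by (simp add: mra_wavelet_def mra_scaling_def l2fun_eq_sq_int)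

lemma Phi_0: "\<Phi> 0 \<noteq> 0"
  using wav by (intro scaling_fourier_nonzero[OF _ Phi continuous_Phi]) (simp add: mra_wavelet_def)

lemma Psi_0: "\<Psi> 0 = 0"
  by (rule wavelet_fourier_zero[OF wav Psi continuous_Psi])

text \<open>The mean value inequality combined with \<Psi> 0 = 0. Linear vanishing at the origin
  turns the dilation y/2^j into a gain of 2^-j.\<close>

lemma cmod_Psi_le: "cmod (\<Psi> y) \<le> C * \<bar>y\<bar>"
proof -
  have "cmod (\<Psi> y - \<Psi> 0) \<le> C * norm (y - 0)"
  proof (rule differentiable_bound[where S=UNIV and f'="\<lambda>y h. h *\<^sub>R d\<Psi> y"])
    show "(\<Psi> has_derivative (\<lambda>h. h *\<^sub>R d\<Psi> x)) (at x within UNIV)" for x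
      using dPsi[of x] by (simp add: has_vector_derivative_def)
    show "onorm (\<lambda>h. h *\<^sub>R d\<Psi> x) \<le> C" for x
      by (rule onorm_bound[OF C_nonneg]) (simp add: mult.commute[of C] mult_left_mono dPsi_bd)
  qed auto
  then show ?thesis by (simp add: Psi_0)
qed

text \<open>Near the origin \<Phi> is bounded away from 0, so \<open>int6\<close> controls u2; for
  \<bar>y\<bar> \<ge> r the factor \<bar>y\<bar> / r is at least 1, so \<open>int5\<close>
  does.\<close>

lemma u2_integrable: "integrable lborel u2"
proof -
  have [measurable]: "u2 \<in> borel_measurable borel"
  proof -
    have [measurable]: "(\<lambda>y. u2 y * \<bar>y\<bar>) \<in> borel_measurable borel"
      using borel_measurable_integrable[OF int5] by simp
    \<comment> \<open>Measurability of u2 is recovered from the product with \<bar>y\<bar> by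
      division; the point 0, where this loses information, is patched by hand.\<close>
    have "(\<lambda>y. if y = 0 then u2 0 else (u2 y * \<bar>y\<bar>) / \<bar>y\<bar>) \<in> borel_measurable borel"
      by measurable
    also have "(\<lambda>y. if y = 0 then u2 0 else (u2 y * \<bar>y\<bar>) / \<bar>y\<bar>) = u2" by auto
    finally show ?thesis .
  qed
  define c where "c = cmod (\<Phi> 0) / 2"
  have c: "c > 0" using Phi_0 by (simp add: c_def)
  have "isCont \<Phi> 0" using continuous_Phi[of UNIV] by (simp add: continuous_on_eq_continuous_at)
  then obtain r where r: "r > 0" "\<And>x. \<bar>x\<bar> < r \<Longrightarrow> cmod (\<Phi> x - \<Phi> 0) < c"
    using c unfolding continuous_at_eps_delta by (auto simp: dist_norm)
  have bd: "u2 y \<le> (1 / c) * (u2 y * cmod (\<Phi> y)) + (1 / r) * (u2 y * \<bar>y\<bar>)" for y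
  proof (cases "\<bar>y\<bar> < r")
    case True
    have "2 * c = cmod (\<Phi> 0)" by (simp add: c_def)
    then have "c \<le> cmod (\<Phi> y)"
      using r(2)[OF True] norm_triangle_ineq2[of "\<Phi> 0" "\<Phi> y"] by (simp add: norm_minus_commute)
    then have "u2 y * 1 \<le> u2 y * (cmod (\<Phi> y) / c)" using c u2_nonneg by (intro mult_left_mono) auto
    moreover have "0 \<le> (1 / r) * (u2 y * \<bar>y\<bar>)" using r u2_nonneg by simp
    ultimately show ?thesis by simp
  next
    case False
    then have "u2 y * 1 \<le> u2 y * (\<bar>y\<bar> / r)" using r u2_nonneg by (intro mult_left_mono) auto
    moreover have "0 \<le> (1 / c) * (u2 y * cmod (\<Phi> y))" using c u2_nonneg by simp
    ultimately show ?thesis by simp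
  qed
  show ?thesis
  proof (rule Bochner_Integration.integrable_bound)
    show "integrable lborel (\<lambda>y. (1 / c) * (u2 y * cmod (\<Phi> y)) + (1 / r) * (u2 y * \<bar>y\<bar>))"
      by (intro Bochner_Integration.integrable_add integrable_mult_right int5 int6)
    show "AE y in lborel. norm (u2 y) \<le> norm ((1 / c) * (u2 y * cmod (\<Phi> y)) + (1 / r) * (u2 y * \<bar>y\<bar>))"
      using bd u2_nonneg by (intro AE_I2) (smt (verit) real_norm_def)
  qed simp
qed

lemma u2_measurable [measurable]: "u2 \<in> borel_measurable borel"
  using borel_measurable_integrable[OF u2_integrable] by simp

text \<open>After one integration by parts the product rule gives two terms: u with the derivative
  of \<Phi> yields S1, and the derivative of u with \<Phi> yields S2 \<bar>t\<bar>.\<close>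

lemma coef_a_bound:
  assumes k: "k \<noteq> 0"
  shows "cmod (coef_a u \<Phi> k t) \<le>
    ((LINT y|lborel. u1 y * cmod (d\<Phi> y)) / sqrt (2 * pi) + (LINT y|lborel. u2 y * cmod (\<Phi> y)) / sqrt (2 * pi) * \<bar>t\<bar>) / \<bar>real_of_int k\<bar>"
proof -
  let ?G = "\<lambda>y. u t y * cnj (\<Phi> y)"
  let ?G' = "\<lambda>y. u t y * cnj (d\<Phi> y) + du t y * cnj (\<Phi> y)"
  have d: "(?G has_vector_derivative ?G' y) (at y)" for y
    by (intro has_vector_derivative_mult du has_vector_derivative_cnj dPhi)
  have iG: "integrable lborel ?G"
    by (rule Bochner_Integration.integrable_bound[OF int4])
      (use u1_nonneg in \<open>auto simp: norm_mult abs_mult intro!: mult_right_mono order_trans[OF u_bd]\<close>)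
  let ?B = "\<lambda>y. u1 y * cmod (d\<Phi> y) + \<bar>t\<bar> * (u2 y * cmod (\<Phi> y))"
  have iB: "integrable lborel ?B"
    by (intro Bochner_Integration.integrable_add integrable_mult_right int3 int6)
  have bd: "cmod (?G' y) \<le> ?B y" for y
  proof -
    have "cmod (?G' y) \<le> cmod (u t y) * cmod (d\<Phi> y) + cmod (du t y) * cmod (\<Phi> y)"
      by (rule order_trans[OF norm_triangle_ineq]) (simp add: norm_mult)
    also have "\<dots> \<le> u1 y * cmod (d\<Phi> y) + \<bar>t\<bar> * u2 y * cmod (\<Phi> y)"
      by (intro add_mono mult_right_mono u_bd du_bd) auto
    finally show ?thesis by (simp add: mult.assoc)
  qed
  have iG': "integrable lborel ?G'"
    by (rule Bochner_Integration.integrable_bound[OF iB])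
      (measurable, intro AE_I2 order_trans[OF bd], simp only: real_norm_def abs_ge_self)
  have "\<bar>real_of_int k\<bar> * cmod (LINT y|lborel. ?G y * iexp (y * real_of_int k)) \<le> (LINT y|lborel. cmod (?G' y))"
    by (rule fourier_integral_derivative_bound[OF d iG iG'])
  also have "\<dots> \<le> (LINT y|lborel. ?B y)"
    by (intro integral_mono integrable_norm iG' iB bd)
  also have "\<dots> = (LINT y|lborel. u1 y * cmod (d\<Phi> y)) + \<bar>t\<bar> * (LINT y|lborel. u2 y * cmod (\<Phi> y))"
    using int3 int6 by simp
  finally have "cmod (LINT y|lborel. ?G y * iexp (y * real_of_int k))
      \<le> ((LINT y|lborel. u1 y * cmod (d\<Phi> y)) + \<bar>t\<bar> * (LINT y|lborel. u2 y * cmod (\<Phi> y))) / \<bar>real_of_int k\<bar>"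
    using k by (simp add: field_simps)
  then have "cmod (coef_a u \<Phi> k t) \<le> ((LINT y|lborel. u1 y * cmod (d\<Phi> y)) + \<bar>t\<bar> * (LINT y|lborel. u2 y * cmod (\<Phi> y))) / \<bar>real_of_int k\<bar> / sqrt (2 * pi)"
    unfolding coef_a_def norm_divide cmod_sqrt_2pi
    by (rule divide_right_mono) simp
  then show ?thesis by (simp add: add_divide_distrib mult.commute)
qed

text \<open>The modulation frequency is only l/2^j, so integrating by parts costs 2^j. Both terms of
  the product rule repay it: the derivative of \<Psi> (y / 2^j) through the chain rule, and \<Psi>
  (y / 2^j) itself through \<open>cmod_Psi_le\<close>. The normalisation 2^(-j/2) survives.\<close>

lemma coef_b_bound:
  assumes l: "l \<noteq> 0"
  shows "cmod (coef_b u \<Psi> j l t) \<le> 2 powr (- real j / 2) *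
    (C / sqrt (2 * pi) * (LINT y|lborel. u1 y) + C / sqrt (2 * pi) * (LINT y|lborel. u2 y * \<bar>y\<bar>) * \<bar>t\<bar>) / \<bar>real_of_int l\<bar>"
proof -
  define s where "s = 2 powr (- real j / 2)"
  have s: "s > 0" by (simp add: s_def)
  let ?G = "\<lambda>y. u t y * cnj (\<Psi> (y / 2 ^ j))"
  let ?G' = "\<lambda>y. u t y * cnj ((1 / 2 ^ j) *\<^sub>R d\<Psi> (y / 2 ^ j)) + du t y * cnj (\<Psi> (y / 2 ^ j))"
  have dP: "((\<lambda>y. \<Psi> (y / 2 ^ j)) has_vector_derivative (1 / 2 ^ j) *\<^sub>R d\<Psi> (y / 2 ^ j)) (at y)" for y
  proof -
    have "((\<lambda>y. y / 2 ^ j) has_vector_derivative (1 / 2 ^ j :: real)) (at y)"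
      unfolding has_real_derivative_iff_has_vector_derivative[symmetric] by (auto intro!: derivative_eq_intros)
    from vector_diff_chain_at[OF this dPsi] show ?thesis by (simp add: o_def)
  qed
  have d: "(?G has_vector_derivative ?G' y) (at y)" for y
    by (intro has_vector_derivative_mult du has_vector_derivative_cnj dP)
  have Psi_le: "cmod (\<Psi> (y / 2 ^ j)) \<le> C / 2 ^ j * \<bar>y\<bar>" for y
    using cmod_Psi_le[of "y / 2 ^ j"] by simp
  have iG: "integrable lborel ?G"
  proof (rule Bochner_Integration.integrable_bound[OF integrable_mult_right[OF int1, of "C / 2 ^ j"]])
    have "cmod (?G y) \<le> u1 y * (C / 2 ^ j * \<bar>y\<bar>)" for y
      unfolding norm_mult complex_mod_cnj by (intro mult_mono u_bd Psi_le u1_nonneg) auto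
    then show "AE y in lborel. norm (?G y) \<le> norm (C / 2 ^ j * (u1 y * \<bar>y\<bar>))"
      using u1_nonneg C_nonneg by (intro AE_I2) (simp add: algebra_simps)
  qed simp
  let ?B = "\<lambda>y. C / 2 ^ j * u1 y + \<bar>t\<bar> * (C / 2 ^ j * (u2 y * \<bar>y\<bar>))"
  have iB: "integrable lborel ?B"
    by (intro Bochner_Integration.integrable_add integrable_mult_right int2 int5)
  have bd: "cmod (?G' y) \<le> ?B y" for y
  proof -
    have "cmod (?G' y) \<le> cmod (u t y) * (cmod (d\<Psi> (y / 2 ^ j)) / 2 ^ j) + cmod (du t y) * cmod (\<Psi> (y / 2 ^ j))"
      by (rule order_trans[OF norm_triangle_ineq]) (simp add: norm_mult)
    also have "\<dots> \<le> u1 y * (C / 2 ^ j) + (\<bar>t\<bar> * u2 y) * (C / 2 ^ j * \<bar>y\<bar>)"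
      using u2_nonneg u1_nonneg
      by (intro add_mono mult_mono u_bd du_bd divide_right_mono dPsi_bd Psi_le) auto
    finally show ?thesis by (simp add: algebra_simps)
  qed
  have iG': "integrable lborel ?G'"
    by (rule Bochner_Integration.integrable_bound[OF iB])
      (measurable, intro AE_I2 order_trans[OF bd], simp only: real_norm_def abs_ge_self)
  have "\<bar>real_of_int l / 2 ^ j\<bar> * cmod (LINT y|lborel. ?G y * iexp (y * (real_of_int l / 2 ^ j))) \<le> (LINT y|lborel. cmod (?G' y))"
    by (rule fourier_integral_derivative_bound[OF d iG iG'])
  also have "\<dots> \<le> (LINT y|lborel. ?B y)"
    by (intro integral_mono integrable_norm iG' iB bd)
  also have "\<dots> = (C * (LINT y|lborel. u1 y) + \<bar>t\<bar> * (C * (LINT y|lborel. u2 y * \<bar>y\<bar>))) / 2 ^ j"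
    using int2 int5 by (simp add: add_divide_distrib)
  finally have "cmod (LINT y|lborel. ?G y * iexp (y * (real_of_int l / 2 ^ j)))
      \<le> (C * (LINT y|lborel. u1 y) + \<bar>t\<bar> * (C * (LINT y|lborel. u2 y * \<bar>y\<bar>))) / \<bar>real_of_int l\<bar>"
    using l by (simp add: field_simps)
  moreover have "coef_b u \<Psi> j l t = complex_of_real (s / sqrt (2 * pi)) * (LINT y|lborel. ?G y * iexp (y * (real_of_int l / 2 ^ j)))"
  proof -
    have "(LINT y|lborel. u t y * complex_of_real s * iexp (y * real_of_int l / 2 ^ j) * cnj (\<Psi> (y / 2 ^ j)))
      = (LINT y|lborel. complex_of_real s * (?G y * iexp (y * (real_of_int l / 2 ^ j))))"
      by (intro Bochner_Integration.integral_cong) auto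
    then show ?thesis unfolding coef_b_def s_def[symmetric] by simp
  qed
  ultimately have "cmod (coef_b u \<Psi> j l t) \<le> s / sqrt (2 * pi) * ((C * (LINT y|lborel. u1 y) + \<bar>t\<bar> * (C * (LINT y|lborel. u2 y * \<bar>y\<bar>))) / \<bar>real_of_int l\<bar>)"
    using s by (simp only: norm_mult norm_of_real) (intro mult_mono, auto)
  also have "\<dots> = s * (C / sqrt (2 * pi) * (LINT y|lborel. u1 y) + C / sqrt (2 * pi) * (LINT y|lborel. u2 y * \<bar>y\<bar>) * \<bar>t\<bar>) / \<bar>real_of_int l\<bar>"
    by (simp add: add_divide_distrib algebra_simps)
  finally show ?thesis by (simp add: s_def)
qed

section \<open>Primitives of the basis spectra\<close>

definition wprim :: "int + nat \<times> int \<Rightarrow> real \<Rightarrow> complex" where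
  "wprim i y = (LBINT v=0..y. wfreq \<Phi> \<Psi> i v)"

lemma continuous_wfreq: "continuous_on A (wfreq \<Phi> \<Psi> i)"
proof (cases i)
  case (Inl k)
  then show ?thesis
    by (simp add: wfreq_def[abs_def] continuous_intros continuous_Phi)
next
  case (Inr p)
  obtain j l where "p = (j, l)" by (cases p)
  with Inr show ?thesis
    by (auto simp: wfreq_def[abs_def] intro!: continuous_intros continuous_on_compose2[OF continuous_Psi[of UNIV]])
qed

lemma wprim_has_vector_derivative: "(wprim i has_vector_derivative wfreq \<Phi> \<Psi> i y) (at y)"
proof -
  \<comment> \<open>One interval containing the base point 0 and having y in its interior, so that
    the one-sided form of the derivative becomes two-sided.\<close>
  define a b where "a = - \<bar>y\<bar> - 1" and "b = \<bar>y\<bar> + 1"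
  have ab: "a < y" "y < b" "a \<le> 0" "0 \<le> b" by (auto simp: a_def b_def)
  have "(wprim i has_vector_derivative wfreq \<Phi> \<Psi> i y) (at y within {a..b})"
    unfolding wprim_def[abs_def] zero_ereal_def
    using ab by (intro interval_integral_FTC2 continuous_wfreq) auto
  then show ?thesis using ab by (simp add: at_within_Icc_at)
qed

text \<open>Up to sign, the primitive pairs a basis spectrum with the indicator of the interval
  between 0 and y. In the time domain this is an inner product with \<open>wfam\<close>, where
  orthonormality is at hand.\<close>

lemma cmod_wprim: "cmod (wprim i y) = cmod (ip lborel (osc (min 0 y) (max 0 y)) (wfam \<phi> \<psi> i))"
proof -
  have *: "(LBINT v:{a..b}. wfreq \<Phi> \<Psi> i v) = ip lborel (osc a b) (wfam \<phi> \<psi> i)" if "a \<le> b" for a b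
  proof (cases i)
    case (Inl k)
    then show ?thesis
      using fourier_pairing_dil[OF Phi sq_int_phi continuous_Phi that, of 0 k]
      by (simp add: wfreq_def wfam_def mult.commute)
  next
    case (Inr p)
    obtain j l where "p = (j, l)" by (cases p)
    with Inr show ?thesis
      using fourier_pairing_dil[OF Psi sq_int_psi continuous_Psi that, of j l]
      by (simp add: wfreq_def wfam_def)
  qed
  show ?thesis
  proof (cases "0 \<le> y")
    case True
    then show ?thesis unfolding wprim_def zero_ereal_def
      by (simp add: interval_integral_Icc *)
  next
    case False
    then show ?thesis unfolding wprim_def zero_ereal_def
      by (subst interval_integral_endpoints_reverse) (simp add: interval_integral_Icc * norm_minus_cancel)
  qed
qed

lemma wprim_bessel:
  assumes "finite J" shows "(\<Sum>i\<in>J. (cmod (wprim i y))\<^sup>2) \<le> osc_const * \<bar>y\<bar>"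
proof -
  have "(\<Sum>i\<in>J. (cmod (wprim i y))\<^sup>2) \<le> nsq lborel (osc (min 0 y) (max 0 y))"
    unfolding cmod_wprim
    by (rule bessel[OF assms sq_int_osc]) (auto simp: sq_int_wfam[OF wav] ip_wfam[OF wav])
  also have "\<dots> \<le> osc_const * (max 0 y - min 0 y)" by (rule nsq_osc_le) simp
  also have "max 0 y - min 0 y = \<bar>y\<bar>" by (auto simp: max_def min_def)
  finally show ?thesis .
qed

text \<open>Trades the square root growth from Bessel's inequality for linear growth, so that
  integrability of u1, u2 and of their products with \<bar>y\<bar> suffices.\<close>

lemma cmod_wprim_le: "cmod (wprim i y) \<le> 1 + osc_const * \<bar>y\<bar>"
proof -
  have "(cmod (wprim i y))\<^sup>2 \<le> osc_const * \<bar>y\<bar>" using wprim_bessel[of "{i}" y] by simp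
  moreover have "2 * cmod (wprim i y) \<le> 1 + (cmod (wprim i y))\<^sup>2"
    using sum_squares_bound[of 1 "cmod (wprim i y)"] by simp
  ultimately show ?thesis using norm_ge_zero[of "wprim i y"] by linarith
qed

lemma wprim_measurable [measurable]: "wprim i \<in> borel_measurable borel"
  by (intro borel_measurable_continuous_onI continuous_at_imp_continuous_on ballI
      has_vector_derivative_continuous[OF wprim_has_vector_derivative])

lemma wfreq_measurable [measurable]: "wfreq \<Phi> \<Psi> i \<in> borel_measurable borel"
  by (intro borel_measurable_continuous_onI continuous_wfreq)

lemma cmod_u_wfreq_le:
  "cmod (u t y * wfreq \<Phi> \<Psi> (Inr (j, l)) y) \<le> 2 powr (- real j / 2) * C / 2 ^ j * (u1 y * \<bar>y\<bar>)"
proof -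
  define s where "s = 2 powr (- real j / 2)"
  have s: "s > 0" by (simp add: s_def)
  have "cmod (u t y) * cmod (\<Psi> (y / 2 ^ j)) \<le> u1 y * (C * \<bar>y / 2 ^ j\<bar>)"
    by (intro mult_mono u_bd cmod_Psi_le u1_nonneg) auto
  then have "s * (cmod (u t y) * cmod (\<Psi> (y / 2 ^ j))) \<le> s * (u1 y * (C * \<bar>y / 2 ^ j\<bar>))"
    using s by (intro mult_left_mono) auto
  moreover have "cmod (wfreq \<Phi> \<Psi> (Inr (j, l)) y) = s * cmod (\<Psi> (y / 2 ^ j))"
    using s unfolding wfreq_def sum.case prod.case s_def[symmetric] by (simp add: norm_mult)
  ultimately show ?thesis unfolding s_def[symmetric] by (simp add: norm_mult algebra_simps)
qed

lemma integrable_u_wfreq: "integrable lborel (\<lambda>y. u t y * wfreq \<Phi> \<Psi> i y)"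
proof (cases i)
  case (Inl k)
  show ?thesis
    by (rule Bochner_Integration.integrable_bound[OF int4])
      (use u1_nonneg Inl in \<open>auto simp: wfreq_def norm_mult abs_mult intro!: mult_right_mono order_trans[OF u_bd]\<close>)
next
  case (Inr p)
  obtain j l where p: "p = (j, l)" by (cases p)
  show ?thesis unfolding Inr p
    by (rule Bochner_Integration.integrable_bound[OF integrable_mult_right[OF int1, of "2 powr (- real j / 2) * C / 2 ^ j"]])
      (measurable, intro AE_I2 order_trans[OF cmod_u_wfreq_le], simp only: real_norm_def abs_ge_self)
qed

text \<open>Covers l = 0, where there is no oscillation for integration by parts to exploit. The
  decay in j comes instead from the linear vanishing of \<Psi> at the origin.\<close>

lemma coef_b_scale_bound:
  "cmod (coef_b u \<Psi> j l t) \<le> 2 powr (- real j / 2) * (C / sqrt (2 * pi) * (LINT y|lborel. u1 y * \<bar>y\<bar>)) / 2 ^ j"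
proof -
  have "cmod (LINT y|lborel. u t y * wfreq \<Phi> \<Psi> (Inr (j, l)) y)
      \<le> (LINT y|lborel. 2 powr (- real j / 2) * C / 2 ^ j * (u1 y * \<bar>y\<bar>))"
    by (intro Bochner_Integration.integral_norm_bound_integral integrable_u_wfreq cmod_u_wfreq_le
        integrable_mult_right int1)
  also have "\<dots> = 2 powr (- real j / 2) * C / 2 ^ j * (LINT y|lborel. u1 y * \<bar>y\<bar>)"
    by (rule integral_mult_right_zero)
  finally have "cmod (wcoef u \<Phi> \<Psi> (Inr (j, l)) t)
      \<le> 2 powr (- real j / 2) * C / 2 ^ j * (LINT y|lborel. u1 y * \<bar>y\<bar>) / sqrt (2 * pi)"
    unfolding wcoef_eq norm_divide cmod_sqrt_2pi by (intro divide_right_mono) simp_all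
  then show ?thesis by (simp add: wcoef_def algebra_simps)
qed

lemma integrable_du_wprim: "integrable lborel (\<lambda>y. du t y * wprim i y)"
proof (rule Bochner_Integration.integrable_bound)
  show "integrable lborel (\<lambda>y. \<bar>t\<bar> * u2 y + \<bar>t\<bar> * osc_const * (u2 y * \<bar>y\<bar>))"
    by (intro Bochner_Integration.integrable_add integrable_mult_right u2_integrable int5)
  have "cmod (du t y * wprim i y) \<le> (\<bar>t\<bar> * u2 y) * (1 + osc_const * \<bar>y\<bar>)" for y
    unfolding norm_mult using u2_nonneg by (intro mult_mono du_bd cmod_wprim_le) auto
  then show "AE y in lborel. norm (du t y * wprim i y) \<le> norm (\<bar>t\<bar> * u2 y + \<bar>t\<bar> * osc_const * (u2 y * \<bar>y\<bar>))"
    by (intro AE_I2) (auto simp: algebra_simps intro: order_trans[OF _ abs_ge_self])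
qed measurable

text \<open>Moves the derivative onto u. The time variable then enters through \<open>du t\<close>,
  whose bound \<bar>t\<bar> * u2 y is uniform for t in bounded sets.\<close>

lemma integral_u_wfreq: "(LINT y|lborel. u t y * wfreq \<Phi> \<Psi> i y) = - (LINT y|lborel. du t y * wprim i y)"
proof -
  have d: "((\<lambda>y. u t y * wprim i y) has_vector_derivative (u t y * wfreq \<Phi> \<Psi> i y + du t y * wprim i y)) (at y)" for y
    by (intro has_vector_derivative_mult du wprim_has_vector_derivative)
  have i: "integrable lborel (\<lambda>y. u t y * wprim i y)"
  proof (rule Bochner_Integration.integrable_bound)
    show "integrable lborel (\<lambda>y. u1 y + osc_const * (u1 y * \<bar>y\<bar>))"
      by (intro Bochner_Integration.integrable_add integrable_mult_right int2 int1)
    have "cmod (u t y * wprim i y) \<le> u1 y * (1 + osc_const * \<bar>y\<bar>)" for y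
      unfolding norm_mult using u1_nonneg by (intro mult_mono u_bd cmod_wprim_le) auto
    then show "AE y in lborel. norm (u t y * wprim i y) \<le> norm (u1 y + osc_const * (u1 y * \<bar>y\<bar>))"
      by (intro AE_I2) (auto simp: algebra_simps intro: order_trans[OF _ abs_ge_self])
  qed measurable
  have "(LINT y|lborel. u t y * wfreq \<Phi> \<Psi> i y + du t y * wprim i y) = 0"
    by (rule integral_vector_derivative_eq_0[OF d i])
      (intro Bochner_Integration.integrable_add integrable_u_wfreq integrable_du_wprim)
  then show ?thesis
    by (simp add: integrable_u_wfreq integrable_du_wprim eq_neg_iff_add_eq_0)
qed

end

section \<open>Tail of the coefficient sequence\<close>

text \<open>Telescoping, as 1/k^2 \<le> 1/(k - 1) - 1/k.\<close>

lemma sum_inverse_squares_nat: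
  assumes "2 \<le> m" shows "(\<Sum>k=m..n. 1 / (real k)\<^sup>2) \<le> 1 / (real m - 1)"
proof -
  have "(\<Sum>k=m..n. 1 / (real k)\<^sup>2) \<le> 1 / (real m - 1) - 1 / real n" if "m \<le> n + 1" "n \<ge> 1"
    using that
  proof (induction n)
    case (Suc n)
    show ?case
    proof (cases "m = Suc (Suc n)")
      case True
      then show ?thesis by simp
    next
      case False
      then have mn: "m \<le> Suc n" using Suc.prems by simp
      then have n: "n \<ge> 1" using assms by simp
      have "1 / (real (Suc n))\<^sup>2 \<le> 1 / (real n * real (Suc n))"
        using n by (intro divide_left_mono) (auto simp: power2_eq_square)
      also have "\<dots> = 1 / real n - 1 / real (Suc n)" using n by (simp add: field_simps)
      finally have "1 / (real (Suc n))\<^sup>2 \<le> 1 / real n - 1 / real (Suc n)" .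
      moreover have "(\<Sum>k=m..n. 1 / (real k)\<^sup>2) \<le> 1 / (real m - 1) - 1 / real n"
        using Suc.IH mn n by simp
      ultimately show ?thesis using mn by (simp add: sum.atLeast_Suc_atMost)
    qed
  qed simp
  moreover have "(\<Sum>k=m..n. 1 / (real k)\<^sup>2) \<le> 1 / (real m - 1)" if "\<not> (m \<le> n + 1 \<and> n \<ge> 1)"
  proof -
    have "{m..n} = {}" using that assms by auto
    then show ?thesis using assms by simp
  qed
  moreover have "1 / (real m - 1) - 1 / real n \<le> 1 / (real m - 1)" by simp
  ultimately show ?thesis by (meson order_trans)
qed

lemma sum_inverse_squares_int:
  assumes fin: "finite A" and A: "\<And>k. k \<in> A \<Longrightarrow> int m \<le> \<bar>k\<bar>" and m: "2 \<le> m"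
  shows "(\<Sum>k\<in>A. 1 / (real_of_int k)\<^sup>2) \<le> 2 / (real m - 1)"
proof -
  obtain n where n: "\<And>k. k \<in> A \<Longrightarrow> nat \<bar>k\<bar> \<le> n"
    using finite_nat_set_iff_bounded_le[of "(\<lambda>k. nat \<bar>k\<bar>) ` A"] fin by auto
  have "A \<subseteq> int ` {m..n} \<union> (\<lambda>k. - int k) ` {m..n}"
  proof
    fix k assume k: "k \<in> A"
    then have "nat \<bar>k\<bar> \<in> {m..n}" using A[OF k] n[OF k] by auto
    moreover have "k = int (nat \<bar>k\<bar>) \<or> k = - int (nat \<bar>k\<bar>)" by auto
    ultimately show "k \<in> int ` {m..n} \<union> (\<lambda>k. - int k) ` {m..n}" by blast
  qed
  then have "(\<Sum>k\<in>A. 1 / (real_of_int k)\<^sup>2) \<le> (\<Sum>k\<in>int ` {m..n} \<union> (\<lambda>k. - int k) ` {m..n}. 1 / (real_of_int k)\<^sup>2)"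
    by (intro sum_mono2) auto
  also have "\<dots> \<le> (\<Sum>k\<in>int ` {m..n}. 1 / (real_of_int k)\<^sup>2) + (\<Sum>k\<in>(\<lambda>k. - int k) ` {m..n}. 1 / (real_of_int k)\<^sup>2)"
    using sum_nonneg[of "int ` {m..n} \<inter> (\<lambda>k. - int k) ` {m..n}" "\<lambda>k. 1 / (real_of_int k)\<^sup>2"]
    by (subst sum_Un) auto
  also have "\<dots> = 2 * (\<Sum>k=m..n. 1 / (real k)\<^sup>2)"
    by (simp add: sum.reindex inj_on_def)
  also have "\<dots> \<le> 2 * (1 / (real m - 1))"
    by (intro mult_left_mono sum_inverse_squares_nat m) auto
  finally show ?thesis by simp
qed

text \<open>The indices 1 and -1 contribute at most 2, and all others at most 2 / (2 - 1).\<close>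

lemma sum_inverse_squares_int_nonzero:
  assumes fin: "finite A" and A: "0 \<notin> A"
  shows "(\<Sum>k\<in>A. 1 / (real_of_int k)\<^sup>2) \<le> 4"
proof -
  have "A \<subseteq> {1, -1} \<union> {k\<in>A. 2 \<le> \<bar>k\<bar>}"
  proof
    fix k assume "k \<in> A"
    then show "k \<in> {1, -1} \<union> {k\<in>A. 2 \<le> \<bar>k\<bar>}" using A by (cases "k = 0") auto
  qed
  then have "(\<Sum>k\<in>A. 1 / (real_of_int k)\<^sup>2) \<le> (\<Sum>k\<in>{1, -1} \<union> {k\<in>A. 2 \<le> \<bar>k\<bar>}. 1 / (real_of_int k)\<^sup>2)"
    using fin by (intro sum_mono2) auto
  also have "\<dots> = 2 + (\<Sum>k\<in>{k\<in>A. 2 \<le> \<bar>k\<bar>}. 1 / (real_of_int k)\<^sup>2)"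
    using fin by (subst sum.union_disjoint) auto
  also have "(\<Sum>k\<in>{k\<in>A. 2 \<le> \<bar>k\<bar>}. 1 / (real_of_int k)\<^sup>2) \<le> 2 / (real 2 - 1)"
    by (rule sum_inverse_squares_int) (use fin in auto)
  finally show ?thesis by simp
qed

text \<open>The indices kept by the model. Taking all parameters equal to n gives the increasing
  sets along which the expansion converges.\<close>

definition midx :: "nat \<Rightarrow> nat \<Rightarrow> (nat \<Rightarrow> nat) \<Rightarrow> (int + nat \<times> int) set" where
  "midx N0 N Mj = Inl ` {- (int N0 - 1)..int N0 - 1}
     \<union> Inr ` (SIGMA j:{..<N}. {- (int (Mj j) - 1)..int (Mj j) - 1})"

lemma Inl_in_midx: "Inl k \<in> midx N0 N Mj \<longleftrightarrow> \<bar>k\<bar> < int N0"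
  by (auto simp: midx_def image_iff)

lemma Inr_in_midx: "Inr (j, l) \<in> midx N0 N Mj \<longleftrightarrow> j < N \<and> \<bar>l\<bar> < int (Mj j)"
  by (auto simp: midx_def image_iff)

lemma finite_midx: "finite (midx N0 N Mj)"
  by (auto simp: midx_def)

lemma model_X_eq:
  "model_X u \<Phi> \<Psi> \<xi> \<eta> N0 N Mj t \<omega> =
    (\<Sum>i\<in>midx N0 N Mj. complex_of_real ((case i of Inl k \<Rightarrow> \<xi> k | Inr (j, l) \<Rightarrow> \<eta> j l) \<omega>) * wcoef u \<Phi> \<Psi> i t)"
  unfolding model_X_def midx_def
  by (subst sum.union_disjoint, auto simp: sum.reindex inj_on_def wcoef_def)
    (subst sum.Sigma, auto intro!: sum.cong)

lemma incseq_midx: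
  assumes "m \<le> n" shows "midx m m (\<lambda>_. m) \<subseteq> midx n n (\<lambda>_. n)"
proof
  fix i assume "i \<in> midx m m (\<lambda>_. m)"
  then show "i \<in> midx n n (\<lambda>_. n)"
    using assms by (cases i) (auto simp: Inl_in_midx Inr_in_midx)
qed

lemma midx_covers:
  assumes "finite J" obtains n where "J \<subseteq> midx n n (\<lambda>_. n)"
proof -
  have "\<exists>n. J \<subseteq> midx n n (\<lambda>_. n)"
    using assms
  proof induction
    case (insert i J)
    then obtain n where n: "J \<subseteq> midx n n (\<lambda>_. n)" by auto
    have "\<exists>m. i \<in> midx m m (\<lambda>_. m)"
    proof (cases i)
      case (Inl k)
      then show ?thesis by (intro exI[of _ "nat \<bar>k\<bar> + 1"]) (simp add: Inl_in_midx)
    next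
      case (Inr p)
      obtain j l where "p = (j, l)" by (cases p)
      with Inr show ?thesis by (intro exI[of _ "nat \<bar>l\<bar> + j + 1"]) (simp add: Inr_in_midx)
    qed
    then obtain m where "i \<in> midx m m (\<lambda>_. m)" by auto
    then have "insert i J \<subseteq> midx (max m n) (max m n) (\<lambda>_. max m n)"
      using n incseq_midx[of m "max m n"] incseq_midx[of n "max m n"] by auto
    then show ?case by blast
  qed auto
  then show ?thesis using that by blast
qed

lemma sum_geometric_tail:
  fixes q :: real assumes "0 < q" "q < 1"
  shows "(\<Sum>j=N..<n. q ^ j) \<le> q ^ N / (1 - q)"
proof (cases "N \<le> n")
  case True
  then have "(\<Sum>j=N..<n. q ^ j) * (1 - q) = q ^ N - q ^ n"
  proof (induction n rule: dec_induct)
    case (step n)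
    then show ?case by (simp add: distrib_right right_diff_distrib)
  qed simp
  also have "\<dots> \<le> q ^ N" using assms by simp
  finally show ?thesis using assms by (simp add: pos_le_divide_eq)
qed (use assms in auto)

lemma divide_le_divide_cross:
  fixes a b c d :: real
  assumes "a * d \<le> c * b" "0 < b" "0 < d" shows "a / b \<le> c / d"
  using assms by (simp add: divide_le_eq le_divide_eq mult.commute)

text \<open>A budget argument with x^2/3 for each of three blocks: scaling terms beyond N0, wavelet
  terms beyond Mj at levels below N, and all wavelet terms at levels from N on. The last third is
  divided as 5/18 for l \<noteq> 0 and 1/18 for l = 0, which explains the numbers 72/5 and
  18/7.\<close>

lemma coefficient_tail_sum:
  fixes c :: "int + nat \<times> int \<Rightarrow> complex" and S Q D x :: real
  assumes nonneg: "0 \<le> S" "0 \<le> Q" "0 \<le> D" and x: "x > 0"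
    and cS: "\<And>k. k \<noteq> 0 \<Longrightarrow> cmod (c (Inl k)) \<le> S / \<bar>real_of_int k\<bar>"
    and cQ: "\<And>j l. l \<noteq> 0 \<Longrightarrow> cmod (c (Inr (j, l))) \<le> 2 powr (- real j / 2) * Q / \<bar>real_of_int l\<bar>"
    and cD: "\<And>j. cmod (c (Inr (j, 0))) \<le> 2 powr (- real j / 2) * D / 2 ^ j"
    and N0: "real N0 > 6 / x\<^sup>2 * S\<^sup>2 + 1"
    and NQ: "real N > 1 + log 2 (72 * Q\<^sup>2 / (5 * x\<^sup>2))"
    and ND: "real N > 1 + log 8 (18 * D\<^sup>2 / (7 * x\<^sup>2))"
    and Mj: "\<And>j. j < N \<Longrightarrow> real (Mj j) > 1 + 12 / x\<^sup>2 * Q\<^sup>2 * (1 - 1 / 2 ^ N)"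
    and N: "N > 0" and fin: "finite J" and disj: "J \<inter> midx N0 N Mj = {}"
  shows "(\<Sum>i\<in>J. (cmod (c i))\<^sup>2) \<le> x\<^sup>2"
proof -
  have x2: "x\<^sup>2 > 0" using x by simp
  have s2: "(2 powr (- real j / 2))\<^sup>2 = (1/2) ^ j" for j
    by (simp add: power2_eq_square powr_add[symmetric] powr_minus_divide powr_realpow power_one_over)
  have cQ2: "(cmod (c (Inr (j, l))))\<^sup>2 \<le> (1/2) ^ j * Q\<^sup>2 * (1 / (real_of_int l)\<^sup>2)" if "l \<noteq> 0" for j l
  proof -
    have "(cmod (c (Inr (j, l))))\<^sup>2 \<le> (2 powr (- real j / 2) * Q / \<bar>real_of_int l\<bar>)\<^sup>2"
      by (intro power_mono cQ that) auto
    also have "\<dots> = (1/2) ^ j * Q\<^sup>2 * (1 / (real_of_int l)\<^sup>2)"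
      unfolding power_divide power_mult_distrib s2 by simp
    finally show ?thesis .
  qed
  \<comment> \<open>Squaring 2^(-j/2) 2^(-j) gives 8^(-j), the reason for the logarithm to base 8 in
    \<open>ND\<close>.\<close>
  have cD2: "(cmod (c (Inr (j, 0))))\<^sup>2 \<le> D\<^sup>2 * (1/8) ^ j" for j
  proof -
    have "(cmod (c (Inr (j, 0))))\<^sup>2 \<le> (2 powr (- real j / 2) * D / 2 ^ j)\<^sup>2"
      by (intro power_mono cD) auto
    also have "\<dots> = (1/2) ^ j * D\<^sup>2 / (2 ^ j)\<^sup>2" unfolding power_divide[of _ _ 2] power_mult_distrib s2 by simp
    also have "((2::real) ^ j)\<^sup>2 = 4 ^ j" by (simp add: power2_eq_square power_mult_distrib[symmetric])
    also have "(1/2::real) ^ j * D\<^sup>2 / 4 ^ j = D\<^sup>2 * (1/8) ^ j"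
      by (simp add: power_one_over power_mult_distrib[symmetric] field_simps)
    finally show ?thesis .
  qed
  define A where "A = {k. Inl k \<in> J}"
  define B where "B = {p. Inr p \<in> J}"
  have finA: "finite A" unfolding A_def using finite_vimageI[OF fin, of Inl] by (simp add: vimage_def)
  have finB: "finite B" unfolding B_def using finite_vimageI[OF fin, of Inr] by (simp add: vimage_def)
  have J: "J = Inl ` A \<union> Inr ` B"
  proof (rule set_eqI)
    fix i show "i \<in> J \<longleftrightarrow> i \<in> Inl ` A \<union> Inr ` B" by (cases i) (auto simp: A_def B_def)
  qed
  have sumJ: "(\<Sum>i\<in>J. (cmod (c i))\<^sup>2) = (\<Sum>k\<in>A. (cmod (c (Inl k)))\<^sup>2) + (\<Sum>p\<in>B. (cmod (c (Inr p)))\<^sup>2)"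
    unfolding J using finA finB by (subst sum.union_disjoint) (auto simp: sum.reindex)
  have N02: "2 \<le> N0"
  proof -
    have "0 \<le> 6 / x\<^sup>2 * S\<^sup>2" by simp
    then show ?thesis using N0 by linarith
  qed
  have Ak: "int N0 \<le> \<bar>k\<bar>" if "k \<in> A" for k
    using that disj Inl_in_midx[of k N0 N Mj] by (auto simp: A_def)
  have part1: "(\<Sum>k\<in>A. (cmod (c (Inl k)))\<^sup>2) \<le> x\<^sup>2 / 3"
  proof -
    have "(\<Sum>k\<in>A. (cmod (c (Inl k)))\<^sup>2) \<le> (\<Sum>k\<in>A. S\<^sup>2 * (1 / (real_of_int k)\<^sup>2))"
    proof (rule sum_mono)
      fix k assume "k \<in> A"
      then have "k \<noteq> 0" using Ak[of k] N02 by auto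
      from power_mono[OF cS[OF this], of 2] show "(cmod (c (Inl k)))\<^sup>2 \<le> S\<^sup>2 * (1 / (real_of_int k)\<^sup>2)"
        by (simp add: power_divide)
    qed
    also have "\<dots> = S\<^sup>2 * (\<Sum>k\<in>A. 1 / (real_of_int k)\<^sup>2)" by (simp add: sum_distrib_left)
    also have "\<dots> \<le> S\<^sup>2 * (2 / (real N0 - 1))"
      by (intro mult_left_mono sum_inverse_squares_int finA Ak N02) auto
    also have "\<dots> \<le> x\<^sup>2 / 3"
    proof -
      have "6 * S\<^sup>2 \<le> x\<^sup>2 * (real N0 - 1)" using N0 x2 by (simp add: field_simps)
      then show ?thesis using N02 by (simp add: field_simps)
    qed
    finally show ?thesis .
  qed
  obtain n where n: "\<And>p. p \<in> B \<Longrightarrow> fst p < n"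
    using finite_nat_set_iff_bounded[of "fst ` B"] finB by auto
  define L where "L j = {l. (j, l) \<in> B}" for j
  have finL: "finite (L j)" for j
  proof (rule finite_subset)
    show "L j \<subseteq> snd ` B" by (force simp: L_def)
  qed (use finB in simp)
  define R where "R j = (\<Sum>l\<in>L j. (cmod (c (Inr (j, l))))\<^sup>2)" for j
  have R0: "R j \<ge> 0" for j by (simp add: R_def sum_nonneg)
  have "B = (SIGMA j:{..<n}. L j)" using n by (fastforce simp: L_def)
  then have "(\<Sum>p\<in>B. (cmod (c (Inr p)))\<^sup>2) = (\<Sum>j<n. R j)"
    unfolding R_def using finL by (subst sum.Sigma) auto
  also have "\<dots> \<le> (\<Sum>j\<in>{..<N} \<union> {N..<n}. R j)"
    by (intro sum_mono2) (auto simp: R0)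
  also have "\<dots> = (\<Sum>j<N. R j) + (\<Sum>j=N..<n. R j)"
    by (intro sum.union_disjoint) auto
  finally have sumB: "(\<Sum>p\<in>B. (cmod (c (Inr p)))\<^sup>2) \<le> (\<Sum>j<N. R j) + (\<Sum>j=N..<n. R j)" .
  have q: "0 < 1 - 1 / (2::real) ^ N"
    using one_less_power[of "2::real" N] N by simp
  have part2: "(\<Sum>j<N. R j) \<le> x\<^sup>2 / 3"
  proof -
    \<comment> \<open>Level j receives a share proportional to 2^-j. These weights sum to 2 (1 -
      2^-N) over j < N, so the shares add up to x^2/3; this is the origin of the factor 1 - 2^-N in
      \<open>Mj\<close>.\<close>
    have Rj: "R j \<le> (1/2) ^ j * (x\<^sup>2 / (6 * (1 - 1 / 2 ^ N)))" if j: "j < N" for j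
    proof -
      have Mj2: "2 \<le> Mj j"
      proof -
        have "0 \<le> 12 / x\<^sup>2 * Q\<^sup>2 * (1 - 1 / 2 ^ N)" using q by simp
        then show ?thesis using Mj[OF j] by linarith
      qed
      have Lk: "int (Mj j) \<le> \<bar>l\<bar>" if "l \<in> L j" for l
        using that disj j Inr_in_midx[of j l N0 N Mj] by (auto simp: L_def B_def)
      have "R j \<le> (\<Sum>l\<in>L j. (1/2) ^ j * Q\<^sup>2 * (1 / (real_of_int l)\<^sup>2))"
        unfolding R_def using Lk Mj2 by (intro sum_mono cQ2) force
      also have "\<dots> = (1/2) ^ j * Q\<^sup>2 * (\<Sum>l\<in>L j. 1 / (real_of_int l)\<^sup>2)" by (simp add: sum_distrib_left)
      also have "\<dots> \<le> (1/2) ^ j * Q\<^sup>2 * (2 / (real (Mj j) - 1))"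
        by (intro mult_left_mono sum_inverse_squares_int finL Lk Mj2) auto
      also have "\<dots> = (1/2) ^ j * (Q\<^sup>2 * (2 / (real (Mj j) - 1)))" by simp
      also have "\<dots> \<le> (1/2) ^ j * (x\<^sup>2 / (6 * (1 - 1 / 2 ^ N)))"
      proof (rule mult_left_mono)
        have "12 * Q\<^sup>2 * (1 - 1 / 2 ^ N) / x\<^sup>2 \<le> real (Mj j) - 1" using Mj[OF j] by simp
        then have "12 * Q\<^sup>2 * (1 - 1 / 2 ^ N) \<le> x\<^sup>2 * (real (Mj j) - 1)"
          using x2 by (simp only: pos_divide_le_eq mult.commute)
        then have "(Q\<^sup>2 * 2) * (6 * (1 - 1 / 2 ^ N)) \<le> x\<^sup>2 * (real (Mj j) - 1)" by (simp add: algebra_simps)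
        then show "Q\<^sup>2 * (2 / (real (Mj j) - 1)) \<le> x\<^sup>2 / (6 * (1 - 1 / 2 ^ N))"
          unfolding times_divide_eq_right
        proof (rule divide_le_divide_cross)
          show "0 < 6 * (1 - 1 / (2::real) ^ N)" by (rule mult_pos_pos[OF _ q]) simp
        qed (use Mj2 in simp)
      qed simp
      finally show ?thesis .
    qed
    have "(\<Sum>j<N. R j) \<le> (\<Sum>j<N. (1/2) ^ j * (x\<^sup>2 / (6 * (1 - 1 / 2 ^ N))))"
      by (intro sum_mono Rj) auto
    also have "\<dots> = (\<Sum>j<N. (1/2) ^ j) * (x\<^sup>2 / (6 * (1 - 1 / 2 ^ N)))" by (rule sum_distrib_right[symmetric])
    also have "(\<Sum>j<N. (1/2::real) ^ j) = 2 * (1 - 1 / 2 ^ N)"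
      by (subst geometric_sum) (auto simp: power_one_over)
    also have "2 * (1 - 1 / 2 ^ N) * (x\<^sup>2 / (6 * (1 - 1 / 2 ^ N))) = x\<^sup>2 / 3"
      using q by (simp add: divide_simps)
    finally show ?thesis .
  qed
  have part3: "(\<Sum>j=N..<n. R j) \<le> x\<^sup>2 / 3"
  proof -
    \<comment> \<open>Here no shift is kept, so all nonzero l enter through the constant 4, while l
      = 0 is paid for by the separate bound \<open>cD2\<close>.\<close>
    have Rj: "R j \<le> 4 * Q\<^sup>2 * (1/2) ^ j + D\<^sup>2 * (1/8) ^ j" for j
    proof -
      have "R j \<le> (\<Sum>l\<in>insert 0 (L j - {0}). (cmod (c (Inr (j, l))))\<^sup>2)"
        unfolding R_def using finL by (intro sum_mono2) auto
      also have "\<dots> = (cmod (c (Inr (j, 0))))\<^sup>2 + (\<Sum>l\<in>L j - {0}. (cmod (c (Inr (j, l))))\<^sup>2)"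
        using finL by (subst sum.insert) auto
      also have "(\<Sum>l\<in>L j - {0}. (cmod (c (Inr (j, l))))\<^sup>2) \<le> (\<Sum>l\<in>L j - {0}. (1/2) ^ j * Q\<^sup>2 * (1 / (real_of_int l)\<^sup>2))"
        by (intro sum_mono cQ2) auto
      also have "\<dots> = (1/2) ^ j * Q\<^sup>2 * (\<Sum>l\<in>L j - {0}. 1 / (real_of_int l)\<^sup>2)" by (simp add: sum_distrib_left)
      also have "\<dots> \<le> (1/2) ^ j * Q\<^sup>2 * 4"
        using finL by (intro mult_left_mono sum_inverse_squares_int_nonzero) auto
      finally show ?thesis using cD2[of j] by (simp add: mult_ac)
    qed
    have "(\<Sum>j=N..<n. R j) \<le> (\<Sum>j=N..<n. 4 * Q\<^sup>2 * (1/2) ^ j + D\<^sup>2 * (1/8) ^ j)"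
      by (intro sum_mono Rj)
    also have "\<dots> = 4 * Q\<^sup>2 * (\<Sum>j=N..<n. (1/2) ^ j) + D\<^sup>2 * (\<Sum>j=N..<n. (1/8) ^ j)"
      by (simp add: sum.distrib sum_distrib_left)
    also have "\<dots> \<le> 4 * Q\<^sup>2 * ((1/2) ^ N / (1 - 1/2)) + D\<^sup>2 * ((1/8) ^ N / (1 - 1/8))"
      by (intro add_mono mult_left_mono sum_geometric_tail) auto
    also have "4 * Q\<^sup>2 * ((1/2) ^ N / (1 - 1/2)) \<le> 5 * x\<^sup>2 / 18"
    \<comment> \<open>For Q = 0 the logarithm in \<open>NQ\<close> carries no information, but then
      the term to be bounded is 0.\<close>
    proof (cases "Q = 0")
      case False
      then have "72 * Q\<^sup>2 / (5 * x\<^sup>2) < 2 powr (real N - 1)"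
        using NQ x2 by (subst log_less_iff[symmetric]) auto
      also have "\<dots> = 2 ^ N / 2" by (simp add: powr_diff powr_realpow)
      finally show ?thesis using x2 by (simp add: power_one_over field_simps)
    qed (use x2 in simp)
    also have "D\<^sup>2 * ((1/8) ^ N / (1 - 1/8)) \<le> x\<^sup>2 / 18"
    proof (cases "D = 0")
      case False
      then have "18 * D\<^sup>2 / (7 * x\<^sup>2) < 8 powr (real N - 1)"
        using ND x2 by (subst log_less_iff[symmetric]) auto
      also have "\<dots> = 8 ^ N / 8" by (simp add: powr_diff powr_realpow)
      finally show ?thesis using x2 by (simp add: power_one_over field_simps)
    qed (use x2 in simp)
    finally show ?thesis by simp
  qed
  show ?thesis using part1 part2 part3 sumB unfolding sumJ by linarith
qed

section \<open>Sub-Gaussian estimates\<close>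

text \<open>The infimum defining \<open>sg_tau\<close> is not given as attained, so the estimate is
  taken at points within 1/(n + 1) of it and passed to the limit.\<close>

lemma strictly_sub_gaussian_exp_bound:
  assumes "strictly_sub_gaussian M \<xi>"
  shows "integrable M (\<lambda>\<omega>. exp (l * \<xi> \<omega>))"
    and "(\<integral>\<omega>. exp (l * \<xi> \<omega>) \<partial>M) \<le> exp (l\<^sup>2 * (\<integral>\<omega>. (\<xi> \<omega>)\<^sup>2 \<partial>M) / 2)"
proof -
  have ne: "sg_bounds M \<xi> \<noteq> {}" and tau: "Inf (sg_bounds M \<xi>) = sqrt (\<integral>\<omega>. (\<xi> \<omega>)\<^sup>2 \<partial>M)"
    using assms by (auto simp: strictly_sub_gaussian_def sub_gaussian_def sg_tau_def)
  from ne show "integrable M (\<lambda>\<omega>. exp (l * \<xi> \<omega>))" by (auto simp: sg_bounds_def)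
  define \<tau> where "\<tau> = Inf (sg_bounds M \<xi>)"
  have \<tau>0: "\<tau> \<ge> 0" unfolding \<tau>_def using ne by (intro cInf_greatest) (auto simp: sg_bounds_def)
  have bd: "(\<integral>\<omega>. exp (l * \<xi> \<omega>) \<partial>M) \<le> exp (l\<^sup>2 * (\<tau> + inverse (real (Suc n)))\<^sup>2 / 2)" for n
  proof -
    have "Inf (sg_bounds M \<xi>) < \<tau> + inverse (real (Suc n))" by (simp add: \<tau>_def)
    then obtain a where a: "a \<in> sg_bounds M \<xi>" "a < \<tau> + inverse (real (Suc n))"
      using cInf_lessD[OF ne] by blast
    have "(\<integral>\<omega>. exp (l * \<xi> \<omega>) \<partial>M) \<le> exp (l\<^sup>2 * a\<^sup>2 / 2)" using a(1) by (simp add: sg_bounds_def)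
    also have "\<dots> \<le> exp (l\<^sup>2 * (\<tau> + inverse (real (Suc n)))\<^sup>2 / 2)"
      using a by (auto simp: sg_bounds_def intro!: mult_left_mono power_mono)
    finally show ?thesis .
  qed
  have "(\<lambda>n. exp (l\<^sup>2 * (\<tau> + inverse (real (Suc n)))\<^sup>2 / 2)) \<longlonglongrightarrow> exp (l\<^sup>2 * (\<tau> + 0)\<^sup>2 / 2)"
    by (intro tendsto_intros LIMSEQ_inverse_real_of_nat) auto
  then have "(\<integral>\<omega>. exp (l * \<xi> \<omega>) \<partial>M) \<le> exp (l\<^sup>2 * (\<tau> + 0)\<^sup>2 / 2)"
    by (rule LIMSEQ_le_const) (use bd in auto)
  also have "(\<tau> + 0)\<^sup>2 = (\<integral>\<omega>. (\<xi> \<omega>)\<^sup>2 \<partial>M)"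
    using tau by (simp add: \<tau>_def)
  finally show "(\<integral>\<omega>. exp (l * \<xi> \<omega>) \<partial>M) \<le> exp (l\<^sup>2 * (\<integral>\<omega>. (\<xi> \<omega>)\<^sup>2 \<partial>M) / 2)" .
qed

text \<open>Independence factorises the exponential moment and the exponents add. The nonnegative
  integral is the form in which Fatou's lemma is applied later.\<close>

lemma (in prob_space) indep_sum_exp_bound:
  fixes \<zeta> :: "'i \<Rightarrow> 'a \<Rightarrow> real"
  assumes indep: "indep_vars (\<lambda>_. borel) \<zeta> UNIV"
    and int: "\<And>i l. integrable M (\<lambda>\<omega>. exp (l * \<zeta> i \<omega>))"
    and bd: "\<And>i l. expectation (\<lambda>\<omega>. exp (l * \<zeta> i \<omega>)) \<le> exp (l\<^sup>2 / 2)"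
    and fin: "finite K"
  shows "(\<integral>\<^sup>+\<omega>. ennreal (exp (l * (\<Sum>i\<in>K. c i * \<zeta> i \<omega>))) \<partial>M) \<le> ennreal (exp (l\<^sup>2 * (\<Sum>i\<in>K. (c i)\<^sup>2) / 2))"
proof -
  have eq: "exp (l * (\<Sum>i\<in>K. c i * \<zeta> i \<omega>)) = (\<Prod>i\<in>K. exp (l * c i * \<zeta> i \<omega>))" for \<omega>
    using fin by (simp add: sum_distrib_left exp_sum mult.assoc)
  have ind: "indep_vars (\<lambda>_. borel) (\<lambda>i \<omega>. exp (l * c i * \<zeta> i \<omega>)) K"
    by (rule indep_vars_compose2[where X=\<zeta> and M'="\<lambda>_. borel" and Y="\<lambda>i x. exp (l * c i * x)"])
      (auto intro: indep_vars_subset[OF indep])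
  have i: "integrable M (\<lambda>\<omega>. \<Prod>i\<in>K. exp (l * c i * \<zeta> i \<omega>))"
    by (rule indep_vars_integrable[OF fin ind]) (rule int)
  have "(\<integral>\<omega>. (\<Prod>i\<in>K. exp (l * c i * \<zeta> i \<omega>)) \<partial>M) = (\<Prod>i\<in>K. \<integral>\<omega>. exp (l * c i * \<zeta> i \<omega>) \<partial>M)"
    by (rule indep_vars_lebesgue_integral[OF fin ind]) (rule int)
  also have "\<dots> \<le> (\<Prod>i\<in>K. exp ((l * c i)\<^sup>2 / 2))"
    by (intro prod_mono conjI bd) auto
  also have "\<dots> = exp (l\<^sup>2 * (\<Sum>i\<in>K. (c i)\<^sup>2) / 2)"
    using fin by (simp add: exp_sum[symmetric] power_mult_distrib sum_distrib_left sum_divide_distrib)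
  finally show ?thesis
    unfolding eq using i by (subst nn_integral_eq_integral) (auto simp: prod_nonneg)
qed

lemma L2_convergence_AE_subseq:
  fixes Z :: "nat \<Rightarrow> 'a \<Rightarrow> real"
  assumes int: "\<And>n. integrable M (\<lambda>\<omega>. (Z0 \<omega> - Z n \<omega>)\<^sup>2)"
    and lim: "(\<lambda>n. \<integral>\<omega>. (Z0 \<omega> - Z n \<omega>)\<^sup>2 \<partial>M) \<longlonglongrightarrow> 0"
  obtains r where "strict_mono r" "AE \<omega> in M. (\<lambda>n. Z (r n) \<omega>) \<longlonglongrightarrow> Z0 \<omega>"
proof -
  have "\<exists>r. strict_mono r \<and> (AE \<omega> in M. (\<lambda>n. (Z0 \<omega> - Z (r n) \<omega>)\<^sup>2) \<longlonglongrightarrow> 0)"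
    using tendsto_L1_AE_subseq[of M "\<lambda>n \<omega>. (Z0 \<omega> - Z n \<omega>)\<^sup>2"] int lim by simp
  then obtain r where r: "strict_mono r" "AE \<omega> in M. (\<lambda>n. (Z0 \<omega> - Z (r n) \<omega>)\<^sup>2) \<longlonglongrightarrow> 0" by blast
  have "AE \<omega> in M. (\<lambda>n. Z (r n) \<omega>) \<longlonglongrightarrow> Z0 \<omega>"
    using r(2)
  proof eventually_elim
    case (elim \<omega>)
    then have "(\<lambda>n. \<bar>Z (r n) \<omega> - Z0 \<omega>\<bar>) \<longlonglongrightarrow> 0"
      using tendsto_real_sqrt[of "\<lambda>n. (Z0 \<omega> - Z (r n) \<omega>)\<^sup>2" 0] by (simp add: abs_minus_commute)
    then show ?case by (rule LIM_zero_cancel[OF tendsto_rabs_zero_cancel])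
  qed
  then show ?thesis using r(1) that by blast
qed

text \<open>The function x^q exp(-x) is largest at x = q.\<close>

lemma powr_le_exp:
  fixes x q :: real assumes "0 \<le> x" "0 < q"
  shows "x powr q \<le> (q / exp 1) powr q * exp x"
proof (cases "x = 0")
  case False
  then have x: "x > 0" using assms by simp
  have "ln (x / q) \<le> x / q - 1" using x assms by (intro ln_le_minus_one) auto
  then have "q * ln (x / q) \<le> q * (x / q - 1)" using assms by (intro mult_left_mono) auto
  then have "q * ln x \<le> q * (ln q - 1) + x" using x assms by (simp add: ln_div algebra_simps)
  then have "exp (q * ln x) \<le> exp (q * (ln q - 1) + x)" by simp
  then show ?thesis using x assms by (simp add: powr_def exp_add ln_div)
qed (use assms in simp)

lemma sub_gaussian_moment_bound:
  fixes W :: "'a \<Rightarrow> real"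
  assumes W[measurable]: "W \<in> borel_measurable M" and s: "s > 0" and q: "q > 0"
    and sg: "\<And>l. (\<integral>\<^sup>+\<omega>. ennreal (exp (l * W \<omega>)) \<partial>M) \<le> ennreal (exp (l\<^sup>2 * s\<^sup>2 / 2))"
  shows "(\<integral>\<^sup>+\<omega>. ennreal (\<bar>W \<omega>\<bar> powr q) \<partial>M) \<le> ennreal (2 * (q / exp 1) powr (q / 2) * s powr q)"
proof -
  \<comment> \<open>The minimiser of l^(-q) exp(l^2 s^2 / 2); it produces the constant
    (q/e)^(q/2).\<close>
  define l where "l = sqrt q / s"
  have l: "l > 0" using s q by (simp add: l_def)
  define c where "c = (q / exp 1) powr q / l powr q"
  have c: "c \<ge> 0" by (simp add: c_def)
  have bd: "\<bar>W \<omega>\<bar> powr q \<le> c * exp (l * W \<omega>) + c * exp ((- l) * W \<omega>)" for \<omega>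
  proof -
    have "l powr q * \<bar>W \<omega>\<bar> powr q = (l * \<bar>W \<omega>\<bar>) powr q"
      using l by (simp add: powr_mult)
    also have "\<dots> \<le> (q / exp 1) powr q * exp (l * \<bar>W \<omega>\<bar>)" using l q by (intro powr_le_exp) auto
    also have "\<dots> \<le> (q / exp 1) powr q * (exp (l * W \<omega>) + exp ((- l) * W \<omega>))"
      by (intro mult_left_mono) (auto simp: abs_if)
    finally show ?thesis using l by (simp add: c_def field_simps)
  qed
  have "(\<integral>\<^sup>+\<omega>. ennreal (\<bar>W \<omega>\<bar> powr q) \<partial>M)
      \<le> (\<integral>\<^sup>+\<omega>. ennreal c * ennreal (exp (l * W \<omega>)) + ennreal c * ennreal (exp ((- l) * W \<omega>)) \<partial>M)"
    using c bd by (intro nn_integral_mono) (auto simp: ennreal_mult[symmetric] ennreal_plus[symmetric] simp del: ennreal_plus)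
  also have "\<dots> = ennreal c * (\<integral>\<^sup>+\<omega>. ennreal (exp (l * W \<omega>)) \<partial>M) + ennreal c * (\<integral>\<^sup>+\<omega>. ennreal (exp ((- l) * W \<omega>)) \<partial>M)"
    by (subst nn_integral_add) (auto simp: nn_integral_cmult)
  also have "\<dots> \<le> ennreal c * ennreal (exp (l\<^sup>2 * s\<^sup>2 / 2)) + ennreal c * ennreal (exp ((- l)\<^sup>2 * s\<^sup>2 / 2))"
    by (intro add_mono mult_left_mono sg) auto
  also have "\<dots> = ennreal (2 * c * exp (l\<^sup>2 * s\<^sup>2 / 2))"
    using c by (simp add: ennreal_mult[symmetric] ennreal_plus[symmetric] del: ennreal_plus)
  also have "2 * c * exp (l\<^sup>2 * s\<^sup>2 / 2) = 2 * (q / exp 1) powr (q / 2) * s powr q"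
  proof -
    have "l\<^sup>2 * s\<^sup>2 / 2 = q / 2" using s q by (simp add: l_def power_divide)
    moreover have "l powr q = q powr (q / 2) / s powr q"
      using s q by (simp add: l_def powr_divide powr_half_sqrt[symmetric] powr_powr)
    moreover have "(q / exp 1) powr q = (q / exp 1) powr (q / 2) * (q / exp 1) powr (q / 2)"
      by (simp add: powr_add[symmetric])
    moreover have "(q / exp 1) powr (q / 2) = q powr (q / 2) / exp (q / 2)"
      using q by (simp add: powr_divide) (simp add: powr_def)
    ultimately show ?thesis using s q by (simp add: c_def)
  qed
  finally show ?thesis .
qed

lemma abs_one_minus_exp_le: "\<bar>1 - exp w\<bar> \<le> \<bar>w\<bar> * max 1 (exp w)" for w :: real
proof (cases "w \<ge> 0")
  case True
  have "1 - w \<le> exp (- w)" using exp_ge_add_one_self[of "- w"] by simp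
  then have "exp w * (1 - w) \<le> exp w * exp (- w)" by (intro mult_left_mono) auto
  then have "exp w - 1 \<le> w * exp w" by (simp add: exp_minus_inverse algebra_simps)
  then show ?thesis using True by (simp add: max_def)
next
  case False
  then have "exp w < 1" by simp
  then have eq: "\<bar>1 - exp w\<bar> = 1 - exp w" "max 1 (exp w) = 1" "\<bar>w\<bar> = - w" using False by auto
  show ?thesis unfolding eq mult_1_right using exp_ge_add_one_self[of w] by linarith
qed

text \<open>With W = Y - X the difference is exp X * (1 - exp W). X and W may be dependent, so
  Cauchy-Schwarz separates them first; a second use separates \<bar>W\<bar>^(2p) from max(1, exp
  W)^(2p). Hence A^4 \<le> E2^2 H1 H2, and \<open>hfun\<close> is the dependence of the fourth root
  of H1 H2 on x.\<close>

lemma exp_difference_moment_bound: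
  fixes X Y :: "'a \<Rightarrow> real"
  assumes X[measurable]: "X \<in> borel_measurable M" and Y[measurable]: "Y \<in> borel_measurable M"
    and M: "emeasure M (space M) = 1"
    and p: "p \<ge> 1" and x: "x > 0" and E2: "E2 \<ge> 0"
    and sg: "\<And>l. (\<integral>\<^sup>+\<omega>. ennreal (exp (l * (X \<omega> - Y \<omega>))) \<partial>M) \<le> ennreal (exp (l\<^sup>2 * x\<^sup>2 / 2))"
    and EX: "(\<integral>\<^sup>+\<omega>. ennreal (exp (2 * p * X \<omega>)) \<partial>M) \<le> ennreal E2"
  shows "(\<integral>\<^sup>+\<omega>. ennreal (\<bar>exp (X \<omega>) - exp (Y \<omega>)\<bar> powr p) \<partial>M)
      \<le> ennreal (2 powr (2 * p) * (p / exp 1) powr (p / 2) * hfun p x * sqrt E2)"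
proof -
  define W where "W \<omega> = Y \<omega> - X \<omega>" for \<omega>
  have [measurable]: "W \<in> borel_measurable M" unfolding W_def[abs_def] by measurable
  have sgW: "(\<integral>\<^sup>+\<omega>. ennreal (exp (l * W \<omega>)) \<partial>M) \<le> ennreal (exp (l\<^sup>2 * x\<^sup>2 / 2))" for l
    using sg[of "- l"] by (simp add: W_def algebra_simps)
  define A where "A = (\<integral>\<^sup>+\<omega>. ennreal (\<bar>exp (X \<omega>) - exp (Y \<omega>)\<bar> powr p) \<partial>M)"
  define G where "G = (\<integral>\<^sup>+\<omega>. ennreal (\<bar>1 - exp (W \<omega>)\<bar> powr p) ^ 2 \<partial>M)"
  define H1 where "H1 = 2 * (4 * p / exp 1) powr (2 * p) * x powr (4 * p)"
  define H2 where "H2 = 1 + exp (8 * p\<^sup>2 * x\<^sup>2)"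
  have H: "H1 \<ge> 0" "H2 \<ge> 0" by (simp_all add: H1_def H2_def add_nonneg_nonneg)
  have sq_powr: "(y powr r) ^ 2 = y powr (2 * r)" for y r :: real
    by (simp add: power2_eq_square powr_add[symmetric])
  have A_eq: "A = (\<integral>\<^sup>+\<omega>. ennreal (exp (p * X \<omega>)) * ennreal (\<bar>1 - exp (W \<omega>)\<bar> powr p) \<partial>M)"
    unfolding A_def
  proof (rule nn_integral_cong)
    fix \<omega>
    have "exp (X \<omega>) - exp (Y \<omega>) = exp (X \<omega>) * (1 - exp (W \<omega>))"
      by (simp add: W_def right_diff_distrib exp_add[symmetric])
    then have "\<bar>exp (X \<omega>) - exp (Y \<omega>)\<bar> powr p = exp (p * X \<omega>) * \<bar>1 - exp (W \<omega>)\<bar> powr p"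
      by (simp add: abs_mult powr_mult) (simp add: powr_def)
    then show "ennreal (\<bar>exp (X \<omega>) - exp (Y \<omega>)\<bar> powr p) = ennreal (exp (p * X \<omega>)) * ennreal (\<bar>1 - exp (W \<omega>)\<bar> powr p)"
      by (simp add: ennreal_mult)
  qed
  have "A ^ 2 \<le> (\<integral>\<^sup>+\<omega>. ennreal (exp (p * X \<omega>)) ^ 2 \<partial>M) * G"
    unfolding A_eq G_def by (rule Cauchy_Schwarz_nn_integral) measurable
  also have "(\<integral>\<^sup>+\<omega>. ennreal (exp (p * X \<omega>)) ^ 2 \<partial>M) = (\<integral>\<^sup>+\<omega>. ennreal (exp (2 * p * X \<omega>)) \<partial>M)"
    by (intro nn_integral_cong) (simp add: ennreal_power exp_double[symmetric] mult.assoc)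
  also have "\<dots> * G \<le> ennreal E2 * G" by (intro mult_right_mono EX) auto
  finally have A2: "A ^ 2 \<le> ennreal E2 * G" .
  have G_le: "G \<le> (\<integral>\<^sup>+\<omega>. ennreal (\<bar>W \<omega>\<bar> powr (2 * p)) * ennreal (max 1 (exp (W \<omega>)) powr (2 * p)) \<partial>M)"
    unfolding G_def
  proof (rule nn_integral_mono)
    fix \<omega>
    have "\<bar>1 - exp (W \<omega>)\<bar> powr (2 * p) \<le> (\<bar>W \<omega>\<bar> * max 1 (exp (W \<omega>))) powr (2 * p)"
      using p by (intro powr_mono2 abs_one_minus_exp_le) auto
    also have "\<dots> = \<bar>W \<omega>\<bar> powr (2 * p) * max 1 (exp (W \<omega>)) powr (2 * p)"
      by (subst powr_mult) auto
    finally show "ennreal (\<bar>1 - exp (W \<omega>)\<bar> powr p) ^ 2 \<le> ennreal (\<bar>W \<omega>\<bar> powr (2 * p)) * ennreal (max 1 (exp (W \<omega>)) powr (2 * p))"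
      by (simp add: ennreal_power sq_powr ennreal_mult[symmetric])
  qed
  have "G ^ 2 \<le> (\<integral>\<^sup>+\<omega>. ennreal (\<bar>W \<omega>\<bar> powr (2 * p)) * ennreal (max 1 (exp (W \<omega>)) powr (2 * p)) \<partial>M) ^ 2"
    by (rule power_mono[OF G_le]) simp
  also have "\<dots> \<le> (\<integral>\<^sup>+\<omega>. ennreal (\<bar>W \<omega>\<bar> powr (2 * p)) ^ 2 \<partial>M) * (\<integral>\<^sup>+\<omega>. ennreal (max 1 (exp (W \<omega>)) powr (2 * p)) ^ 2 \<partial>M)"
    by (rule Cauchy_Schwarz_nn_integral) measurable
  also have "\<dots> \<le> ennreal H1 * ennreal H2"
  proof (rule mult_mono)
    have "(\<integral>\<^sup>+\<omega>. ennreal (\<bar>W \<omega>\<bar> powr (2 * p)) ^ 2 \<partial>M) = (\<integral>\<^sup>+\<omega>. ennreal (\<bar>W \<omega>\<bar> powr (4 * p)) \<partial>M)"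
      by (intro nn_integral_cong) (simp add: ennreal_power sq_powr)
    also have "\<dots> \<le> ennreal (2 * (4 * p / exp 1) powr (4 * p / 2) * x powr (4 * p))"
      by (rule sub_gaussian_moment_bound) (use x p sgW in auto)
    finally show "(\<integral>\<^sup>+\<omega>. ennreal (\<bar>W \<omega>\<bar> powr (2 * p)) ^ 2 \<partial>M) \<le> ennreal H1"
      by (simp add: H1_def)
    have "(\<integral>\<^sup>+\<omega>. ennreal (max 1 (exp (W \<omega>)) powr (2 * p)) ^ 2 \<partial>M) \<le> (\<integral>\<^sup>+\<omega>. 1 + ennreal (exp (4 * p * W \<omega>)) \<partial>M)"
    proof (rule nn_integral_mono)
      fix \<omega>
      have "max 1 (exp (W \<omega>)) powr (4 * p) \<le> 1 + exp (4 * p * W \<omega>)"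
        by (cases "W \<omega> \<ge> 0") (auto simp: max_def powr_def mult.commute)
      then have "ennreal (max 1 (exp (W \<omega>)) powr (4 * p)) \<le> ennreal (1 + exp (4 * p * W \<omega>))"
        by (rule ennreal_leI)
      then show "ennreal (max 1 (exp (W \<omega>)) powr (2 * p)) ^ 2 \<le> 1 + ennreal (exp (4 * p * W \<omega>))"
        by (simp add: ennreal_power sq_powr)
    qed
    also have "\<dots> = 1 + (\<integral>\<^sup>+\<omega>. ennreal (exp (4 * p * W \<omega>)) \<partial>M)"
      by (subst nn_integral_add) (auto simp: M)
    also have "\<dots> \<le> 1 + ennreal (exp ((4 * p)\<^sup>2 * x\<^sup>2 / 2))"
      by (intro add_left_mono sgW)
    also have "\<dots> = ennreal H2"
      by (simp add: H2_def power_mult_distrib)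
    finally show "(\<integral>\<^sup>+\<omega>. ennreal (max 1 (exp (W \<omega>)) powr (2 * p)) ^ 2 \<partial>M) \<le> ennreal H2" .
  qed auto
  finally have G2: "G ^ 2 \<le> ennreal (H1 * H2)" using H by (simp add: ennreal_mult)
  \<comment> \<open>Finiteness is extracted from the squared bounds so that the roots can be taken
    in the reals.\<close>
  have "G < \<top>"
  proof (rule ccontr)
    assume "\<not> G < \<top>"
    then have "G = \<top>" by (metis top.not_eq_extremum)
    then show False using G2 by (simp add: ennreal_top_eq_mult_iff power2_eq_square ennreal_top_mult top_unique)
  qed
  then obtain g where g: "G = ennreal g" "g \<ge> 0" by (cases G) auto
  have "A < \<top>"
  proof (rule ccontr)
    assume "\<not> A < \<top>"
    then have "A = \<top>" by (metis top.not_eq_extremum)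
    then show False using A2 g E2 by (simp add: ennreal_mult[symmetric] power2_eq_square ennreal_top_mult top_unique)
  qed
  then obtain a where a: "A = ennreal a" "a \<ge> 0" by (cases A) auto
  have g2: "g\<^sup>2 \<le> H1 * H2" using G2 g H by (simp add: ennreal_power)
  have a2: "a\<^sup>2 \<le> E2 * g" using A2 a g E2 by (simp add: ennreal_power ennreal_mult[symmetric])
  define R where "R = sqrt E2 * (H1 * H2) powr (1 / 4)"
  have R0: "R \<ge> 0" using E2 by (simp add: R_def)
  have "a ^ 4 = (a\<^sup>2)\<^sup>2" by simp
  also have "\<dots> \<le> (E2 * g)\<^sup>2" using a2 by (intro power_mono) auto
  also have "\<dots> = E2\<^sup>2 * g\<^sup>2" by (simp add: power_mult_distrib)
  also have "\<dots> \<le> E2\<^sup>2 * (H1 * H2)" using g2 by (intro mult_left_mono) auto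
  also have "\<dots> = R ^ 4"
  proof -
    have "(sqrt E2) ^ 4 = ((sqrt E2)\<^sup>2)\<^sup>2" by simp
    also have "\<dots> = E2\<^sup>2" using E2 by simp
    finally have 1: "(sqrt E2) ^ 4 = E2\<^sup>2" .
    have "((H1 * H2) powr (1 / 4)) ^ 4 = H1 * H2"
    proof (cases "H1 * H2 = 0")
      case False
      then have z: "H1 * H2 > 0" using H by (simp add: less_le)
      then have "((H1 * H2) powr (1 / 4)) ^ 4 = ((H1 * H2) powr (1 / 4)) powr real 4"
        by (subst powr_realpow) auto
      then show ?thesis using z by (simp add: powr_powr)
    qed auto
    then show ?thesis by (simp add: R_def power_mult_distrib 1)
  qed
  finally have "a ^ Suc 3 \<le> R ^ Suc 3" by (simp add: eval_nat_numeral)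
  then have "a \<le> R" using R0 by (rule power_le_imp_le_base)
  also have "R \<le> 2 powr (2 * p) * (p / exp 1) powr (p / 2) * hfun p x * sqrt E2"
  proof -
    have "(H1 * H2) powr (1 / 4) = 2 powr (1/4) * (4 * p / exp 1) powr (p / 2) * x powr p * H2 powr (1 / 4)"
      using x p H by (simp add: H1_def powr_mult powr_powr powr_divide)
    also have "(4 * p / exp 1) powr (p / 2) = 4 powr (p / 2) * (p / exp 1) powr (p / 2)"
      using p powr_mult[of 4 "p / exp 1" "p / 2"] by simp
    also have "(4::real) powr (p / 2) = 2 powr p"
      using powr_powr[of 2 2 "p / 2"] by simp
    finally have "(H1 * H2) powr (1 / 4) = (2 powr (1/4) * 2 powr p) * (p / exp 1) powr (p / 2) * hfun p x"
      by (simp add: hfun_def H2_def)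
    \<comment> \<open>The computation yields 2^(p + 1/4); since p \<ge> 1 this may be rounded up to
      the 2^(2p) that appears in m.\<close>
    also have "\<dots> \<le> 2 powr (2 * p) * (p / exp 1) powr (p / 2) * hfun p x"
      unfolding powr_add[symmetric] using p
      by (intro mult_right_mono powr_mono) (auto simp: hfun_def)
    finally have "(H1 * H2) powr (1 / 4) \<le> 2 powr (2 * p) * (p / exp 1) powr (p / 2) * hfun p x" .
    from mult_left_mono[OF this, of "sqrt E2"] show ?thesis using E2 by (simp add: R_def mult_ac)
  qed
  finally have "A \<le> ennreal (2 powr (2 * p) * (p / exp 1) powr (p / 2) * hfun p x * sqrt E2)"
    unfolding a(1) by (rule ennreal_leI)
  then show ?thesis by (simp add: A_def)
qed

section \<open>A jointly measurable version of the process\<close>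

lemma ennreal_le_sqrt:
  assumes "A ^ 2 \<le> ennreal s" "s \<ge> 0" shows "A \<le> ennreal (sqrt s)"
proof (cases A)
  case (real a)
  then have "a\<^sup>2 \<le> s" using assms by (simp add: ennreal_power)
  then show ?thesis using real by (simp add: real_le_rsqrt ennreal_leI)
next
  case top
  then show ?thesis using assms by (simp add: power2_eq_square ennreal_top_mult top_unique)
qed

lemma summable_enn2real:
  fixes G :: "nat \<Rightarrow> ennreal"
  assumes "(\<Sum>r. G r) \<noteq> \<top>"
  shows "summable (\<lambda>r. enn2real (G r))" and "G r < \<top>"
proof -
  have G: "G r < \<top>" for r
  proof -
    have "G r \<le> (\<Sum>r. G r)" using sum_le_suminf[of G "{r}"] by simp
    then show ?thesis using assms by (metis top.not_eq_extremum top.extremum_uniqueI)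
  qed
  then show "G r < \<top>" .
  have "(\<Sum>r. ennreal (enn2real (G r))) \<noteq> \<top>" using assms G by simp
  then show "summable (\<lambda>r. enn2real (G r))" by (intro summable_suminf_not_top) auto
qed

section \<open>The random expansion and its partial sums\<close>

locale wavelet_expansion =
  wavelet_kernel \<phi> \<psi> \<Phi> \<Psi> d\<Phi> d\<Psi> u du u1 u2 C + prob_space M
  for \<phi> \<psi> \<Phi> \<Psi> d\<Phi> d\<Psi> :: "real \<Rightarrow> complex"
    and u du :: "real \<Rightarrow> real \<Rightarrow> complex" and u1 u2 :: "real \<Rightarrow> real" and C :: real
    and M :: "'a measure" +
  fixes X :: "real \<Rightarrow> 'a \<Rightarrow> real" and \<zeta> :: "int + nat \<times> int \<Rightarrow> 'a \<Rightarrow> real"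
  assumes X_rv [measurable]: "\<And>t. X t \<in> borel_measurable M"
    and X_L2: "\<And>t. integrable M (\<lambda>\<omega>. (X t \<omega>)\<^sup>2)"
    and zeta_rv [measurable]: "\<And>i. \<zeta> i \<in> borel_measurable M"
    and zeta_L2: "\<And>i. integrable M (\<lambda>\<omega>. (\<zeta> i \<omega>)\<^sup>2)"
    and zeta_orth: "\<And>i j. (\<integral>\<omega>. \<zeta> i \<omega> * \<zeta> j \<omega> \<partial>M) = (if i = j then 1 else 0)"
    and expansion: "\<And>t. (\<lambda>n. \<integral>\<omega>. (cmod (complex_of_real (X t \<omega>)
        - (\<Sum>i\<in>midx n n (\<lambda>_. n). complex_of_real (\<zeta> i \<omega>) * wcoef u \<Phi> \<Psi> i t)))\<^sup>2 \<partial>M) \<longlonglongrightarrow> 0"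
    and msc: "ms_continuous M X"
    and sep: "separable_process M X"
begin

abbreviation "I n \<equiv> midx n n (\<lambda>_. n)"

definition rcoef :: "int + nat \<times> int \<Rightarrow> real \<Rightarrow> real" where
  "rcoef i t = (\<integral>\<omega>. X t \<omega> * \<zeta> i \<omega> \<partial>M)"

definition psum :: "nat \<Rightarrow> real \<Rightarrow> 'a \<Rightarrow> real" where
  "psum n t \<omega> = (\<Sum>i\<in>I n. \<zeta> i \<omega> * rcoef i t)"

lemma sq_int_X: "sq_int M (\<lambda>\<omega>. complex_of_real (X t \<omega>))"
  using X_L2 by (simp add: sq_int_def)

lemma sq_int_zeta: "sq_int M (\<lambda>\<omega>. complex_of_real (\<zeta> i \<omega>))"
  using zeta_L2 by (simp add: sq_int_def)

lemma ip_zeta: "ip M (\<lambda>\<omega>. complex_of_real (\<zeta> i \<omega>)) (\<lambda>\<omega>. complex_of_real (\<zeta> j \<omega>)) = (if i = j then 1 else 0)"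
  unfolding ip_def using zeta_orth[of i j]
  by (simp flip: of_real_mult)

lemma sq_int_comb: "sq_int M (\<lambda>\<omega>. \<Sum>i\<in>J. complex_of_real (\<zeta> i \<omega>) * a i)"
  using sq_int_sum[of J M "\<lambda>i \<omega>. a i * complex_of_real (\<zeta> i \<omega>)"] sq_int_scale[OF sq_int_zeta]
  by (simp add: mult.commute)

lemma nsq_zeta: "nsq M (\<lambda>\<omega>. complex_of_real (\<zeta> i \<omega>)) = 1"
  using ip_self[of M "\<lambda>\<omega>. complex_of_real (\<zeta> i \<omega>)"] ip_zeta[of i i] by simp

lemma nsq_comb:
  "finite J \<Longrightarrow> nsq M (\<lambda>\<omega>. \<Sum>i\<in>J. complex_of_real (\<zeta> i \<omega>) * a i) = (\<Sum>i\<in>J. (cmod (a i))\<^sup>2)"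
  using nsq_sum[of J M "\<lambda>i \<omega>. complex_of_real (\<zeta> i \<omega>)" a] sq_int_zeta ip_zeta
  by (simp add: mult.commute)

text \<open>The coefficients are real because both the process and the basis variables are:
  the expansion forces them to be the correlations of the two.\<close>

lemma wcoef_eq_rcoef: "wcoef u \<Phi> \<Psi> i t = complex_of_real (rcoef i t)"
proof -
  let ?V = "\<lambda>n \<omega>. \<Sum>i\<in>I n. complex_of_real (\<zeta> i \<omega>) * wcoef u \<Phi> \<Psi> i t"
  let ?e = "\<lambda>n. nsq M (\<lambda>\<omega>. complex_of_real (X t \<omega>) - ?V n \<omega>)"
  obtain n0 where n0: "{i} \<subseteq> I n0" using midx_covers[of "{i}"] by auto
  have le: "(cmod (complex_of_real (rcoef i t) - wcoef u \<Phi> \<Psi> i t))\<^sup>2 \<le> ?e n" if "n \<ge> n0" for n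
  proof -
    have iI: "i \<in> I n" using n0 incseq_midx[OF that] by auto
    have XZ: "ip M (\<lambda>\<omega>. complex_of_real (X t \<omega>)) (\<lambda>\<omega>. complex_of_real (\<zeta> i \<omega>)) = complex_of_real (rcoef i t)"
      by (simp add: ip_def rcoef_def flip: of_real_mult)
    have "?V n = (\<lambda>\<omega>. \<Sum>k\<in>I n. wcoef u \<Phi> \<Psi> k t * complex_of_real (\<zeta> k \<omega>))"
      by (simp add: mult.commute)
    then have "ip M (?V n) (\<lambda>\<omega>. complex_of_real (\<zeta> i \<omega>))
        = (\<Sum>k\<in>I n. wcoef u \<Phi> \<Psi> k t * (if k = i then 1 else 0))"
      by (simp only: ip_sum_left[OF sq_int_scale[OF sq_int_zeta] sq_int_zeta] ip_scale_left ip_zeta)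
    also have "\<dots> = wcoef u \<Phi> \<Psi> i t"
      using iI finite_midx by (simp add: if_distrib[of "\<lambda>x. _ * x"] sum.delta cong: if_cong)
    finally have "ip M (\<lambda>\<omega>. complex_of_real (X t \<omega>) - ?V n \<omega>) (\<lambda>\<omega>. complex_of_real (\<zeta> i \<omega>))
        = complex_of_real (rcoef i t) - wcoef u \<Phi> \<Psi> i t"
      using XZ by (simp add: ip_diff_left sq_int_X sq_int_comb sq_int_zeta)
    then show ?thesis
      using ip_cauchy_schwarz[OF sq_int_diff[OF sq_int_X sq_int_comb] sq_int_zeta, of t "\<lambda>i. wcoef u \<Phi> \<Psi> i t" "I n" i]
      by (simp add: nsq_zeta)
  qed
  have "?e \<longlonglongrightarrow> 0" using expansion[of t] by (simp add: nsq_def)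
  then have "(cmod (complex_of_real (rcoef i t) - wcoef u \<Phi> \<Psi> i t))\<^sup>2 \<le> 0"
    by (rule LIMSEQ_le_const) (use le in blast)
  then show ?thesis by simp
qed

lemma psum_eq: "complex_of_real (psum n t \<omega>) = (\<Sum>i\<in>I n. complex_of_real (\<zeta> i \<omega>) * wcoef u \<Phi> \<Psi> i t)"
  by (simp add: psum_def wcoef_eq_rcoef)

lemma psum_L2: "integrable M (\<lambda>\<omega>. (X t \<omega> - psum n t \<omega>)\<^sup>2)"
  "(\<lambda>n. \<integral>\<omega>. (X t \<omega> - psum n t \<omega>)\<^sup>2 \<partial>M) \<longlonglongrightarrow> 0"
proof -
  have eq: "(X t \<omega> - psum n t \<omega>)\<^sup>2 = (cmod (complex_of_real (X t \<omega>)
        - (\<Sum>i\<in>I n. complex_of_real (\<zeta> i \<omega>) * wcoef u \<Phi> \<Psi> i t)))\<^sup>2" for n \<omega>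
    unfolding psum_eq[symmetric] of_real_diff[symmetric] norm_of_real by simp
  show "integrable M (\<lambda>\<omega>. (X t \<omega> - psum n t \<omega>)\<^sup>2)"
    unfolding eq using sq_int_diff[OF sq_int_X sq_int_comb] by (simp add: sq_int_def)
  show "(\<lambda>n. \<integral>\<omega>. (X t \<omega> - psum n t \<omega>)\<^sup>2 \<partial>M) \<longlonglongrightarrow> 0"
    unfolding eq by (rule expansion)
qed

text \<open>By Cauchy-Schwarz, correlations with a variable of unit norm inherit mean-square
  continuity. This makes the partial sums sample continuous and jointly measurable.\<close>

lemma rcoef_continuous: "continuous_on UNIV (rcoef i)"
proof -
  have "isCont (rcoef i) t" for t
  proof -
    have le: "(rcoef i s - rcoef i t)\<^sup>2 \<le> (\<integral>\<omega>. (X s \<omega> - X t \<omega>)\<^sup>2 \<partial>M)" for s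
    proof -
      have "ip M (\<lambda>\<omega>. complex_of_real (X s \<omega>) - complex_of_real (X t \<omega>)) (\<lambda>\<omega>. complex_of_real (\<zeta> i \<omega>))
          = complex_of_real (rcoef i s - rcoef i t)"
        by (subst ip_diff_left[OF sq_int_X sq_int_X sq_int_zeta])
          (simp add: ip_def rcoef_def flip: of_real_mult)
      then have "(cmod (complex_of_real (rcoef i s - rcoef i t)))\<^sup>2 \<le> nsq M (\<lambda>\<omega>. complex_of_real (X s \<omega>) - complex_of_real (X t \<omega>))"
        using ip_cauchy_schwarz[OF sq_int_diff[OF sq_int_X sq_int_X] sq_int_zeta, of s t i] by (simp add: nsq_zeta)
      then show ?thesis by (simp add: nsq_def flip: of_real_diff)
    qed
    have "((\<lambda>s. \<integral>\<omega>. (X s \<omega> - X t \<omega>)\<^sup>2 \<partial>M) \<longlongrightarrow> 0) (at t)"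
      using msc by (simp add: ms_continuous_def)
    then have "((\<lambda>s. (rcoef i s - rcoef i t)\<^sup>2) \<longlongrightarrow> 0) (at t)"
      by (rule tendsto_sandwich[OF _ _ tendsto_const, rotated 2]) (use le in auto)
    then have "((\<lambda>s. \<bar>rcoef i s - rcoef i t\<bar>) \<longlongrightarrow> 0) (at t)"
      using tendsto_real_sqrt[of "\<lambda>s. (rcoef i s - rcoef i t)\<^sup>2" 0] by simp
    then have "((\<lambda>s. rcoef i s - rcoef i t) \<longlongrightarrow> 0) (at t)"
      by (rule tendsto_rabs_zero_cancel)
    then show ?thesis unfolding isCont_def by (rule LIM_zero_cancel)
  qed
  then show ?thesis by (intro continuous_at_imp_continuous_on) auto
qed

lemma rcoef_measurable [measurable]: "rcoef i \<in> borel_measurable borel"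
  by (rule borel_measurable_continuous_onI[OF rcoef_continuous])

lemma psum_measurable [measurable]: "(\<lambda>(t, \<omega>). psum n t \<omega>) \<in> borel_measurable (lborel \<Otimes>\<^sub>M M)"
  unfolding psum_def by measurable

lemma psum_continuous: "continuous_on A (\<lambda>t. psum n t \<omega>)"
  unfolding psum_def
  by (intro continuous_intros continuous_on_subset[OF rcoef_continuous subset_UNIV])

text \<open>A random variable without t that, multiplied by \<bar>t\<bar>, dominates the increment
  of the partial sums from m to n at every t. It is extended-valued, since finiteness is known only
  almost surely and only along a subsequence.\<close>

definition fluct :: "nat \<Rightarrow> nat \<Rightarrow> 'a \<Rightarrow> ennreal" where
  "fluct m n \<omega> = (\<integral>\<^sup>+y. ennreal (u2 y) * ennreal (cmod (\<Sum>i\<in>I n - I m. complex_of_real (\<zeta> i \<omega>) * wprim i y)) \<partial>lborel)"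

lemma fluct_measurable [measurable]: "fluct m n \<in> borel_measurable M"
  unfolding fluct_def[abs_def]
  by (intro sigma_finite_measure.borel_measurable_nn_integral sigma_finite_lborel) measurable

text \<open>The finite sum is taken inside the integral of \<open>integral_u_wfreq\<close>, and
  \<open>du t\<close> is replaced by its majorant \<bar>t\<bar> * u2.\<close>

lemma psum_diff_le:
  assumes "m \<le> n"
  shows "ennreal \<bar>psum n t \<omega> - psum m t \<omega>\<bar> \<le> ennreal \<bar>t\<bar> * fluct m n \<omega>"
proof -
  let ?J = "I n - I m"
  let ?w = "\<lambda>y. \<Sum>i\<in>?J. complex_of_real (\<zeta> i \<omega>) * wprim i y"
  have "psum n t \<omega> - psum m t \<omega> = (\<Sum>i\<in>?J. \<zeta> i \<omega> * rcoef i t)"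
    unfolding psum_def by (rule sum_diff[symmetric]) (auto simp: finite_midx incseq_midx[OF assms])
  then have "complex_of_real (psum n t \<omega> - psum m t \<omega>) = (\<Sum>i\<in>?J. complex_of_real (\<zeta> i \<omega>) * wcoef u \<Phi> \<Psi> i t)"
    by (simp add: wcoef_eq_rcoef)
  also have "\<dots> = - (LINT y|lborel. du t y * ?w y) / complex_of_real (sqrt (2 * pi))"
  proof -
    have "(LINT y|lborel. du t y * ?w y) = (LINT y|lborel. (\<Sum>i\<in>?J. complex_of_real (\<zeta> i \<omega>) * (du t y * wprim i y)))"
      by (simp add: sum_distrib_left mult_ac)
    also have "\<dots> = (\<Sum>i\<in>?J. complex_of_real (\<zeta> i \<omega>) * (LINT y|lborel. du t y * wprim i y))"
      by (subst Bochner_Integration.integral_sum) (auto intro: integrable_mult_right integrable_du_wprim)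
    finally show ?thesis
      by (simp add: wcoef_eq integral_u_wfreq sum_negf sum_divide_distrib)
  qed
  finally have c: "complex_of_real (psum n t \<omega> - psum m t \<omega>) = - (LINT y|lborel. du t y * ?w y) / complex_of_real (sqrt (2 * pi))" .
  have "\<bar>psum n t \<omega> - psum m t \<omega>\<bar> = cmod (complex_of_real (psum n t \<omega> - psum m t \<omega>))"
    by (simp only: norm_of_real)
  also have "\<dots> = cmod (LINT y|lborel. du t y * ?w y) / sqrt (2 * pi)"
    unfolding c norm_divide norm_minus_cancel cmod_sqrt_2pi ..
  finally have eq: "\<bar>psum n t \<omega> - psum m t \<omega>\<bar> = cmod (LINT y|lborel. du t y * ?w y) / sqrt (2 * pi)" .
  have int: "integrable lborel (\<lambda>y. du t y * ?w y)"
  proof -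
    have "integrable lborel (\<lambda>y. \<Sum>i\<in>?J. complex_of_real (\<zeta> i \<omega>) * (du t y * wprim i y))"
      by (intro Bochner_Integration.integrable_sum integrable_mult_right integrable_du_wprim)
    then show ?thesis by (simp add: sum_distrib_left mult_ac)
  qed
  \<comment> \<open>The normalising factor exceeds 1 and is simply dropped.\<close>
  have "sqrt (2 * pi) \<ge> 1" using pi_gt3 by simp
  then have "\<bar>psum n t \<omega> - psum m t \<omega>\<bar> \<le> cmod (LINT y|lborel. du t y * ?w y)"
    unfolding eq using mult_left_mono[of 1 "sqrt (2 * pi)" "cmod (LINT y|lborel. du t y * ?w y)"]
    by (simp add: divide_le_eq)
  then have "ennreal \<bar>psum n t \<omega> - psum m t \<omega>\<bar> \<le> ennreal (cmod (LINT y|lborel. du t y * ?w y))"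
    by (rule ennreal_leI)
  also have "\<dots> \<le> (\<integral>\<^sup>+y. ennreal (cmod (du t y * ?w y)) \<partial>lborel)"
    by (rule integral_norm_bound_ennreal[OF int])
  also have "\<dots> \<le> (\<integral>\<^sup>+y. ennreal \<bar>t\<bar> * (ennreal (u2 y) * ennreal (cmod (?w y))) \<partial>lborel)"
  proof (rule nn_integral_mono)
    fix y
    have "cmod (du t y * ?w y) \<le> \<bar>t\<bar> * u2 y * cmod (?w y)"
      unfolding norm_mult by (intro mult_right_mono du_bd) auto
    then show "ennreal (cmod (du t y * ?w y)) \<le> ennreal \<bar>t\<bar> * (ennreal (u2 y) * ennreal (cmod (?w y)))"
      using u2_nonneg[of y] by (simp add: ennreal_mult[symmetric] mult.assoc ennreal_leI)
  qed
  also have "\<dots> = ennreal \<bar>t\<bar> * fluct m n \<omega>"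
    unfolding fluct_def by (rule nn_integral_cmult) measurable
  finally show ?thesis .
qed

lemma nn_integral_comb_le:
  assumes "finite J"
  shows "(\<integral>\<^sup>+\<omega>. ennreal (cmod (\<Sum>i\<in>J. complex_of_real (\<zeta> i \<omega>) * a i)) \<partial>M) \<le> ennreal (sqrt (\<Sum>i\<in>J. (cmod (a i))\<^sup>2))"
proof (rule ennreal_le_sqrt)
  let ?f = "\<lambda>\<omega>. \<Sum>i\<in>J. complex_of_real (\<zeta> i \<omega>) * a i"
  have "(\<integral>\<^sup>+\<omega>. ennreal (cmod (?f \<omega>)) \<partial>M)\<^sup>2 = (\<integral>\<^sup>+\<omega>. ennreal (cmod (?f \<omega>)) * 1 \<partial>M)\<^sup>2" by simp
  also have "\<dots> \<le> (\<integral>\<^sup>+\<omega>. ennreal (cmod (?f \<omega>)) ^ 2 \<partial>M) * (\<integral>\<^sup>+\<omega>. 1 ^ 2 \<partial>M)"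
    by (rule Cauchy_Schwarz_nn_integral) measurable
  also have "(\<integral>\<^sup>+\<omega>. ennreal (cmod (?f \<omega>)) ^ 2 \<partial>M) = ennreal (nsq M ?f)"
    unfolding nsq_def using sq_int_comb[of a J] unfolding sq_int_def
    by (subst nn_integral_eq_integral[symmetric]) (auto simp: ennreal_power)
  also have "(\<integral>\<^sup>+\<omega>. 1 ^ 2 \<partial>M) = (1::ennreal)" by (simp add: emeasure_space_1)
  finally show "(\<integral>\<^sup>+\<omega>. ennreal (cmod (?f \<omega>)) \<partial>M)\<^sup>2 \<le> ennreal (\<Sum>i\<in>J. (cmod (a i))\<^sup>2)"
    by (simp add: nsq_comb[OF assms])
qed (simp add: sum_nonneg)

lemma fluct_expectation_le:
  "(\<integral>\<^sup>+\<omega>. fluct m n \<omega> \<partial>M) \<le> (\<integral>\<^sup>+y. ennreal (u2 y * sqrt (\<Sum>i\<in>I n - I m. (cmod (wprim i y))\<^sup>2)) \<partial>lborel)"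
proof -
  interpret P: pair_sigma_finite M lborel
    by (intro pair_sigma_finite.intro sigma_finite_measure_axioms sigma_finite_lborel)
  let ?w = "\<lambda>y \<omega>. \<Sum>i\<in>I n - I m. complex_of_real (\<zeta> i \<omega>) * wprim i y"
  have "(\<integral>\<^sup>+\<omega>. fluct m n \<omega> \<partial>M) = (\<integral>\<^sup>+y. \<integral>\<^sup>+\<omega>. ennreal (u2 y) * ennreal (cmod (?w y \<omega>)) \<partial>M \<partial>lborel)"
    unfolding fluct_def by (rule P.Fubini'[symmetric]) measurable
  also have "\<dots> = (\<integral>\<^sup>+y. ennreal (u2 y) * (\<integral>\<^sup>+\<omega>. ennreal (cmod (?w y \<omega>)) \<partial>M) \<partial>lborel)"
    by (intro nn_integral_cong nn_integral_cmult) measurable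
  also have "\<dots> \<le> (\<integral>\<^sup>+y. ennreal (u2 y) * ennreal (sqrt (\<Sum>i\<in>I n - I m. (cmod (wprim i y))\<^sup>2)) \<partial>lborel)"
    by (intro nn_integral_mono mult_left_mono nn_integral_comb_le) (auto simp: finite_midx)
  finally show ?thesis by (simp add: ennreal_mult' u2_nonneg)
qed

text \<open>Bessel's inequality makes the squared primitives summable at every frequency, so their
  tails tend to 0 pointwise under an integrable majorant and the expected fluctuations tend to 0.
  Along a subsequence these are at most 2^-r, so their sum has finite expectation.\<close>

lemma fluct_subsequence:
  obtains m where "strict_mono m" "AE \<omega> in M. (\<Sum>r. fluct (m r) (m (Suc r)) \<omega>) \<noteq> \<top>"
proof -
  define s where "s n y = (\<Sum>i\<in>I n. (cmod (wprim i y))\<^sup>2)" for n y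
  define S where "S y = (SUP n. s n y)" for y
  have bdd: "bdd_above (range (\<lambda>n. s n y))" for y
    using wprim_bessel[OF finite_midx] unfolding s_def by (intro bdd_aboveI2) auto
  have inc: "incseq (\<lambda>n. s n y)" for y
    unfolding s_def by (intro monoI sum_mono2 incseq_midx finite_midx) auto
  have lim: "(\<lambda>n. s n y) \<longlonglongrightarrow> S y" for y
    unfolding S_def by (rule LIMSEQ_incseq_SUP[OF bdd inc])
  have sS: "s n y \<le> S y" for n y unfolding S_def by (rule cSUP_upper[OF _ bdd]) simp
  have s0: "s n y \<ge> 0" for n y by (simp add: s_def sum_nonneg)
  have SK: "S y \<le> osc_const * \<bar>y\<bar>" for y
    unfolding S_def s_def by (intro cSUP_least wprim_bessel finite_midx) auto
  have [measurable]: "s n \<in> borel_measurable borel" for n unfolding s_def[abs_def] by measurable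
  have [measurable]: "S \<in> borel_measurable borel"
    by (rule borel_measurable_LIMSEQ_real[OF lim]) auto
  \<comment> \<open>Bounds a block that starts at n whatever its end, because s n' - s n \<le> S - s
    n for every n'. The choice of the next index is therefore free.\<close>
  define b where "b n y = u2 y * sqrt (S y - s n y)" for n y
  have [measurable]: "b n \<in> borel_measurable borel" for n unfolding b_def[abs_def] by measurable
  have b0: "b n y \<ge> 0" for n y using u2_nonneg sS by (simp add: b_def)
  let ?B = "\<lambda>y. u2 y + osc_const * (u2 y * \<bar>y\<bar>)"
  have iB: "integrable lborel ?B"
    by (intro Bochner_Integration.integrable_add integrable_mult_right u2_integrable int5)
  have b_le: "b n y \<le> ?B y" for n y
  proof -
    have "sqrt (S y - s n y) \<le> sqrt (osc_const * \<bar>y\<bar>)" using SK[of y] s0[of n y] by simp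
    also have "\<dots> \<le> 1 + osc_const * \<bar>y\<bar>"
    proof (rule real_le_lsqrt)
      have z: "0 \<le> osc_const * \<bar>y\<bar>" using osc_const_nonneg by simp
      then show "osc_const * \<bar>y\<bar> \<le> (1 + osc_const * \<bar>y\<bar>)\<^sup>2"
        using zero_le_power2[of "osc_const * \<bar>y\<bar>"] unfolding power2_sum one_power2 by linarith
    qed (use osc_const_nonneg in simp)
    finally have "b n y \<le> u2 y * (1 + osc_const * \<bar>y\<bar>)"
      unfolding b_def using u2_nonneg by (rule mult_left_mono)
    then show ?thesis by (simp add: algebra_simps)
  qed
  have ib: "integrable lborel (b n)" for n
    by (rule Bochner_Integration.integrable_bound[OF iB])
      (use b0 b_le in \<open>auto intro!: AE_I2 order_trans[OF _ abs_ge_self]\<close>)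
  define e where "e n = (LINT y|lborel. b n y)" for n
  have "e \<longlonglongrightarrow> (\<integral>y. 0 \<partial>(lborel :: real measure))"
    unfolding e_def
  proof (rule integral_dominated_convergence[where w="?B"])
    have "(\<lambda>n. b n y) \<longlonglongrightarrow> u2 y * sqrt (S y - S y)" for y
      unfolding b_def by (intro tendsto_intros lim)
    then show "AE y in lborel. (\<lambda>n. b n y) \<longlonglongrightarrow> 0" by simp
    show "AE y in lborel. norm (b n y) \<le> ?B y" for n
      using b0 b_le by (intro AE_I2) simp
  qed (use iB in auto)
  then have e0: "e \<longlonglongrightarrow> 0" by simp
  have "\<forall>r. \<exists>k. \<forall>n\<ge>k. e n < (1/2) ^ r"
    using order_tendstoD(2)[OF e0, of "(1/2) ^ _"] by (auto simp: eventually_sequentially)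
  from choice[OF this] obtain k where k: "\<And>r n. n \<ge> k r \<Longrightarrow> e n < (1/2) ^ r" by blast
  \<comment> \<open>Summing the thresholds guarantees m r \<ge> k r, and adding r makes the sequence
    strictly increasing.\<close>
  define m where "m r = (\<Sum>j\<le>r. k j) + r" for r
  have m: "strict_mono m" by (rule strict_mono_Suc_iff[THEN iffD2]) (simp add: m_def)
  have mk: "m r \<ge> k r" for r
    using member_le_sum[of r "{..r}" k] by (simp add: m_def)
  have fl: "(\<integral>\<^sup>+\<omega>. fluct (m r) (m (Suc r)) \<omega> \<partial>M) \<le> ennreal ((1/2) ^ r)" for r
  proof -
    have sub: "I (m r) \<subseteq> I (m (Suc r))" using m by (intro incseq_midx) (simp add: strict_mono_less_eq)
    have "(\<integral>\<^sup>+\<omega>. fluct (m r) (m (Suc r)) \<omega> \<partial>M) \<le> (\<integral>\<^sup>+y. ennreal (u2 y * sqrt (\<Sum>i\<in>I (m (Suc r)) - I (m r). (cmod (wprim i y))\<^sup>2)) \<partial>lborel)"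
      by (rule fluct_expectation_le)
    also have "\<dots> \<le> (\<integral>\<^sup>+y. ennreal (b (m r) y) \<partial>lborel)"
    proof (intro nn_integral_mono ennreal_leI)
      fix y
      have "(\<Sum>i\<in>I (m (Suc r)) - I (m r). (cmod (wprim i y))\<^sup>2) = s (m (Suc r)) y - s (m r) y"
        unfolding s_def by (rule sum_diff) (auto simp: finite_midx sub)
      then show "u2 y * sqrt (\<Sum>i\<in>I (m (Suc r)) - I (m r). (cmod (wprim i y))\<^sup>2) \<le> b (m r) y"
        unfolding b_def using u2_nonneg sS by (intro mult_left_mono) auto
    qed
    also have "\<dots> = ennreal (e (m r))"
      unfolding e_def using b0 by (intro nn_integral_eq_integral ib) auto
    also have "\<dots> \<le> ennreal ((1/2) ^ r)" using k[OF mk[of r]] by (intro ennreal_leI) simp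
    finally show ?thesis .
  qed
  have "(\<integral>\<^sup>+\<omega>. (\<Sum>r. fluct (m r) (m (Suc r)) \<omega>) \<partial>M) = (\<Sum>r. \<integral>\<^sup>+\<omega>. fluct (m r) (m (Suc r)) \<omega> \<partial>M)"
    by (rule nn_integral_suminf) measurable
  also have "\<dots> \<le> (\<Sum>r. ennreal ((1/2) ^ r))" by (intro suminf_le fl) auto
  also have "\<dots> = ennreal (\<Sum>r. (1/2) ^ r)" by (intro suminf_ennreal2) auto
  also have "\<dots> < \<top>" by simp
  finally have "AE \<omega> in M. (\<Sum>r. fluct (m r) (m (Suc r)) \<omega>) \<noteq> \<infinity>"
    by (intro nn_integral_PInf_AE) auto
  then show ?thesis using that[OF m] by simp
qed

text \<open>The Weierstrass test on each [-R, R], with the summable majorant \<bar>R\<bar> * g r,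
  followed by continuity of uniform limits.\<close>

lemma psum_converges_continuous:
  assumes m: "strict_mono m" and fin: "(\<Sum>r. fluct (m r) (m (Suc r)) \<omega>) \<noteq> \<top>"
  obtains f where "continuous_on UNIV f" "\<And>t. (\<lambda>r. psum (m r) t \<omega>) \<longlonglongrightarrow> f t"
proof -
  define g where "g r = enn2real (fluct (m r) (m (Suc r)) \<omega>)" for r
  have g: "summable g" unfolding g_def by (rule summable_enn2real(1)[OF fin])
  have g0: "g r \<ge> 0" for r by (simp add: g_def)
  have fl: "fluct (m r) (m (Suc r)) \<omega> = ennreal (g r)" for r
    using summable_enn2real(2)[OF fin, of r] by (simp add: g_def)
  define d where "d r t = psum (m (Suc r)) t \<omega> - psum (m r) t \<omega>" for r t
  have d: "\<bar>d r t\<bar> \<le> \<bar>t\<bar> * g r" for r t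
  proof -
    have "m r \<le> m (Suc r)" using m by (simp add: strict_mono_less_eq)
    from psum_diff_le[OF this, of t \<omega>] show ?thesis
      unfolding d_def fl using g0 by (simp add: ennreal_mult[symmetric])
  qed
  have sum_d: "(\<Sum>r<n. d r t) = psum (m n) t \<omega> - psum (m 0) t \<omega>" for n t
    unfolding d_def by (rule sum_lessThan_telescope)
  define f where "f t = psum (m 0) t \<omega> + (\<Sum>r. d r t)" for t
  have unif: "uniform_limit {-R..R} (\<lambda>n t. \<Sum>r<n. d r t) (\<lambda>t. \<Sum>r. d r t) sequentially" for R
  proof (rule Weierstrass_m_test)
    show "norm (d r t) \<le> \<bar>R\<bar> * g r" if "t \<in> {-R..R}" for r t
    proof -
      have "\<bar>t\<bar> * g r \<le> \<bar>R\<bar> * g r" using that g0 by (intro mult_right_mono) auto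
      then show ?thesis using d[of r t] by simp
    qed
    show "summable (\<lambda>r. \<bar>R\<bar> * g r)" by (intro summable_mult g)
  qed
  have cont: "continuous_on {-R..R} (\<lambda>t. \<Sum>r. d r t)" for R
  proof (rule uniform_limit_theorem[OF _ unif])
    show "\<forall>\<^sub>F n in sequentially. continuous_on {-R..R} (\<lambda>t. \<Sum>r<n. d r t)"
      unfolding sum_d by (intro always_eventually allI continuous_intros psum_continuous)
  qed simp
  have "continuous_on UNIV (\<lambda>t. \<Sum>r. d r t)"
  proof (rule continuous_at_imp_continuous_on, rule ballI)
    fix t :: real
    have "continuous_on {-(\<bar>t\<bar>+1)<..<\<bar>t\<bar>+1} (\<lambda>t. \<Sum>r. d r t)"
      by (rule continuous_on_subset[OF cont[of "\<bar>t\<bar>+1"]]) auto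
    then show "isCont (\<lambda>t. \<Sum>r. d r t) t"
      by (rule continuous_on_interior) (auto simp: interior_open abs_if)
  qed
  then have "continuous_on UNIV f" unfolding f_def by (intro continuous_intros psum_continuous)
  moreover have "(\<lambda>n. psum (m n) t \<omega>) \<longlonglongrightarrow> f t" for t
  proof -
    have "(\<lambda>n. \<Sum>r<n. d r t) \<longlonglongrightarrow> (\<Sum>r. d r t)"
      by (rule tendsto_uniform_limitI[OF unif[of "\<bar>t\<bar>"]]) auto
    then have "(\<lambda>n. psum (m 0) t \<omega> + (\<Sum>r<n. d r t)) \<longlonglongrightarrow> f t"
      unfolding f_def by (intro tendsto_intros)
    then show ?thesis by (simp add: sum_d)
  qed
  ultimately show ?thesis by (rule that)
qed

text \<open>Separability alone does not make the process jointly measurable; sample continuity of its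
  mean-square limit, combined with separability, does.\<close>

lemma measurable_version:
  obtains Y where "(\<lambda>(t, \<omega>). Y t \<omega>) \<in> borel_measurable (lborel \<Otimes>\<^sub>M M)"
    "AE \<omega> in M. \<forall>t. X t \<omega> = Y t \<omega>"
proof -
  obtain m where m: "strict_mono m" and fin: "AE \<omega> in M. (\<Sum>r. fluct (m r) (m (Suc r)) \<omega>) \<noteq> \<top>"
    by (rule fluct_subsequence)
  \<comment> \<open>\<open>lim\<close> is a total function, so joint measurability holds everywhere;
    the arbitrary value at divergent sequences is confined to the null set excluded by
    \<open>fin\<close>.\<close>
  define Y where "Y t \<omega> = lim (\<lambda>r. psum (m r) t \<omega>)" for t \<omega>
  have Y_meas: "(\<lambda>(t, \<omega>). Y t \<omega>) \<in> borel_measurable (lborel \<Otimes>\<^sub>M M)"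
  proof -
    have "(\<lambda>x. lim (\<lambda>r. (\<lambda>(t, \<omega>). psum (m r) t \<omega>) x)) \<in> borel_measurable (lborel \<Otimes>\<^sub>M M)"
      by (intro borel_measurable_lim_metric psum_measurable)
    then show ?thesis by (simp add: Y_def case_prod_beta')
  qed
  have cont: "continuous_on UNIV (\<lambda>t. Y t \<omega>) \<and> (\<forall>t. (\<lambda>r. psum (m r) t \<omega>) \<longlonglongrightarrow> Y t \<omega>)"
    if f: "(\<Sum>r. fluct (m r) (m (Suc r)) \<omega>) \<noteq> \<top>" for \<omega>
  proof -
    obtain f where f: "continuous_on UNIV f" "\<And>t. (\<lambda>r. psum (m r) t \<omega>) \<longlonglongrightarrow> f t"
      by (rule psum_converges_continuous[OF m f]) blast
    have "Y t \<omega> = f t" for t unfolding Y_def by (rule limI[OF f(2)])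
    then show ?thesis using f by simp
  qed
  have XY: "AE \<omega> in M. X t \<omega> = Y t \<omega>" for t
  proof -
    have lim: "(\<lambda>n. \<integral>\<omega>. (X t \<omega> - psum (m n) t \<omega>)\<^sup>2 \<partial>M) \<longlonglongrightarrow> 0"
      using LIMSEQ_subseq_LIMSEQ[OF psum_L2(2)[of t] m] by (simp add: o_def)
    obtain r where r: "strict_mono r" "AE \<omega> in M. (\<lambda>n. psum (m (r n)) t \<omega>) \<longlonglongrightarrow> X t \<omega>"
      by (rule L2_convergence_AE_subseq[OF psum_L2(1) lim])
    show ?thesis
      using r(2) fin
    proof eventually_elim
      case (elim \<omega>)
      have "(\<lambda>n. psum (m n) t \<omega>) \<longlonglongrightarrow> Y t \<omega>" using cont[OF elim(2)] by simp
      from LIMSEQ_subseq_LIMSEQ[OF this r(1)] have 1: "(\<lambda>n. psum (m (r n)) t \<omega>) \<longlonglongrightarrow> Y t \<omega>"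
        by (simp add: o_def)
      show ?case by (rule LIMSEQ_unique[OF elim(1) 1])
    qed
  qed
  from sep obtain S N where SN0: "countable S \<and> closure S = (UNIV :: real set) \<and> N \<in> null_sets M \<and>
      (\<forall>G F. open G \<and> closed (F::real set) \<longrightarrow>
        {\<omega>\<in>space M. \<forall>t\<in>G \<inter> S. X t \<omega> \<in> F} - {\<omega>\<in>space M. \<forall>t\<in>G. X t \<omega> \<in> F} \<subseteq> N)"
    unfolding separable_process_def by (elim exE)
  then have S: "countable S" and N: "N \<in> null_sets M" by simp_all
  have SN: "{\<omega>\<in>space M. \<forall>t\<in>G \<inter> S. X t \<omega> \<in> F} - {\<omega>\<in>space M. \<forall>t\<in>G. X t \<omega> \<in> F} \<subseteq> N"
    if "open G" "closed F" for G F
    using SN0 that by simp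
  have "AE \<omega> in M. \<forall>s\<in>S. X s \<omega> = Y s \<omega>"
    using S XY by (simp add: AE_ball_countable)
  moreover have "AE \<omega> in M. \<omega> \<notin> N" by (rule AE_not_in[OF N])
  moreover have "AE \<omega> in M. \<omega> \<in> space M" by (rule AE_space)
  ultimately have "AE \<omega> in M. \<forall>t. X t \<omega> = Y t \<omega>"
    using fin
  proof eventually_elim
    case (elim \<omega>)
    have c: "continuous_on UNIV (\<lambda>t. Y t \<omega>)" using cont[OF elim(4)] by blast
    show ?case
    proof (rule allI, rule ccontr)
      fix t assume ne: "X t \<omega> \<noteq> Y t \<omega>"
      \<comment> \<open>Half the gap, so the closed interval \<open>F\<close> around Y t excludes X
        t. By continuity of Y and agreement on S, the process lies in \<open>F\<close> on the part
        of S near t, and separability extends this to t itself.\<close>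
      define \<epsilon> where "\<epsilon> = \<bar>X t \<omega> - Y t \<omega>\<bar> / 2"
      have \<epsilon>: "\<epsilon> > 0" using ne by (simp add: \<epsilon>_def)
      define F where "F = {Y t \<omega> - \<epsilon>..Y t \<omega> + \<epsilon>}"
      define G where "G = (\<lambda>s. Y s \<omega>) -` {Y t \<omega> - \<epsilon><..<Y t \<omega> + \<epsilon>}"
      have G: "open G" unfolding G_def by (rule open_vimage[OF _ c]) simp
      have tG: "t \<in> G" using \<epsilon> by (simp add: G_def)
      have "\<forall>s\<in>G \<inter> S. X s \<omega> \<in> F" using elim(1) by (auto simp: G_def F_def)
      then have "\<forall>s\<in>G. X s \<omega> \<in> F"
        using SN[OF G, of F] elim(2,3) by (auto simp: F_def)
      then have "X t \<omega> \<in> F" using tG by blast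
      then have "\<bar>X t \<omega> - Y t \<omega>\<bar> \<le> \<epsilon>" by (auto simp: F_def abs_le_iff)
      then show False using \<epsilon> by (simp add: \<epsilon>_def)
    qed
  qed
  then show ?thesis by (rule that[OF Y_meas])
qed

end

section \<open>The error estimate\<close>

text \<open>The finite omitted blocks satisfy the exponential bound uniformly, because their squared
  coefficients sum to at most x^2. Fatou's lemma along an almost surely convergent subsequence
  carries the bound to the whole error.\<close>

lemma (in wavelet_expansion) tail_exp_bound:
  assumes indep: "indep_vars (\<lambda>_. borel) \<zeta> UNIV"
    and ssg: "\<And>i. strictly_sub_gaussian M (\<zeta> i)"
    and J: "finite J" and tail: "\<And>K. finite K \<Longrightarrow> K \<inter> J = {} \<Longrightarrow> (\<Sum>i\<in>K. (rcoef i t)\<^sup>2) \<le> x\<^sup>2"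
  shows "(\<integral>\<^sup>+\<omega>. ennreal (exp (l * (X t \<omega> - (\<Sum>i\<in>J. \<zeta> i \<omega> * rcoef i t)))) \<partial>M) \<le> ennreal (exp (l\<^sup>2 * x\<^sup>2 / 2))"
proof -
  let ?XJ = "\<lambda>\<omega>. \<Sum>i\<in>J. \<zeta> i \<omega> * rcoef i t"
  have zeta1: "(\<integral>\<omega>. (\<zeta> i \<omega>)\<^sup>2 \<partial>M) = 1" for i
    using zeta_orth[of i i] by (simp add: power2_eq_square)
  obtain n0 where n0: "J \<subseteq> I n0" by (rule midx_covers[OF J])
  have step: "(\<integral>\<^sup>+\<omega>. ennreal (exp (l * (psum n t \<omega> - ?XJ \<omega>))) \<partial>M) \<le> ennreal (exp (l\<^sup>2 * x\<^sup>2 / 2))"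
    if "n \<ge> n0" for n
  proof -
    have sub: "J \<subseteq> I n" using n0 incseq_midx[OF that] by blast
    have "psum n t \<omega> - ?XJ \<omega> = (\<Sum>i\<in>I n - J. rcoef i t * \<zeta> i \<omega>)" for \<omega>
      unfolding psum_def using sum_diff[OF finite_midx sub, of "\<lambda>i. \<zeta> i \<omega> * rcoef i t"]
      by (simp add: mult.commute)
    then have "(\<integral>\<^sup>+\<omega>. ennreal (exp (l * (psum n t \<omega> - ?XJ \<omega>))) \<partial>M)
        \<le> ennreal (exp (l\<^sup>2 * (\<Sum>i\<in>I n - J. (rcoef i t)\<^sup>2) / 2))"
      using indep_sum_exp_bound[OF indep, of "I n - J" l "\<lambda>i. rcoef i t"]
        strictly_sub_gaussian_exp_bound[OF ssg] zeta1
      by (simp add: finite_midx)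
    also have "\<dots> \<le> ennreal (exp (l\<^sup>2 * x\<^sup>2 / 2))"
    proof -
      have "(\<Sum>i\<in>I n - J. (rcoef i t)\<^sup>2) \<le> x\<^sup>2" by (rule tail) (auto simp: finite_midx)
      then have "l\<^sup>2 * (\<Sum>i\<in>I n - J. (rcoef i t)\<^sup>2) \<le> l\<^sup>2 * x\<^sup>2" by (rule mult_left_mono) simp
      then show ?thesis by (intro ennreal_leI) simp
    qed
    finally show ?thesis .
  qed
  obtain r where r: "strict_mono r" "AE \<omega> in M. (\<lambda>n. psum (r n) t \<omega>) \<longlonglongrightarrow> X t \<omega>"
    by (rule L2_convergence_AE_subseq[OF psum_L2])
  \<comment> \<open>The shift by n0 ensures r (n + n0) \<ge> n0, so that every term contains J and
    \<open>step\<close> applies.\<close>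
  define f where "f n \<omega> = ennreal (exp (l * (psum (r (n + n0)) t \<omega> - ?XJ \<omega>)))" for n \<omega>
  have ps [measurable]: "psum n t \<in> borel_measurable M" for n
    unfolding psum_def[abs_def] by measurable
  have f_meas: "f n \<in> borel_measurable M" for n
    unfolding f_def[abs_def] by measurable
  have "(\<integral>\<^sup>+\<omega>. ennreal (exp (l * (X t \<omega> - ?XJ \<omega>))) \<partial>M) = (\<integral>\<^sup>+\<omega>. liminf (\<lambda>n. f n \<omega>) \<partial>M)"
  proof (rule nn_integral_cong_AE)
    show "AE \<omega> in M. ennreal (exp (l * (X t \<omega> - ?XJ \<omega>))) = liminf (\<lambda>n. f n \<omega>)"
      using r(2)
    proof eventually_elim
      case (elim \<omega>)
      from LIMSEQ_ignore_initial_segment[OF this, of n0]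
      have "(\<lambda>n. f n \<omega>) \<longlonglongrightarrow> ennreal (exp (l * (X t \<omega> - ?XJ \<omega>)))"
        unfolding f_def by (intro tendsto_ennrealI tendsto_exp tendsto_mult tendsto_diff tendsto_const)
      from lim_imp_Liminf[OF _ this] show ?case by simp
    qed
  qed
  also have "\<dots> \<le> liminf (\<lambda>n. \<integral>\<^sup>+\<omega>. f n \<omega> \<partial>M)"
    by (rule nn_integral_liminf[OF f_meas])
  also have "\<dots> \<le> liminf (\<lambda>n. ennreal (exp (l\<^sup>2 * x\<^sup>2 / 2)))"
  proof (rule Liminf_mono, rule always_eventually, rule allI)
    fix n
    have "n0 \<le> r (n + n0)" using seq_suble[OF r(1), of "n + n0"] by simp
    from step[OF this] show "(\<integral>\<^sup>+\<omega>. f n \<omega> \<partial>M) \<le> ennreal (exp (l\<^sup>2 * x\<^sup>2 / 2))" by (simp add: f_def)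
  qed
  also have "\<dots> = ennreal (exp (l\<^sup>2 * x\<^sup>2 / 2))" by (rule Liminf_const) simp
  finally show ?thesis .
qed

text \<open>Mean-square continuity bounds the second moment near each point, and bisection makes the
  bound uniform. Through the strictly sub-Gaussian inequality it bounds the exponential moments, so
  that the real-valued supremum in m is a genuine one.\<close>

lemma (in wavelet_expansion) second_moment_bounded:
  assumes "a \<le> b" shows "\<exists>B. \<forall>s\<in>{a..b}. (\<integral>\<omega>. (X s \<omega>)\<^sup>2 \<partial>M) \<le> B"
  using assms
proof (induction rule: Bolzano)
  case (trans a b c)
  then obtain B1 B2 where "\<forall>s\<in>{a..b}. (\<integral>\<omega>. (X s \<omega>)\<^sup>2 \<partial>M) \<le> B1" "\<forall>s\<in>{b..c}. (\<integral>\<omega>. (X s \<omega>)\<^sup>2 \<partial>M) \<le> B2"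
    by blast
  then show ?case by (intro exI[of _ "max B1 B2"]) (auto simp: le_max_iff_disj)
next
  case (local t)
  have "((\<lambda>s. \<integral>\<omega>. (X s \<omega> - X t \<omega>)\<^sup>2 \<partial>M) \<longlongrightarrow> 0) (at t)"
    using msc by (simp add: ms_continuous_def)
  then have "\<forall>\<^sub>F s in at t. (\<integral>\<omega>. (X s \<omega> - X t \<omega>)\<^sup>2 \<partial>M) < 1"
    by (rule order_tendstoD) simp
  then obtain d where d: "d > 0" "\<And>s. s \<noteq> t \<Longrightarrow> dist s t < d \<Longrightarrow> (\<integral>\<omega>. (X s \<omega> - X t \<omega>)\<^sup>2 \<partial>M) < 1"
    unfolding eventually_at by auto
  have "(\<integral>\<omega>. (X s \<omega>)\<^sup>2 \<partial>M) \<le> 2 + 2 * (\<integral>\<omega>. (X t \<omega>)\<^sup>2 \<partial>M)" if "\<bar>s - t\<bar> < d" for s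
  proof -
    have "(\<integral>\<omega>. (X s \<omega> - X t \<omega>)\<^sup>2 \<partial>M) \<le> 1"
      using d(2)[of s] that by (cases "s = t") (auto simp: dist_real_def)
    moreover have "nsq M (\<lambda>\<omega>. complex_of_real (X s \<omega>)) \<le>
        2 * nsq M (\<lambda>\<omega>. complex_of_real (X s \<omega>) - complex_of_real (X t \<omega>)) + 2 * nsq M (\<lambda>\<omega>. complex_of_real (X t \<omega>))"
      using nsq_add_le[OF sq_int_diff[OF sq_int_X[of s] sq_int_X[of t]] sq_int_X[of t]] by simp
    ultimately show ?thesis by (simp add: nsq_def flip: of_real_diff)
  qed
  then show ?case using d(1)
    by (intro exI[of _ d] conjI allI impI exI[of _ "2 + 2 * (\<integral>\<omega>. (X t \<omega>)\<^sup>2 \<partial>M)"] ballI) auto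
qed

text \<open>X t is the combination with coefficients 1, 0, 0, ...; its partial sums equal X t from n
  = 1 on.\<close>

lemma strictly_sub_gaussian_process_member:
  assumes "strictly_sub_gaussian_process M X" "X t \<in> borel_measurable M" "integrable M (\<lambda>\<omega>. (X t \<omega>)\<^sup>2)"
  shows "strictly_sub_gaussian M (X t)"
proof -
  have "(\<lambda>n. \<integral>\<omega>. (X t \<omega> - (\<Sum>i<n. (if i = (0::nat) then 1 else 0) * X t \<omega>))\<^sup>2 \<partial>M) \<longlonglongrightarrow> 0"
  proof (rule tendsto_eventually)
    have "(\<Sum>i<n. (if i = (0::nat) then 1 else 0) * X t \<omega>) = X t \<omega>" if "n \<ge> 1" for n \<omega>
      using that by (simp add: if_distrib[of "\<lambda>x. x * _"] sum.delta cong: if_cong)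
    then show "\<forall>\<^sub>F n in sequentially. (\<integral>\<omega>. (X t \<omega> - (\<Sum>i<n. (if i = (0::nat) then 1 else 0) * X t \<omega>))\<^sup>2 \<partial>M) = 0"
      by (intro eventually_sequentiallyI[of 1]) simp
  qed
  with assms(1)[unfolded strictly_sub_gaussian_process_def, THEN spec, of "\<lambda>_. t", THEN spec,
      of "\<lambda>i. if i = (0::nat) then 1 else 0", THEN spec, of "X t"] assms(2,3)
  show ?thesis by (simp only: simp_thms)
qed

text \<open>The event speaks of X, whose joint measurability is not given, so it is covered by a
  measurable set: the Markov set for Y together with a null set containing all points where X and Y
  differ. The case I = \<infinity> is listed separately because \<open>enn2real\<close> sends
  \<infinity> to 0.\<close>

lemma (in prob_space) markov_time_integral:
  fixes X Y Z :: "real \<Rightarrow> 'a \<Rightarrow> real"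
  assumes Y: "(\<lambda>(t, \<omega>). Y t \<omega>) \<in> borel_measurable (lborel \<Otimes>\<^sub>M M)"
    and Z: "(\<lambda>(t, \<omega>). Z t \<omega>) \<in> borel_measurable (lborel \<Otimes>\<^sub>M M)"
    and XY: "AE \<omega> in M. \<forall>t. X t \<omega> = Y t \<omega>"
    and T: "T > 0" and p: "p \<ge> 1" and d: "\<delta> > 0" and e: "\<epsilon> > 0"
    and bd: "\<And>t. t \<in> {0..T} \<Longrightarrow> (\<integral>\<^sup>+\<omega>. ennreal (\<bar>exp (X t \<omega>) - exp (Z t \<omega>)\<bar> powr p) \<partial>M) \<le> ennreal (\<epsilon> * \<delta> powr p / T)"
  shows "\<exists>A\<in>sets M. {\<omega>\<in>space M.
      (let I = (\<integral>\<^sup>+ t\<in>{0..T}. ennreal (\<bar>exp (X t \<omega>) - exp (Z t \<omega>)\<bar> powr p) \<partial>lborel)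
       in I = \<infinity> \<or> enn2real I powr (1 / p) > \<delta>)} \<subseteq> A \<and> measure M A \<le> \<epsilon>"
proof -
  interpret PP: pair_sigma_finite M lborel
    by (intro pair_sigma_finite.intro sigma_finite_measure_axioms sigma_finite_lborel)
  define J where "J \<omega> = (\<integral>\<^sup>+ t\<in>{0..T}. ennreal (\<bar>exp (Y t \<omega>) - exp (Z t \<omega>)\<bar> powr p) \<partial>lborel)" for \<omega>
  note [measurable] = Y Z
  have m: "(\<lambda>(\<omega>, t). ennreal (\<bar>exp (Y t \<omega>) - exp (Z t \<omega>)\<bar> powr p) * indicator {0..T} t) \<in> borel_measurable (M \<Otimes>\<^sub>M lborel)"
  proof -
    have "(\<lambda>(\<omega>, t). Y t \<omega>) \<in> borel_measurable (M \<Otimes>\<^sub>M lborel)"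
      using measurable_compose[OF measurable_pair_swap' Y] by (simp add: case_prod_beta')
    moreover have "(\<lambda>(\<omega>, t). Z t \<omega>) \<in> borel_measurable (M \<Otimes>\<^sub>M lborel)"
      using measurable_compose[OF measurable_pair_swap' Z] by (simp add: case_prod_beta')
    ultimately show ?thesis unfolding case_prod_beta' by measurable
  qed
  have J_meas [measurable]: "J \<in> borel_measurable M"
    unfolding J_def[abs_def] using m by (intro sigma_finite_measure.borel_measurable_nn_integral sigma_finite_lborel) simp
  have "(\<integral>\<^sup>+\<omega>. J \<omega> \<partial>M) = (\<integral>\<^sup>+t. \<integral>\<^sup>+\<omega>. ennreal (\<bar>exp (Y t \<omega>) - exp (Z t \<omega>)\<bar> powr p) * indicator {0..T} t \<partial>M \<partial>lborel)"
    unfolding J_def by (rule PP.Fubini'[symmetric]) (rule m)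
  also have "\<dots> \<le> (\<integral>\<^sup>+t. ennreal (\<epsilon> * \<delta> powr p / T) * indicator {0..T} t \<partial>lborel)"
  proof (rule nn_integral_mono)
    fix t :: real
    show "(\<integral>\<^sup>+\<omega>. ennreal (\<bar>exp (Y t \<omega>) - exp (Z t \<omega>)\<bar> powr p) * indicator {0..T} t \<partial>M) \<le> ennreal (\<epsilon> * \<delta> powr p / T) * indicator {0..T} t"
    proof (cases "t \<in> {0..T}")
      case True
      have "(\<integral>\<^sup>+\<omega>. ennreal (\<bar>exp (Y t \<omega>) - exp (Z t \<omega>)\<bar> powr p) \<partial>M) = (\<integral>\<^sup>+\<omega>. ennreal (\<bar>exp (X t \<omega>) - exp (Z t \<omega>)\<bar> powr p) \<partial>M)"
        by (rule nn_integral_cong_AE) (use XY in \<open>auto elim!: eventually_mono\<close>)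
      then show ?thesis using bd[OF True] True by simp
    qed simp
  qed
  also have "\<dots> = ennreal (\<epsilon> * \<delta> powr p)"
    using T e by (simp add: nn_integral_cmult_indicator ennreal_mult[symmetric])
  finally have EJ: "(\<integral>\<^sup>+\<omega>. J \<omega> \<partial>M) \<le> ennreal (\<epsilon> * \<delta> powr p)" .
  \<comment> \<open>The threshold is on the p-th power and non-strict, so \<open>B\<close> also
    contains the points where J is infinite.\<close>
  define B where "B = {\<omega>\<in>space M. ennreal (\<delta> powr p) \<le> J \<omega>}"
  have B [measurable]: "B \<in> sets M" unfolding B_def by measurable
  have dp: "\<delta> powr p > 0" using d by simp
  have "ennreal (\<delta> powr p * measure M B) = (\<integral>\<^sup>+\<omega>. ennreal (\<delta> powr p) * indicator B \<omega> \<partial>M)"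
    using dp by (simp add: nn_integral_cmult_indicator emeasure_eq_measure ennreal_mult)
  also have "\<dots> \<le> (\<integral>\<^sup>+\<omega>. J \<omega> \<partial>M)"
    by (intro nn_integral_mono) (auto simp: B_def indicator_def)
  also note EJ
  finally have "\<delta> powr p * measure M B \<le> \<delta> powr p * \<epsilon>" using e dp by (simp add: mult.commute)
  then have PB: "measure M B \<le> \<epsilon>" using dp by (simp only: mult_le_cancel_left_pos)
  obtain N where N: "{\<omega>\<in>space M. \<not> (\<forall>t. X t \<omega> = Y t \<omega>)} \<subseteq> N" "emeasure M N = 0" "N \<in> sets M"
    by (rule AE_E[OF XY])
  have "measure M (B \<union> N) = measure M B"
    using N by (intro measure_Un_null_set) auto
  moreover have "{\<omega>\<in>space M.
      (let I = (\<integral>\<^sup>+ t\<in>{0..T}. ennreal (\<bar>exp (X t \<omega>) - exp (Z t \<omega>)\<bar> powr p) \<partial>lborel)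
       in I = \<infinity> \<or> enn2real I powr (1 / p) > \<delta>)} \<subseteq> B \<union> N"
  proof (rule subsetI, elim CollectE conjE)
    fix \<omega>
    assume w: "\<omega> \<in> space M" and I: "let I = (\<integral>\<^sup>+ t\<in>{0..T}. ennreal (\<bar>exp (X t \<omega>) - exp (Z t \<omega>)\<bar> powr p) \<partial>lborel)
       in I = \<infinity> \<or> enn2real I powr (1 / p) > \<delta>"
    show "\<omega> \<in> B \<union> N"
    proof (cases "\<forall>t. X t \<omega> = Y t \<omega>")
      case True
      then have "J \<omega> = \<infinity> \<or> enn2real (J \<omega>) powr (1 / p) > \<delta>"
        using I by (simp add: J_def Let_def)
      then have "ennreal (\<delta> powr p) \<le> J \<omega>"
      proof
        assume a: "enn2real (J \<omega>) powr (1 / p) > \<delta>"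
        have "\<delta> powr p \<le> (enn2real (J \<omega>) powr (1 / p)) powr p"
          using a d p by (intro powr_mono2) auto
        also have "\<dots> = enn2real (J \<omega>)" using p by (simp add: powr_powr)
        finally have "ennreal (\<delta> powr p) \<le> ennreal (enn2real (J \<omega>))" by (rule ennreal_leI)
        also have "\<dots> \<le> J \<omega>" by (cases "J \<omega>") auto
        finally show ?thesis .
      qed simp
      then show ?thesis using w by (simp add: B_def)
    next
      case False
      then show ?thesis using w N(1) by auto
    qed
  qed
  ultimately show ?thesis using PB B N(3) by (intro bexI[of _ "B \<union> N"]) auto
qed

theorem theorem4:
  fixes M :: "'a measure"
    and X :: "real \<Rightarrow> 'a \<Rightarrow> real"
    and u du :: "real \<Rightarrow> real \<Rightarrow> complex"
    and \<phi> \<psi> \<Phi> \<Psi> d\<Phi> d\<Psi> :: "real \<Rightarrow> complex"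
    and u1 u2 :: "real \<Rightarrow> real"
    and \<xi> :: "int \<Rightarrow> 'a \<Rightarrow> real"
    and \<eta> :: "nat \<Rightarrow> int \<Rightarrow> 'a \<Rightarrow> real"
    and T p \<delta> \<epsilon> C S1 S2 Q1 Q2 D m xm :: real
    and N0 N :: nat and Mj :: "nat \<Rightarrow> nat"
  assumes P: "prob_space M"
    and params: "T > 0" "p \<ge> 1" "\<delta> > 0" "0 < \<epsilon>" "\<epsilon> < 1"
    \<comment> \<open>standing setting\<close>
    and X_rv: "\<And>t. X t \<in> borel_measurable M"
    and X_L2: "\<And>t. integrable M (\<lambda>\<omega>. (X t \<omega>)\<^sup>2)"
    and X_centered: "\<And>t. (\<integral>\<omega>. X t \<omega> \<partial>M) = 0"
    and u_borel: "(\<lambda>(t, y). u t y) \<in> borel_measurable (borel :: (real \<times> real) measure)"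
    and u_L2: "\<And>t. integrable lborel (\<lambda>y. (cmod (u t y))\<^sup>2)"
    and cov: "\<And>t s. complex_of_real (\<integral>\<omega>. X t \<omega> * X s \<omega> \<partial>M)
                     = (LINT y|lborel. u t y * cnj (u s y))"
    \<comment> \<open>condition RC\<close>
    and u_L1: "\<And>t. integrable lborel (u t)"
    and RC: "\<And>t x. Im ((LINT y|lborel. u t y * exp (\<i> * complex_of_real (x * y))) / (2 * pi)) = 0"
    \<comment> \<open>process properties\<close>
    and sep: "separable_process M X"
    and msc: "ms_continuous M X"
    and ssg: "strictly_sub_gaussian_process M X"
    \<comment> \<open>MRA, wavelet and their Fourier transforms\<close>
    and wav: "mra_wavelet \<phi> \<psi>"
    and Phi: "fourier_L2 \<phi> \<Phi>"
    and Psi: "fourier_L2 \<psi> \<Psi>"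
    \<comment> \<open>expansion (E) with independent strictly sub-Gaussian coefficients\<close>
    and xi_rv: "\<And>k. \<xi> k \<in> borel_measurable M"
    and eta_rv: "\<And>j l. \<eta> j l \<in> borel_measurable M"
    and xi_L2: "\<And>k. integrable M (\<lambda>\<omega>. (\<xi> k \<omega>)\<^sup>2)"
    and eta_L2: "\<And>j l. integrable M (\<lambda>\<omega>. (\<eta> j l \<omega>)\<^sup>2)"
    and xi_centered: "\<And>k. (\<integral>\<omega>. \<xi> k \<omega> \<partial>M) = 0"
    and eta_centered: "\<And>j l. (\<integral>\<omega>. \<eta> j l \<omega> \<partial>M) = 0"
    and xi_orth: "\<And>k l. (\<integral>\<omega>. \<xi> k \<omega> * \<xi> l \<omega> \<partial>M) = (if k = l then 1 else 0)"
    and eta_orth: "\<And>m k n l. (\<integral>\<omega>. \<eta> m k \<omega> * \<eta> n l \<omega> \<partial>M)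
                               = (if m = n \<and> k = l then 1 else 0)"
    and xi_eta_orth: "\<And>k n l. (\<integral>\<omega>. \<xi> k \<omega> * \<eta> n l \<omega> \<partial>M) = 0"
    and indep: "prob_space.indep_vars M (\<lambda>_. borel)
                  (\<lambda>i. case i of Inl k \<Rightarrow> \<xi> k | Inr (j, l) \<Rightarrow> \<eta> j l)
                  (UNIV :: (int + nat \<times> int) set)"
    and xi_ssg: "\<And>k. strictly_sub_gaussian M (\<xi> k)"
    and eta_ssg: "\<And>j l. strictly_sub_gaussian M (\<eta> j l)"
    and expansion: "\<And>t. (\<lambda>n. \<integral>\<omega>. (cmod (complex_of_real (X t \<omega>)
                         - model_X u \<Phi> \<Psi> \<xi> \<eta> n n (\<lambda>_. n) t \<omega>))\<^sup>2 \<partial>M) \<longlonglongrightarrow> 0"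
    \<comment> \<open>regularity assumptions\<close>
    and Phi_ac: "abs_cont \<Phi>"
    and u_ac: "\<And>t. abs_cont (u t)"
    and du: "\<And>t y. (u t has_vector_derivative du t y) (at y)"
    and dPhi: "\<And>y. (\<Phi> has_vector_derivative d\<Phi> y) (at y)"
    and dPsi: "\<And>y. (\<Psi> has_vector_derivative d\<Psi> y) (at y)"
    and dPsi_bd: "\<And>y. cmod (d\<Psi> y) \<le> C"
    and u_bd: "\<And>t y. cmod (u t y) \<le> u1 y"
    and du_bd: "\<And>t y. cmod (du t y) \<le> \<bar>t\<bar> * u2 y"
    and int1: "integrable lborel (\<lambda>y. u1 y * \<bar>y\<bar>)"
    and int2: "integrable lborel u1"
    and int3: "integrable lborel (\<lambda>y. u1 y * cmod (d\<Phi> y))"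
    and int4: "integrable lborel (\<lambda>y. u1 y * cmod (\<Phi> y))"
    and int5: "integrable lborel (\<lambda>y. u2 y * \<bar>y\<bar>)"
    and int6: "integrable lborel (\<lambda>y. u2 y * cmod (\<Phi> y))"
    and lim_psi: "\<And>j t. ((\<lambda>y. u t y * cnj (\<Psi> (y / 2 ^ j))) \<longlongrightarrow> 0) at_infinity"
    and lim_phi: "\<And>t. ((\<lambda>y. u t y * complex_of_real (cmod (\<Phi> y))) \<longlongrightarrow> 0) at_infinity"
    \<comment> \<open>constants\<close>
    and S1_def: "S1 = (LINT y|lborel. u1 y * cmod (d\<Phi> y)) / sqrt (2 * pi)"
    and S2_def: "S2 = (LINT y|lborel. u2 y * cmod (\<Phi> y)) / sqrt (2 * pi)"
    and Q1_def: "Q1 = C / sqrt (2 * pi) * (LINT y|lborel. u1 y)"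
    and Q2_def: "Q2 = C / sqrt (2 * pi) * (LINT y|lborel. u2 y * \<bar>y\<bar>)"
    and D_def: "D = C / sqrt (2 * pi) * (LINT y|lborel. u1 y * \<bar>y\<bar>)"
    and m_def: "m = \<epsilon> * \<delta> powr p /
                 (2 powr (2 * p) * (p / exp 1) powr (p / 2) * T *
                  (SUP t\<in>{0..T}. sqrt (\<integral>\<omega>. exp (2 * p * X t \<omega>) \<partial>M)))"
    and xm: "xm \<ge> 0" "hfun p xm = m"
    \<comment> \<open>choice of the model parameters\<close>
    and N0_pos: "N0 > 0" and N_pos: "N > 0" and Mj_pos: "\<And>j. j < N \<Longrightarrow> Mj j > 0"
    and N0_bd: "real N0 > 6 / xm\<^sup>2 * (S1 + S2 * T)\<^sup>2 + 1"
    and N_bd: "real N > max (1 + log 2 (72 * (Q1 + Q2 * T)\<^sup>2 / (5 * xm\<^sup>2)))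
                            (1 + log 8 (18 * D\<^sup>2 / (7 * xm\<^sup>2)))"
    and Mj_bd: "\<And>j. j < N \<Longrightarrow>
                 real (Mj j) > 1 + 12 / xm\<^sup>2 * (Q1 + Q2 * T)\<^sup>2 * (1 - 1 / 2 ^ N)"
  shows "\<exists>A\<in>sets M.
           {\<omega>\<in>space M.
              (let I = (\<integral>\<^sup>+ t\<in>{0..T}. ennreal ((cmod (complex_of_real (exp (X t \<omega>))
                         - exp (model_X u \<Phi> \<Psi> \<xi> \<eta> N0 N Mj t \<omega>))) powr p) \<partial>lborel)
               in I = \<infinity> \<or> enn2real I powr (1 / p) > \<delta>)} \<subseteq> A
           \<and> measure M A \<le> \<epsilon>"
proof -
  interpret prob_space M by (rule P)
  let ?\<zeta> = "\<lambda>i. case i of Inl k \<Rightarrow> \<xi> k | Inr (j, l) \<Rightarrow> \<eta> j l"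
  have eta_xi_orth: "(\<integral>\<omega>. \<eta> n l \<omega> * \<xi> k \<omega> \<partial>M) = 0" for n l k
    using xi_eta_orth[of k n l] by (simp add: mult.commute)
  interpret W: wavelet_expansion \<phi> \<psi> \<Phi> \<Psi> d\<Phi> d\<Psi> u du u1 u2 C M X ?\<zeta>
  proof unfold_locales
    show "(\<integral>\<omega>. ?\<zeta> i \<omega> * ?\<zeta> i' \<omega> \<partial>M) = (if i = i' then 1 else 0)" for i i'
      by (auto simp: xi_orth eta_orth xi_eta_orth eta_xi_orth split: sum.split)
    show "(\<lambda>n. \<integral>\<omega>. (cmod (complex_of_real (X t \<omega>)
        - (\<Sum>i\<in>midx n n (\<lambda>_. n). complex_of_real (?\<zeta> i \<omega>) * wcoef u \<Phi> \<Psi> i t)))\<^sup>2 \<partial>M) \<longlonglongrightarrow> 0" for t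
      using expansion[of t] by (simp only: model_X_eq)
  qed (use wav Phi Psi du dPhi dPsi dPsi_bd u_bd du_bd int1 int2 int3 int4 int5 int6 X_rv X_L2 xi_rv eta_rv
      xi_L2 eta_L2 msc sep in \<open>auto split: sum.split\<close>)
  have ssg\<zeta>: "strictly_sub_gaussian M (?\<zeta> i)" for i
    using xi_ssg eta_ssg by (auto split: sum.split)
  define Xh where "Xh t \<omega> = (\<Sum>i\<in>midx N0 N Mj. ?\<zeta> i \<omega> * W.rcoef i t)" for t \<omega>
  have model: "model_X u \<Phi> \<Psi> \<xi> \<eta> N0 N Mj t \<omega> = complex_of_real (Xh t \<omega>)" for t \<omega>
    by (simp add: model_X_eq Xh_def W.wcoef_eq_rcoef)
  have Xh_meas: "(\<lambda>(t, \<omega>). Xh t \<omega>) \<in> borel_measurable (lborel \<Otimes>\<^sub>M M)"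
    unfolding Xh_def by measurable
  have Xh_rv: "Xh t \<in> borel_measurable M" for t
    unfolding Xh_def[abs_def] by measurable
  have S2: "S2 \<ge> 0" and S1: "S1 \<ge> 0"
    unfolding S1_def S2_def using W.u1_nonneg W.u2_nonneg by simp_all
  have Q1: "Q1 \<ge> 0" and Q2: "Q2 \<ge> 0" and D: "D \<ge> 0"
    unfolding Q1_def Q2_def D_def using W.u1_nonneg W.u2_nonneg W.C_nonneg
    by (auto intro!: mult_nonneg_nonneg divide_nonneg_nonneg)
  define E2 where "E2 t = (\<integral>\<omega>. exp (2 * p * X t \<omega>) \<partial>M)" for t
  define K where "K = (SUP t\<in>{0..T}. sqrt (E2 t))"
  have ssgX: "strictly_sub_gaussian M (X t)" for t
    by (rule strictly_sub_gaussian_process_member[OF ssg X_rv X_L2])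
  have E2_int: "integrable M (\<lambda>\<omega>. exp (2 * p * X t \<omega>))" for t
    by (rule strictly_sub_gaussian_exp_bound(1)[OF ssgX])
  have E2_nonneg: "E2 t \<ge> 0" for t by (simp add: E2_def)
  have bdd: "bdd_above ((\<lambda>t. sqrt (E2 t)) ` {0..T})"
  proof -
    from W.second_moment_bounded[of 0 T] params(1) obtain B
      where "\<forall>s\<in>{0..T}. (\<integral>\<omega>. (X s \<omega>)\<^sup>2 \<partial>M) \<le> B" by auto
    then have B: "\<And>s. s \<in> {0..T} \<Longrightarrow> (\<integral>\<omega>. (X s \<omega>)\<^sup>2 \<partial>M) \<le> B" by (rule bspec)
    have "sqrt (E2 s) \<le> sqrt (exp ((2 * p)\<^sup>2 * B / 2))" if "s \<in> {0..T}" for s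
    proof -
      have "E2 s \<le> exp ((2 * p)\<^sup>2 * (\<integral>\<omega>. (X s \<omega>)\<^sup>2 \<partial>M) / 2)"
        unfolding E2_def by (rule strictly_sub_gaussian_exp_bound(2)[OF ssgX])
      also have "\<dots> \<le> exp ((2 * p)\<^sup>2 * B / 2)"
        unfolding exp_le_cancel_iff by (intro divide_right_mono mult_left_mono B[OF that]) auto
      finally show ?thesis by simp
    qed
    then show ?thesis by (rule bdd_aboveI2)
  qed
  have E2_le_K: "sqrt (E2 t) \<le> K" if "t \<in> {0..T}" for t
    unfolding K_def by (rule cSUP_upper[OF that bdd])
  \<comment> \<open>K stands in the denominator of m, and division by 0 would make m equal to
    0.\<close>
  have K: "K > 0"
  proof -
    have "E2 0 \<noteq> 0"
    proof
      assume "E2 0 = 0"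
      then have "AE \<omega> in M. exp (2 * p * X 0 \<omega>) = 0"
        unfolding E2_def by (subst (asm) integral_nonneg_eq_0_iff_AE[OF E2_int]) auto
      then show False by simp
    qed
    then have "0 < sqrt (E2 0)" using E2_nonneg[of 0] by simp
    also have "\<dots> \<le> K" using params(1) by (intro E2_le_K) simp
    finally show ?thesis .
  qed
  define c where "c = 2 powr (2 * p) * (p / exp 1) powr (p / 2)"
  have c: "c > 0" using params(2) by (simp add: c_def)
  have m: "m = \<epsilon> * \<delta> powr p / (c * T * K)"
    by (simp add: m_def c_def K_def E2_def)
  have "m > 0" unfolding m using c K params by simp
  \<comment> \<open>\<open>hfun p 0\<close> is 0 because \<open>0 powr p\<close> is, so a positive m
    rules out the root 0.\<close>
  then have x: "xm > 0" using xm params(2) by (cases "xm = 0") (auto simp: hfun_def)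
  obtain Y where Y: "(\<lambda>(t, \<omega>). Y t \<omega>) \<in> borel_measurable (lborel \<Otimes>\<^sub>M M)" "AE \<omega> in M. \<forall>t. X t \<omega> = Y t \<omega>"
    by (rule W.measurable_version)
  have bd: "(\<integral>\<^sup>+\<omega>. ennreal (\<bar>exp (X t \<omega>) - exp (Xh t \<omega>)\<bar> powr p) \<partial>M) \<le> ennreal (\<epsilon> * \<delta> powr p / T)"
    if t: "t \<in> {0..T}" for t
  proof -
    have tail: "(\<Sum>i\<in>J. (W.rcoef i t)\<^sup>2) \<le> xm\<^sup>2" if J: "finite J" "J \<inter> midx N0 N Mj = {}" for J
    proof -
      have "(\<Sum>i\<in>J. (cmod (wcoef u \<Phi> \<Psi> i t))\<^sup>2) \<le> xm\<^sup>2"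
      proof (rule coefficient_tail_sum[where S="S1 + S2 * T" and Q="Q1 + Q2 * T" and D=D])
        show "cmod (wcoef u \<Phi> \<Psi> (Inl k) t) \<le> (S1 + S2 * T) / \<bar>real_of_int k\<bar>" if "k \<noteq> 0" for k
        proof -
          have "cmod (wcoef u \<Phi> \<Psi> (Inl k) t) \<le> (S1 + S2 * \<bar>t\<bar>) / \<bar>real_of_int k\<bar>"
            using W.coef_a_bound[OF that, of t] by (simp add: wcoef_def S1_def S2_def)
          also have "\<dots> \<le> (S1 + S2 * T) / \<bar>real_of_int k\<bar>"
            using t S2 by (intro divide_right_mono add_left_mono mult_left_mono) auto
          finally show ?thesis .
        qed
        show "cmod (wcoef u \<Phi> \<Psi> (Inr (j, l)) t) \<le> 2 powr (- real j / 2) * (Q1 + Q2 * T) / \<bar>real_of_int l\<bar>" if "l \<noteq> 0" for j l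
        proof -
          have "cmod (wcoef u \<Phi> \<Psi> (Inr (j, l)) t) \<le> 2 powr (- real j / 2) * (Q1 + Q2 * \<bar>t\<bar>) / \<bar>real_of_int l\<bar>"
            using W.coef_b_bound[OF that, of j t] by (simp add: wcoef_def Q1_def Q2_def)
          also have "\<dots> \<le> 2 powr (- real j / 2) * (Q1 + Q2 * T) / \<bar>real_of_int l\<bar>"
            using t Q2 by (intro divide_right_mono add_left_mono mult_left_mono) auto
          finally show ?thesis .
        qed
        show "cmod (wcoef u \<Phi> \<Psi> (Inr (j, 0)) t) \<le> 2 powr (- real j / 2) * D / 2 ^ j" for j
          using W.coef_b_scale_bound[of j 0 t] by (simp add: wcoef_def D_def)
      qed (use S1 S2 Q1 Q2 D params x N0_bd N_bd Mj_bd N_pos J in auto)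
      then show ?thesis by (simp add: W.wcoef_eq_rcoef)
    qed
    have "(\<integral>\<^sup>+\<omega>. ennreal (\<bar>exp (X t \<omega>) - exp (Xh t \<omega>)\<bar> powr p) \<partial>M)
        \<le> ennreal (2 powr (2 * p) * (p / exp 1) powr (p / 2) * hfun p xm * sqrt (E2 t))"
    proof (rule exp_difference_moment_bound[OF X_rv Xh_rv emeasure_space_1 params(2) x E2_nonneg])
      show "(\<integral>\<^sup>+\<omega>. ennreal (exp (l * (X t \<omega> - Xh t \<omega>))) \<partial>M) \<le> ennreal (exp (l\<^sup>2 * xm\<^sup>2 / 2))" for l
        unfolding Xh_def by (rule W.tail_exp_bound[OF indep ssg\<zeta> finite_midx tail])
      show "(\<integral>\<^sup>+\<omega>. ennreal (exp (2 * p * X t \<omega>)) \<partial>M) \<le> ennreal (E2 t)"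
        unfolding E2_def by (subst nn_integral_eq_integral[OF E2_int]) auto
    qed
    also have "\<dots> \<le> ennreal (c * m * K)"
      unfolding xm(2) c_def[symmetric] using c \<open>m > 0\<close> E2_le_K[OF t]
      by (intro ennreal_leI mult_left_mono) auto
    \<comment> \<open>m was chosen so that the moment constant c and the supremum K cancel; the
      remaining T is absorbed by integrating over [0,T].\<close>
    also have "c * m * K = \<epsilon> * \<delta> powr p / T"
      unfolding m using c K params(1) by simp
    finally show ?thesis .
  qed
  show ?thesis
    unfolding model
    using markov_time_integral[OF Y(1) Xh_meas Y(2) params(1-4) bd]
    by (simp add: exp_of_real flip: of_real_diff)
qed

end
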